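(* Let $F:\mathbb{R}^n\rightrightarrows\mathbb{R}^n$ be a multifunction such that: (i) $F(x)$ is nonempty, convex and compact for each $x\in\mathbb{R}^n$; (ii) $F$ is locally Lipschitz with respect to the Hausdorff metric; (iii) there exists $\rho>0$ with $\max\{|v|: v\in F(x)\}\le \rho(1+|x|)$ for all $x\in\mathbb{R}^n$. Let $H(x,p)=\sup_{v\in F(x)}\langle v,p\rangle$ and assume that for every nonempty, convex, compact $K\subset\mathbb{R}^n$: (iv) there exists $c\ge 0$ such that, for every $p\in\mathbb{R}^n$, the map $x\mapsto H(x,p)$ is semiconvex on $K$ with constant $c|p|$; (v) the gradient $\nabla_pH(x,p)$ exists for all $x\in K$, $p\neq 0$, and is locally Lipschitz in $x$ on $K$, uniformly over $p$ in any compact subset of $\mathbb{R}^n\smallsetminus\{0\}$. Let $\phi:\mathbb{R}^n\to\mathbb{R}$ be locally semiconcave and let $F$ be locally strongly convex. A trajectory $\overline{x}:[t_0,T]\to\mathbb{R}^n$ (that is, an absolutely continuous arc with $\dot{\overline x}(s)\in F(\overline x(s))$ for a.e. $s\in[t_0,T]$ and $\overline x(t_0)=x_0$) is optimal for the Mayer problem $\mathcal{P}(t_0,x_0)$ if and only if, for every $q\in\partial^+\phi(\overline{x}(T))$, any absolutely continuous solution $\overline{p}:[t_0,T]\to\mathbb{R}^n$ of the differential inclusion $$-\dot{p}(t)\in\partial_x^-H(\overline{x}(t),p(t))\quad\text{for a.e. } t\in[t_0,T]$$ with the transversality condition $-\overline{p}(T)=q$ satisfies the full sensitivity relation $$\bigl(H(\overline{x}(t),\overline{p}(t)),-\overline{p}(t)\bigr)\in\partial^+V(t,\overline{x}(t))\quad\text{for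 all } t\in(t_0,T)$$ and the maximum principle $$H(\overline{x}(t),\overline{p}(t))=\langle\overline{p}(t),\dot{\overline{x}}(t)\rangle\quad\text{for a.e. } t\in[t_0,T].$$
   Context: $T>0$ is fixed, $|\cdot|$ is the Euclidean norm, $\langle\cdot,\cdot\rangle$ the inner product. Mayer problem. For $(t_0,x_0)\in[0,T]\times\mathbb{R}^n$, a trajectory is an absolutely continuous $x:[t_0,T]\to\mathbb{R}^n$ with $\dot x(s)\in F(x(s))$ for a.e. $s\in[t_0,T]$ and $x(t_0)=x_0$. The problem $\mathcal{P}(t_0,x_0)$ is to minimize $\phi(x(T))$ over all such trajectories; an optimal solution is a trajectory attaining the infimum. The value function $V:[0,T]\times\mathbb{R}^n\to\mathbb{R}$ is $V(t_0,x_0)=\inf\phi(x(T))$, the infimum being over all trajectories with $x(t_0)=x_0$. Semiconcavity/semiconvexity. A function $u$ is (linearly) semiconcave on a set $A$ if it is continuous on $A$ and there is a constant $C$ with $u(x+h)+u(x-h)-2u(x)\le C|h|^2$ for all $x,h$ with the segment $[x-h,x+h]\subset A$; $C$ is a semiconcavity constant. $u$ is semiconvex with constant $C$ if $-u$ is semiconcave with constant $C$. $u$ is locally semiconcave if each point has an open neighborhood on which $u$ is semiconcave. Strong convexity. For a convex set $A\subset\mathbb{R}^n$ and $z\in A$, the normal cone is $N_A(z)=\{p\in\mathbb{R}^n:\langle p,v-z\rangle\le 0\ \forall v\in A\}$. A compact convex set $A$ is $R$-convex ($R>0$) if for all $z,y\in\partial A$ (the boundary of $A$) and all $n\in N_A(z)$,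 $m\in N_A(y)$ with $|n|=|m|=1$ one has $|z-y|\le R|n-m|$. $F$ is locally strongly convex if for each compact $K\subset\mathbb{R}^n$ there exists $R>0$ such that $F(x)$ is $R$-convex for every $x\in K$. Generalized differentials. The Fréchet subdifferential $\partial^-f(x)$ is the set of $p$ with $\liminf_{y\to x}\frac{f(y)-f(x)-\langle p,y-x\rangle}{|y-x|}\ge 0$, and the Fréchet superdifferential $\partial^+f(x)$ is the set of $p$ with $\limsup_{y\to x}\frac{f(y)-f(x)-\langle p,y-x\rangle}{|y-x|}\le 0$. $\partial_x^-H(x,p)$ is the Fréchet subdifferential of $H(\cdot,p)$ at $x$; $\partial^+V(t,x)\subset\mathbb{R}\times\mathbb{R}^n$ is the Fréchet superdifferential of $V$ jointly in $(t,x)$. *)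

theory Defs
  imports "HOL-Analysis.Analysis"
begin

text \<open>The sum over \<open>d\<close> ranges over finite families of nonempty closed intervals with pairwise
  disjoint interiors; \<open>Inf k\<close> and \<open>Sup k\<close> are the end points of the interval \<open>k\<close>.\<close>

definition abs_continuous_on :: "real set \<Rightarrow> (real \<Rightarrow> 'a::real_normed_vector) \<Rightarrow> bool" where
  "abs_continuous_on S f \<longleftrightarrow>
    (\<forall>\<epsilon>>0. \<exists>\<delta>>0. \<forall>d. d division_of \<Union>d \<and> \<Union>d \<subseteq> S \<and> (\<Sum>k\<in>d. (Sup k - Inf k)) < \<delta> \<longrightarrow>
      (\<Sum>k\<in>d. norm (f (Sup k) - f (Inf k))) < \<epsilon>)"

text \<open>Intended for nonempty bounded sets, where the suprema exist.\<close>

definition hausdorff_dist :: "'a::metric_space set \<Rightarrow> 'a set \<Rightarrow> real" where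
  "hausdorff_dist A B = max (SUP a\<in>A. infdist a B) (SUP b\<in>B. infdist b A)"

definition locally_hausdorff_lipschitz ::
    "('a::metric_space \<Rightarrow> 'b::metric_space set) \<Rightarrow> bool" where
  "locally_hausdorff_lipschitz F \<longleftrightarrow>
    (\<forall>x. \<exists>e>0. \<exists>L\<ge>0. \<forall>y\<in>ball x e. \<forall>z\<in>ball x e. hausdorff_dist (F y) (F z) \<le> L * dist y z)"

definition semiconcave_on_with ::
    "real \<Rightarrow> 'a::real_normed_vector set \<Rightarrow> ('a \<Rightarrow> real) \<Rightarrow> bool" where
  "semiconcave_on_with C A u \<longleftrightarrow> continuous_on A u \<and>
    (\<forall>x h. closed_segment (x - h) (x + h) \<subseteq> A \<longrightarrow>
      u (x + h) + u (x - h) - 2 * u x \<le> C * (norm h)\<^sup>2)"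

definition semiconvex_on_with ::
    "real \<Rightarrow> 'a::real_normed_vector set \<Rightarrow> ('a \<Rightarrow> real) \<Rightarrow> bool" where
  "semiconvex_on_with C A u \<longleftrightarrow> semiconcave_on_with C A (\<lambda>x. - u x)"

definition locally_semiconcave :: "('a::real_normed_vector \<Rightarrow> real) \<Rightarrow> bool" where
  "locally_semiconcave u \<longleftrightarrow> (\<forall>x. \<exists>U. open U \<and> x \<in> U \<and> (\<exists>C. semiconcave_on_with C U u))"

definition normal_cone :: "'a::real_inner set \<Rightarrow> 'a \<Rightarrow> 'a set" where
  "normal_cone A z = {p. \<forall>v\<in>A. p \<bullet> (v - z) \<le> 0}"

definition R_convex :: "real \<Rightarrow> 'a::real_inner set \<Rightarrow> bool" where
  "R_convex R A \<longleftrightarrow> compact A \<and> convex A \<and>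
    (\<forall>z\<in>frontier A. \<forall>y\<in>frontier A. \<forall>n\<in>normal_cone A z. \<forall>m\<in>normal_cone A y.
      norm n = 1 \<and> norm m = 1 \<longrightarrow> norm (z - y) \<le> R * norm (n - m))"

definition locally_strongly_convex ::
    "('a::topological_space \<Rightarrow> 'b::real_inner set) \<Rightarrow> bool" where
  "locally_strongly_convex F \<longleftrightarrow> (\<forall>K. compact K \<longrightarrow> (\<exists>R>0. \<forall>x\<in>K. R_convex R (F x)))"

text \<open>\<open>S\<close> is the domain of \<open>f\<close>: difference quotients are only taken at points of \<open>S\<close>.\<close>

definition frechet_subdiff :: "'a::real_inner set \<Rightarrow> ('a \<Rightarrow> real) \<Rightarrow> 'a \<Rightarrow> 'a set" where
  "frechet_subdiff S f x =
    {p. Liminf (at x within S) (\<lambda>y. ereal ((f y - f x - p \<bullet> (y - x)) / norm (y - x))) \<ge> 0}"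

definition frechet_superdiff :: "'a::real_inner set \<Rightarrow> ('a \<Rightarrow> real) \<Rightarrow> 'a \<Rightarrow> 'a set" where
  "frechet_superdiff S f x =
    {p. Limsup (at x within S) (\<lambda>y. ereal ((f y - f x - p \<bullet> (y - x)) / norm (y - x))) \<le> 0}"

definition hamiltonian :: "('a::real_inner \<Rightarrow> 'a set) \<Rightarrow> 'a \<Rightarrow> 'a \<Rightarrow> real" where
  "hamiltonian F x p = (SUP v\<in>F x. v \<bullet> p)"

text \<open>Arcs are total functions of which only the values on \<open>{t0..T}\<close> matter.\<close>

definition trajectory ::
    "('a::real_inner \<Rightarrow> 'a set) \<Rightarrow> real \<Rightarrow> real \<Rightarrow> 'a \<Rightarrow> (real \<Rightarrow> 'a) \<Rightarrow> bool" where
  "trajectory F T t0 x0 x \<longleftrightarrow> abs_continuous_on {t0..T} x \<and>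
    (AE s\<in>{t0..T} in lebesgue.
      \<exists>v\<in>F (x s). (x has_vector_derivative v) (at s within {t0..T})) \<and>
    x t0 = x0"

definition value_function ::
    "('a::real_inner \<Rightarrow> 'a set) \<Rightarrow> ('a \<Rightarrow> real) \<Rightarrow> real \<Rightarrow> real \<times> 'a \<Rightarrow> real" where
  "value_function F \<phi> T = (\<lambda>(t0, x0). INF x\<in>{x. trajectory F T t0 x0 x}. \<phi> (x T))"

definition mayer_optimal ::
    "('a::real_inner \<Rightarrow> 'a set) \<Rightarrow> ('a \<Rightarrow> real) \<Rightarrow> real \<Rightarrow> real \<Rightarrow> 'a \<Rightarrow> (real \<Rightarrow> 'a) \<Rightarrow> bool" where
  "mayer_optimal F \<phi> T t0 x0 x \<longleftrightarrow>
    trajectory F T t0 x0 x \<and> \<phi> (x T) = value_function F \<phi> T (t0, x0)"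

definition adjoint_arc ::
    "('a::real_inner \<Rightarrow> 'a set) \<Rightarrow> real \<Rightarrow> real \<Rightarrow> (real \<Rightarrow> 'a) \<Rightarrow> (real \<Rightarrow> 'a) \<Rightarrow> bool" where
  "adjoint_arc F T t0 x p \<longleftrightarrow> abs_continuous_on {t0..T} p \<and>
    (AE t\<in>{t0..T} in lebesgue. \<exists>w. (p has_vector_derivative w) (at t within {t0..T}) \<and>
      - w \<in> frechet_subdiff UNIV (\<lambda>y. hamiltonian F y (p t)) (x t))"

end

theory Submission
  imports Defs
begin

text \<open>Let \<open>f x p\<close> be the point of \<open>F x\<close> that maximizes \<open>v \<bullet> p\<close>. If an arc \<open>y\<close> follows
  \<open>y' = f y p\<close>, then \<open>p \<bullet> (y - x)\<close> grows at least by the integral of the gap \<open>H x p - x' \<bullet> p\<close>, up to an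
  error quadratic in \<open>y - x\<close>, because \<open>- p'\<close> is a subgradient of the semiconvex function \<open>H (\<cdot>) p\<close>.
  Comparing \<open>\<phi>\<close> at the end points of \<open>x\<close> and \<open>y\<close> through its semiconcavity gives two things for every
  adjoint arc of an optimal \<open>x\<close>. By strong convexity the gap dominates the squared distance of \<open>x'\<close> from
  \<open>f x p\<close>, so it must vanish, first near the final time and then, going backwards in steps of uniform
  length, everywhere; this is the maximum principle. Once \<open>x' = f x p\<close>, the same comparison for arcs \<open>y\<close>
  that start near \<open>x\<close> bounds the value function from above by an affine function up to a quadratic error,
  which is the sensitivity relation. Conversely, the two relations for a single adjoint arc force the value
  function to be nonincreasing along \<open>x\<close>. An adjoint arc exists by Filippov's theorem, since the
  subdifferential of \<open>H (\<cdot>) p\<close> depends on \<open>p\<close> in a Lipschitz manner.\<close>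

section \<open>Absolutely continuous functions and the Lebesgue integral\<close>

text \<open>The adjoint inclusion restricts \<open>p'\<close> only; it says nothing about
  \<open>x'\<close>, so the maximum principle cannot be read off from \<open>p\<close> and has to be
  extracted from optimality. The comparison yields one-sided inequalities with quadratic errors, and
  the strong convexity gap is quadratic as well, which is why short steps win. The point
  \<open>f x p\<close> is determined only for \<open>p \<noteq> 0\<close>. Subgradients of
  \<open>H\<close> at \<open>p\<close> are bounded by a multiple of \<open>norm p\<close>, so by
  Gronwall's inequality an adjoint arc vanishes everywhere or nowhere. If it vanishes, the maximum
  principle is trivial and the sensitivity relation only needs arcs near \<open>x\<close> from
  nearby starting points. The equation \<open>y' = f y p\<close> is treated as an inclusion with
  singleton values: Filippov's theorem then gives existence together with a bound of
  \<open>y - x\<close> by the integral of \<open>norm (x' - f x p)\<close>. The same theorem serves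
  for adjoint arcs. A superdifferential bounds the value function from above only. The converse
  therefore rests on an upper Dini derivative, together with the fact that the value function cannot
  jump upward along a trajectory.\<close>

lemma AE_on_lebesgue_iff: "(AE x\<in>S in lebesgue. P x) \<longleftrightarrow> negligible {x\<in>S. \<not> P x}"
proof -
  have "(AE x\<in>S in lebesgue. P x) \<longleftrightarrow> (\<exists>N. N \<in> null_sets lebesgue \<and> {x\<in>S. \<not> P x} \<subseteq> N)"
    unfolding eventually_ae_filter by auto
  also have "\<dots> \<longleftrightarrow> negligible {x\<in>S. \<not> P x}"
    unfolding negligible_iff_null_sets [symmetric] using negligible_subset by blast
  finally show ?thesis .
qed

lemma abs_continuous_on_subset:
  "abs_continuous_on S f \<Longrightarrow> R \<subseteq> S \<Longrightarrow> abs_continuous_on R f"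
  unfolding abs_continuous_on_def by (meson subset_trans)

lemma lipschitz_on_imp_abs_continuous_on:
  fixes f :: "real \<Rightarrow> 'a::real_normed_vector"
  assumes "L-lipschitz_on S f"
  shows "abs_continuous_on S f"
  unfolding abs_continuous_on_def
proof (intro allI impI)
  fix e :: real assume e: "e > 0"
  have L: "L \<ge> 0" using assms by (rule lipschitz_on_nonneg)
  show "\<exists>\<delta>>0. \<forall>d. d division_of \<Union> d \<and> \<Union> d \<subseteq> S \<and> (\<Sum>k\<in>d. Sup k - Inf k) < \<delta> \<longrightarrow>
      (\<Sum>k\<in>d. norm (f (Sup k) - f (Inf k))) < e"
  proof (intro exI[of _ "e / (L + 1)"] conjI allI impI)
    show "e / (L + 1) > 0" using e L by simp
    fix d assume d: "d division_of \<Union> d \<and> \<Union> d \<subseteq> S \<and> (\<Sum>k\<in>d. Sup k - Inf k) < e / (L + 1)"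
    have "norm (f (Sup k) - f (Inf k)) \<le> L * (Sup k - Inf k)" if k: "k \<in> d" for k
    proof -
      obtain u v where uv: "k = cbox u v" "k \<noteq> {}"
        using d k division_ofD(3,4)[of d "\<Union>d" k] by blast
      then have "u \<le> v" by auto
      then have "Sup k = v" "Inf k = u" "u \<in> k" "v \<in> k" using uv by auto
      moreover have "k \<subseteq> S" using k d by blast
      ultimately show ?thesis
        using lipschitz_onD[OF assms, of v u] \<open>u \<le> v\<close> by (auto simp: dist_norm)
    qed
    then have "(\<Sum>k\<in>d. norm (f (Sup k) - f (Inf k))) \<le> L * (\<Sum>k\<in>d. Sup k - Inf k)"
      by (simp add: sum_distrib_left sum_mono)
    also have "\<dots> \<le> L * (e / (L + 1))" using d L by (intro mult_left_mono) auto
    also have "\<dots> < e" using L e by (simp add: field_simps)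
    finally show "(\<Sum>k\<in>d. norm (f (Sup k) - f (Inf k))) < e" .
  qed
qed

lemma abs_continuous_on_imp_continuous_on:
  fixes f :: "real \<Rightarrow> 'a::real_normed_vector"
  assumes "abs_continuous_on {a..b} f"
  shows "continuous_on {a..b} f"
  unfolding continuous_on_iff
proof (intro ballI allI impI)
  fix x e :: real assume x: "x \<in> {a..b}" and e: "e > 0"
  obtain d where d: "d > 0" and D: "\<And>D. D division_of \<Union>D \<Longrightarrow> \<Union>D \<subseteq> {a..b} \<Longrightarrow>
      (\<Sum>k\<in>D. Sup k - Inf k) < d \<Longrightarrow> (\<Sum>k\<in>D. norm (f (Sup k) - f (Inf k))) < e"
    using assms e unfolding abs_continuous_on_def by meson
  have *: "norm (f v - f u) < e" if "u \<in> {a..b}" "v \<in> {a..b}" "u \<le> v" "v - u < d" for u v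
  proof -
    have "{{u..v}} division_of \<Union>{{u..v}}" using that
      by (metis atLeastatMost_empty_iff2 box_real(2) ccpo_Sup_singleton cbox_interval division_of_self not_le)
    then show ?thesis using D[of "{{u..v}}"] that by auto
  qed
  show "\<exists>d>0. \<forall>x'\<in>{a..b}. dist x' x < d \<longrightarrow> dist (f x') (f x) < e"
  proof (intro exI[of _ d] conjI ballI impI)
    fix y assume y: "y \<in> {a..b}" "dist y x < d"
    show "dist (f y) (f x) < e"
    proof (cases "x \<le> y")
      case True then show ?thesis using *[of x y] x y by (auto simp: dist_norm dist_real_def)
    next
      case False then show ?thesis using *[of y x] x y by (auto simp: dist_norm dist_real_def norm_minus_commute)
    qed
  qed (rule d)
qed

lemma negligible_subset_open:
  fixes E :: "real set"
  assumes E: "negligible E" and d: "d > 0"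
  obtains U where "open U" "E \<subseteq> U" "U \<in> lmeasurable" "measure lebesgue U < d"
proof -
  have Es: "E \<in> sets lebesgue" using E by (simp add: negligible_imp_sets)
  obtain U where U: "open U" "E \<subseteq> U" "(U - E) \<in> lmeasurable" "emeasure lebesgue (U - E) < ennreal d"
    using sets_lebesgue_outer_open[OF Es d] by blast
  have UE: "U = (U - E) \<union> E" using U by auto
  have "U - E \<union> E \<in> lmeasurable"
    using U E by (intro fmeasurable.Un) (auto simp: negligible_imp_measurable)
  with UE have 1: "U \<in> lmeasurable" by simp
  have "measure lebesgue U = measure lebesgue (U - E)"
    using U E UE measure_Un_null_set[of "U - E" lebesgue E]
    by (simp add: negligible_iff_null_sets fmeasurableD)
  also have "\<dots> < d" using U d
    by (simp add: emeasure_eq_measure2 ennreal_less_iff)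
  finally show thesis using that U 1 by blast
qed

text \<open>The gauge is tailored to absolute continuity: intervals tagged in \<open>E\<close> are
  forced into an open set of small measure, so the increments of \<open>f\<close> over them are
  small in total; at all other tags differentiability compares the increment with
  \<open>g\<close>.\<close>

lemma abs_continuous_has_integral:
  fixes f :: "real \<Rightarrow> 'a::banach"
  assumes ab: "a \<le> b" and ac: "abs_continuous_on {a..b} f" and E: "negligible E"
    and der: "\<And>t. t \<in> {a..b} - E \<Longrightarrow> (f has_vector_derivative g t) (at t within {a..b})"
  shows "(g has_integral (f b - f a)) {a..b}"
proof (cases "a = b")
  case True then show ?thesis using has_integral_refl(2)[of g b] by simp
next
  case False
  with ab have ab': "a < b" by simp
  \<comment> \<open>The value zero on \<open>E\<close> removes these tags from the Riemann sum, so
    that only increments of \<open>f\<close> remain to be estimated there. The change from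
    \<open>g\<close> is undone at the end because \<open>E\<close> is negligible.\<close>
  define g' where "g' t = (if t \<in> E then 0 else g t)" for t
  have "(g' has_integral (f b - f a)) {a..b}"
    unfolding has_integral_factor_content_real
  proof (intro allI impI)
    fix e :: real assume e: "e > 0"
    define e' where "e' = e / 2 * (b - a)"
    have e': "e' > 0" using e ab' by (simp add: e'_def)
    obtain d where d: "d > 0" and D: "\<And>D. D division_of \<Union>D \<Longrightarrow> \<Union>D \<subseteq> {a..b} \<Longrightarrow>
        (\<Sum>k\<in>D. Sup k - Inf k) < d \<Longrightarrow> (\<Sum>k\<in>D. norm (f (Sup k) - f (Inf k))) < e'"
      using ac e' unfolding abs_continuous_on_def by meson
    obtain U where U: "open U" "E \<subseteq> U" and Um: "U \<in> lmeasurable" "measure lebesgue U < d"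
      using negligible_subset_open[OF E d] by blast
    have "\<exists>r>0. \<forall>y\<in>{a..b}. \<bar>y - t\<bar> < r \<longrightarrow> norm (f y - f t - (y - t) *\<^sub>R g t) \<le> e / 2 * \<bar>y - t\<bar>"
      if "t \<in> {a..b} - E" for t
      using der[OF that] e unfolding has_vector_derivative_def has_derivative_within_alt
      by (fastforce dest: spec[of _ "e/2"])
    then obtain r where r: "\<And>t. t \<in> {a..b} - E \<Longrightarrow> r t > 0"
      "\<And>t y. t \<in> {a..b} - E \<Longrightarrow> y\<in>{a..b} \<Longrightarrow> \<bar>y - t\<bar> < r t \<Longrightarrow>
          norm (f y - f t - (y - t) *\<^sub>R g t) \<le> e / 2 * \<bar>y - t\<bar>"
      by metis
    define \<gamma> where "\<gamma> t = (if t \<in> E then U else if t \<in> {a..b} then ball t (r t) else ball t 1)" for t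
    have g: "gauge \<gamma>"
      using U r by (auto simp: gauge_def \<gamma>_def)
    show "\<exists>d. gauge d \<and> (\<forall>p. p tagged_division_of {a..b} \<and> d fine p \<longrightarrow>
        norm ((\<Sum>(x, k)\<in>p. measure lborel k *\<^sub>R g' x) - (f b - f a)) \<le> e * measure lborel {a..b})"
    proof (intro exI conjI allI impI, rule g)
      fix p assume p: "p tagged_division_of {a..b} \<and> \<gamma> fine p"
      then have fin: "finite p" using tagged_division_of_finite by blast
      define p1 where "p1 = {xk\<in>p. fst xk \<in> E}"
      define p2 where "p2 = {xk\<in>p. fst xk \<notin> E}"
      have P: "p = p1 \<union> p2" "p1 \<inter> p2 = {}" "finite p1" "finite p2"
        using fin by (auto simp: p1_def p2_def)
      have iv: "\<exists>u v. k = {u..v} \<and> u \<le> v \<and> x \<in> {u..v} \<and> u \<in> {a..b} \<and> v \<in> {a..b} \<and> {u..v} \<subseteq> \<gamma> x"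
        if xk: "(x,k) \<in> p" for x k
      proof -
        have "x \<in> k" "k \<subseteq> {a..b}" using tagged_division_ofD(2,3)[OF conjunct1[OF p]] xk by auto
        moreover obtain u v where "k = cbox u v" using tagged_division_ofD(4)[OF conjunct1[OF p]] xk by blast
        moreover have "k \<subseteq> \<gamma> x" using p xk by (auto simp: fine_def)
        ultimately show ?thesis
          by (intro exI[of _ u] exI[of _ v]) auto
      qed
      have "(\<Sum>(x, k)\<in>p. measure lborel k *\<^sub>R g' x) - (f b - f a) =
          (\<Sum>(x, k)\<in>p. measure lborel k *\<^sub>R g' x - (f (Sup k) - f (Inf k)))"
        using additive_tagged_division_1[OF ab, of p f] p
        by (simp add: sum_subtractf case_prod_unfold)
      also have "\<dots> = (\<Sum>(x, k)\<in>p1. measure lborel k *\<^sub>R g' x - (f (Sup k) - f (Inf k))) +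
          (\<Sum>(x, k)\<in>p2. measure lborel k *\<^sub>R g' x - (f (Sup k) - f (Inf k)))"
        unfolding P(1) using P by (intro sum.union_disjoint) auto
      finally have eq: "(\<Sum>(x, k)\<in>p. measure lborel k *\<^sub>R g' x) - (f b - f a) = \<dots>" .
      have b1: "norm (\<Sum>(x, k)\<in>p1. measure lborel k *\<^sub>R g' x - (f (Sup k) - f (Inf k))) \<le> e'"
      proof -
        have pp: "p1 tagged_partial_division_of {a..b}"
          using p tagged_division_of_def tagged_partial_division_subset by (metis P(1) Un_upper1)
        have td: "p1 tagged_division_of \<Union>(snd ` p1)"
          using pp by (rule tagged_partial_division_of_Union_self)
        have dv: "snd ` p1 division_of \<Union>(snd ` p1)"
          using pp by (rule partial_division_of_tagged_division)
        have sub: "\<Union>(snd ` p1) \<subseteq> U \<inter> {a..b}"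
        proof
          fix y assume "y \<in> \<Union>(snd ` p1)"
          then obtain x k where xk: "(x,k) \<in> p" "x \<in> E" "y \<in> k" by (auto simp: p1_def)
          with iv[OF xk(1)] show "y \<in> U \<inter> {a..b}" by (auto simp: \<gamma>_def)
        qed
        have "(\<Sum>k\<in>snd ` p1. Sup k - Inf k) = (\<Sum>k\<in>snd ` p1. measure lebesgue k)"
        proof (rule sum.cong)
          fix k assume "k \<in> snd ` p1"
          then obtain x where "(x,k) \<in> p" by (auto simp: p1_def)
          from iv[OF this] show "Sup k - Inf k = measure lebesgue k" by auto
        qed simp
        also have "\<dots> = measure lebesgue (\<Union>(snd ` p1))"
          using content_division[OF dv] by simp
        also have "\<dots> \<le> measure lebesgue U"
        proof (rule measure_mono_fmeasurable)
          show "\<Union>(snd ` p1) \<in> sets lebesgue"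
            using dv lmeasurable_division by blast
        qed (use sub Um in auto)
        also have "\<dots> < d" by (rule Um)
        finally have "(\<Sum>k\<in>snd ` p1. norm (f (Sup k) - f (Inf k))) < e'"
          using D[OF dv] sub by auto
        moreover have "(\<Sum>(x,k)\<in>p1. norm (f (Sup k) - f (Inf k))) = (\<Sum>k\<in>snd ` p1. norm (f (Sup k) - f (Inf k)))"
        proof -
          \<comment> \<open>Passing from a sum over tagged pairs to a sum over intervals needs a
            summand that vanishes on intervals without interior, since two tags may share a
            degenerate interval. The empty interval is assigned zero because its \<open>Sup\<close>
            and \<open>Inf\<close> are meaningless.\<close>
          define h where "h k = (if k = {} then 0 else norm (f (Sup k) - f (Inf k)))" for k
          have h: "h k = norm (f (Sup k) - f (Inf k))" if "(x,k) \<in> p1" for x k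
          proof -
            have "(x,k) \<in> p" using that by (simp add: p1_def)
            from iv[OF this] have "k \<noteq> {}" by auto
            then show ?thesis by (simp add: h_def)
          qed
          have "(\<Sum>(x,k)\<in>p1. h k) = (\<Sum>k\<in>snd ` p1. h k)"
          proof (rule sum.over_tagged_division_lemma[OF td])
            fix u v :: real assume "box u v = {}"
            then have "v \<le> u" by auto
            then show "h (cbox u v) = 0" by (cases "u = v") (auto simp: h_def)
          qed
          moreover have "(\<Sum>(x,k)\<in>p1. h k) = (\<Sum>(x,k)\<in>p1. norm (f (Sup k) - f (Inf k)))"
          proof (rule sum.cong)
            fix xk assume "xk \<in> p1"
            then show "(case xk of (x, k) \<Rightarrow> h k) = (case xk of (x, k) \<Rightarrow> norm (f (Sup k) - f (Inf k)))"
              using h[of "fst xk" "snd xk"] by (simp add: case_prod_unfold)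
          qed simp
          moreover have "(\<Sum>k\<in>snd ` p1. h k) = (\<Sum>k\<in>snd ` p1. norm (f (Sup k) - f (Inf k)))"
          proof (rule sum.cong)
            fix k assume "k \<in> snd ` p1"
            then obtain x where "(x,k) \<in> p1" by auto
            then show "h k = norm (f (Sup k) - f (Inf k))" by (rule h)
          qed simp
          ultimately show ?thesis by simp
        qed
        moreover have "norm (\<Sum>(x, k)\<in>p1. measure lborel k *\<^sub>R g' x - (f (Sup k) - f (Inf k))) \<le>
            (\<Sum>(x,k)\<in>p1. norm (f (Sup k) - f (Inf k)))"
          by (rule sum_norm_le) (auto simp: p1_def g'_def norm_minus_commute)
        ultimately show ?thesis by linarith
      qed
      have b2: "norm (\<Sum>(x, k)\<in>p2. measure lborel k *\<^sub>R g' x - (f (Sup k) - f (Inf k))) \<le> e'"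
      proof -
        have "norm (\<Sum>(x, k)\<in>p2. measure lborel k *\<^sub>R g' x - (f (Sup k) - f (Inf k))) \<le> (\<Sum>(x,k)\<in>p2. e / 2 * measure lborel k)"
        proof (rule sum_norm_le, clarify)
          fix x k assume "(x,k) \<in> p2"
          then have xk: "(x,k) \<in> p" "x \<notin> E" by (auto simp: p2_def)
          from iv[OF xk(1)] obtain u v where uv: "k = {u..v}" "u \<le> v" "x \<in> {u..v}" "u \<in> {a..b}" "v \<in> {a..b}" "{u..v} \<subseteq> \<gamma> x"
            by blast
          have xE: "x \<in> {a..b} - E" using uv xk by auto
          have "{u..v} \<subseteq> ball x (r x)" using uv xE by (auto simp: \<gamma>_def)
          moreover have "u \<in> {u..v}" "v \<in> {u..v}" using uv by auto
          ultimately have "u \<in> ball x (r x)" "v \<in> ball x (r x)" by blast+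
          then have uv': "\<bar>u - x\<bar> < r x" "\<bar>v - x\<bar> < r x"
            by (auto simp: dist_real_def)
          \<comment> \<open>The error is split at the tag. As \<open>x\<close> lies between
            \<open>u\<close> and \<open>v\<close>, the distances to the two end points add up to
            exactly the length of the interval.\<close>
          have "measure lborel k *\<^sub>R g' x - (f (Sup k) - f (Inf k)) =
              (f u - f x - (u - x) *\<^sub>R g x) - (f v - f x - (v - x) *\<^sub>R g x)"
            using uv xE by (simp add: g'_def algebra_simps)
          then have "norm (measure lborel k *\<^sub>R g' x - (f (Sup k) - f (Inf k))) \<le> e / 2 * \<bar>u - x\<bar> + e / 2 * \<bar>v - x\<bar>"
            using r(2)[OF xE uv(4) uv'(1)] r(2)[OF xE uv(5) uv'(2)]
              norm_triangle_ineq4[of "f u - f x - (u - x) *\<^sub>R g x" "f v - f x - (v - x) *\<^sub>R g x"]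
            by (smt (verit) add_mono)
          also have "\<dots> = e / 2 * measure lborel k" using uv by (simp add: field_simps)
          finally show "norm (measure lborel k *\<^sub>R g' x - (f (Sup k) - f (Inf k))) \<le> e / 2 * measure lborel k" .
        qed
        also have "\<dots> \<le> (\<Sum>(x,k)\<in>p. e / 2 * measure lborel k)"
          using P fin e by (intro sum_mono2) auto
        also have "\<dots> = e / 2 * (\<Sum>(x,k)\<in>p. measure lborel k)"
          by (simp add: sum_distrib_left case_prod_unfold)
        also have "\<dots> = e'"
          using additive_content_tagged_division[of p a b] p ab by (simp add: e'_def)
        finally show ?thesis .
      qed
      show "norm ((\<Sum>(x, k)\<in>p. measure lborel k *\<^sub>R g' x) - (f b - f a)) \<le> e * measure lborel {a..b}"
        unfolding eq using b1 b2 ab by (auto simp: e'_def intro!: order_trans[OF norm_triangle_ineq])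
    qed
  qed
  then show ?thesis
    by (rule has_integral_spike[OF E, rotated]) (auto simp: g'_def)
qed


lemma abs_continuous_has_integral_subinterval:
  fixes f :: "real \<Rightarrow> 'a::banach"
  assumes st: "a \<le> s" "s \<le> t" "t \<le> b" and ac: "abs_continuous_on {a..b} f" and E: "negligible E"
    and der: "\<And>t. t \<in> {a..b} - E \<Longrightarrow> (f has_vector_derivative g t) (at t within {a..b})"
  shows "(g has_integral (f t - f s)) {s..t}"
proof (rule abs_continuous_has_integral[OF st(2) _ E])
  show "abs_continuous_on {s..t} f"
    by (rule abs_continuous_on_subset[OF ac]) (use st in auto)
  show "(f has_vector_derivative g u) (at u within {s..t})" if "u \<in> {s..t} - E" for u
    using der[of u] that st by (auto intro: has_vector_derivative_within_subset)
qed

lemma abs_continuous_on_imp_lipschitz_on: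
  fixes f :: "real \<Rightarrow> 'a::banach"
  assumes ac: "abs_continuous_on {a..b} f" and M: "M \<ge> 0"
    and der: "AE t\<in>{a..b} in lebesgue. \<exists>d. (f has_vector_derivative d) (at t within {a..b}) \<and> norm d \<le> M"
  shows "M-lipschitz_on {a..b} f"
proof -
  define E where "E = {t\<in>{a..b}. \<not> (\<exists>d. (f has_vector_derivative d) (at t within {a..b}) \<and> norm d \<le> M)}"
  have E: "negligible E" using der unfolding AE_on_lebesgue_iff E_def .
  define g where "g t = (if t \<in> {a..b} - E then SOME d. (f has_vector_derivative d) (at t within {a..b}) \<and> norm d \<le> M else 0)" for t
  have g: "(f has_vector_derivative g t) (at t within {a..b}) \<and> norm (g t) \<le> M" if "t \<in> {a..b} - E" for t
    using someI_ex[of "\<lambda>d. (f has_vector_derivative d) (at t within {a..b}) \<and> norm d \<le> M"] that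
    by (auto simp: g_def E_def)
  have gM: "norm (g t) \<le> M" for t
    using g[of t] M by (cases "t \<in> {a..b} - E") (auto simp: g_def)
  have *: "dist (f t) (f s) \<le> M * dist t s" if "s \<in> {a..b}" "t \<in> {a..b}" "s \<le> t" for s t
  proof -
    have "(g has_integral (f t - f s)) {s..t}"
      using that g by (intro abs_continuous_has_integral_subinterval[OF _ _ _ ac E]) auto
    then have "norm (f t - f s) \<le> M * measure lborel {s..t}"
      using gM M has_integral_bound_real by blast
    then show ?thesis using that by (simp add: dist_norm)
  qed
  show ?thesis
  proof (rule lipschitz_onI[OF _ M])
    fix s t assume "s \<in> {a..b}" "t \<in> {a..b}"
    then show "dist (f s) (f t) \<le> M * dist s t"
      using *[of s t] *[of t s] by (cases "s \<le> t") (auto simp: dist_commute)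
  qed
qed

text \<open>Points where the difference quotient misses \<open>v t\<close> by more than
  \<open>1 / Suc n\<close> arbitrarily close by are covered, in the sense of Vitali, by intervals
  with a large Riemann error. Henstock's lemma makes the sum of these errors small, hence also the
  total length of the intervals.\<close>

lemma indefinite_integral_has_vector_derivative_AE:
  fixes v :: "real \<Rightarrow> 'a::euclidean_space"
  assumes v: "v integrable_on {a..b}"
  shows "AE t\<in>{a..b} in lebesgue. ((\<lambda>t. integral {a..t} v) has_vector_derivative v t) (at t within {a..b})"
proof -
  define F where "F t = integral {a..t} v" for t
  define B where "B n = {t\<in>{a..b}. \<forall>d>0. \<exists>y\<in>{a..b}. y \<noteq> t \<and> \<bar>y - t\<bar> < d \<and>
      norm (F y - F t - (y - t) *\<^sub>R v t) > \<bar>y - t\<bar> / Suc n}" for n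
  have neg: "negligible (B n)" for n
    unfolding negligible_outer_le
  proof (intro allI impI)
    fix e :: real assume e: "e > 0"
    \<comment> \<open>Each covering interval has a Riemann error of at least its length divided by
      \<open>Suc n\<close>; a total error below \<open>e / Suc n\<close> thus means a total length
      below \<open>e\<close>.\<close>
    define e' where "e' = e / Suc n"
    have e': "e' > 0" using e by (simp add: e'_def)
    have vb: "v integrable_on cbox a b" using v by simp
    obtain \<gamma> where \<gamma>: "gauge \<gamma>" and H: "\<And>p. p tagged_partial_division_of (cbox a b) \<Longrightarrow> \<gamma> fine p \<Longrightarrow>
        (\<Sum>(x,k)\<in>p. norm (measure lborel k *\<^sub>R v x - integral k v)) < e'"
      using Henstock_lemma[OF vb e'] by blast
    \<comment> \<open>The first component is the tag and sits at an end of the segment. The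
      functions \<open>c\<close> and \<open>r\<close> present the segment as a ball, as Vitali's
      theorem requires.\<close>
    define K where "K = {(x,y). x \<in> {a..b} \<and> y \<in> {a..b} \<and> x \<noteq> y \<and> closed_segment x y \<subseteq> \<gamma> x \<and>
        norm (F y - F x - (y - x) *\<^sub>R v x) > \<bar>y - x\<bar> / Suc n}"
    define c where "c = (\<lambda>(x,y). (x + y) / 2 :: real)"
    define r where "r = (\<lambda>(x,y). \<bar>x - y\<bar> / 2 :: real)"
    have cb: "cball (c i) (r i) = closed_segment (fst i) (snd i)" for i
      by (cases i) (auto simp: c_def r_def closed_segment_eq_real_ivl cball_eq_atLeastAtMost field_simps)
    have rp: "0 < r i" if "i \<in> K" for i
      using that by (auto simp: K_def r_def)
    have cov: "\<exists>i. i \<in> K \<and> x \<in> cball (c i) (r i) \<and> r i < d" if x: "x \<in> B n" and d: "d > 0" for x d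
    proof -
      have "open (\<gamma> x)" "x \<in> \<gamma> x" using \<gamma> by (auto simp: gauge_def)
      then obtain \<eta> where \<eta>: "\<eta> > 0" "ball x \<eta> \<subseteq> \<gamma> x" by (meson open_contains_ball)
      obtain y where y: "y \<in> {a..b}" "y \<noteq> x" "\<bar>y - x\<bar> < min d \<eta>" "norm (F y - F x - (y - x) *\<^sub>R v x) > \<bar>y - x\<bar> / Suc n"
        using x d \<eta> unfolding B_def by (auto dest!: spec[of _ "min d \<eta>"])
      have "closed_segment x y \<subseteq> ball x \<eta>"
        using y \<eta> by (intro closed_segment_subset) (auto simp: dist_real_def abs_minus_commute)
      then have "(x,y) \<in> K" using x y \<eta> by (auto simp: K_def B_def)
      moreover have "x \<in> cball (c (x,y)) (r (x,y))" unfolding cb by simp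
      moreover have "r (x,y) < d" using y d by (simp add: r_def abs_minus_commute)
      ultimately show ?thesis by blast
    qed
    obtain C where C: "countable C" "C \<subseteq> K"
      and dis: "pairwise (\<lambda>i j. disjnt (cball (c i) (r i)) (cball (c j) (r j))) C"
      and N: "negligible (B n - (\<Union>i\<in>C. cball (c i) (r i)))"
      using Vitali_covering_theorem_cballs[OF rp cov] by blast
    \<comment> \<open>Henstock's lemma speaks of finite families; the bound then passes to the
      countable union.\<close>
    have fin: "measure lebesgue (\<Union>i\<in>I. cball (c i) (r i)) \<le> e" if I: "I \<subseteq> C" "finite I" for I
    proof -
      define p where "p = (\<lambda>i. (fst i, cball (c i) (r i))) ` I"
      have inj: "inj_on (\<lambda>i. (fst i, cball (c i) (r i))) I"
      proof (rule inj_onI)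
        fix i j assume ij: "i \<in> I" "j \<in> I" "(fst i, cball (c i) (r i)) = (fst j, cball (c j) (r j))"
        show "i = j"
        proof (rule ccontr)
          assume "i \<noteq> j"
          moreover have "i \<in> C" "j \<in> C" using ij I by auto
          ultimately have "disjnt (cball (c i) (r i)) (cball (c j) (r j))" using pairwiseD[OF dis, of i j] by simp
          moreover have "i \<in> K" using ij I C by auto
          then have "c i \<in> cball (c i) (r i)" using rp[of i] by auto
          ultimately show False using ij by (simp add: disjnt_def)
        qed
      qed
      have tp: "p tagged_partial_division_of (cbox a b)"
      unfolding tagged_partial_division_of_def
      proof (intro conjI allI impI)
        show "finite p" using I by (simp add: p_def)
        {
        fix x k assume "(x,k) \<in> p"
        then obtain i where i: "i \<in> I" "x = fst i" "k = cball (c i) (r i)" by (auto simp: p_def)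
        then have iK: "i \<in> K" using I C by auto
        show "x \<in> k" unfolding i cb by simp
        show "k \<subseteq> cbox a b" unfolding i cb
          by (rule closed_segment_subset) (use iK in \<open>auto simp: K_def\<close>)
        show "\<exists>a b. k = cbox a b" unfolding i cball_eq_atLeastAtMost by (metis box_real(2))
        }
        fix x k x' k' assume xk: "(x,k) \<in> p \<and> (x',k') \<in> p \<and> (x, k) \<noteq> (x', k')"
        then obtain i j where i: "i \<in> I" "x = fst i" "k = cball (c i) (r i)" and j: "j \<in> I" "x' = fst j" "k' = cball (c j) (r j)" by (auto simp: p_def)
        then have "i \<noteq> j" "i \<in> C" "j \<in> C" using xk I by auto
        then have "disjnt k k'" using pairwiseD[OF dis, of i j] i j by simp
        then show "interior k \<inter> interior k' = {}" using interior_subset[of k] interior_subset[of k'] by (auto simp: disjnt_iff)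
      qed
      have fn: "\<gamma> fine p"
      proof -
        have "closed_segment (fst i) (snd i) \<subseteq> \<gamma> (fst i)" if "i \<in> I" for i
        proof -
          have "i \<in> K" using that I C by auto
          then show ?thesis by (auto simp: K_def)
        qed
        then show ?thesis by (auto simp: fine_def p_def cb)
      qed
      have tm: "\<bar>x - y\<bar> / Suc n \<le> norm (measure lborel (cball (c (x,y)) (r (x,y))) *\<^sub>R v x - integral (cball (c (x,y)) (r (x,y))) v)"
        if "(x,y) \<in> K" for x y
      proof -
        have xy: "x \<in> {a..b}" "y \<in> {a..b}" "x \<noteq> y" "norm (F y - F x - (y - x) *\<^sub>R v x) > \<bar>y - x\<bar> / Suc n"
          using that by (auto simp: K_def)
        have diff: "F t - F s = integral {s..t} v" if "s \<in> {a..b}" "t \<in> {a..b}" "s \<le> t" for s t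
        proof -
          have "v integrable_on {a..t}" using v that by (auto intro: integrable_on_subinterval)
          then show ?thesis
            using Henstock_Kurzweil_Integration.integral_combine[of a s t v] that by (simp add: F_def algebra_simps)
        qed
        show ?thesis
        proof (cases "x \<le> y")
          case True
          then show ?thesis using xy diff[of x y] cb[of "(x,y)"]
            by (simp add: closed_segment_eq_real_ivl norm_minus_commute abs_minus_commute)
        next
          case False
          then have "measure lborel (cball (c (x,y)) (r (x,y))) *\<^sub>R v x - integral (cball (c (x,y)) (r (x,y))) v =
              F y - F x - (y - x) *\<^sub>R v x"
            using xy diff[of y x] cb[of "(x,y)"]
            by (simp add: closed_segment_eq_real_ivl algebra_simps)
          then show ?thesis using xy by (simp add: abs_minus_commute)
        qed
      qed
      have "(\<Sum>i\<in>I. \<bar>fst i - snd i\<bar> / Suc n) \<le>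
          (\<Sum>i\<in>I. norm (measure lborel (cball (c i) (r i)) *\<^sub>R v (fst i) - integral (cball (c i) (r i)) v))"
      proof (rule sum_mono)
        fix i assume "i \<in> I"
        then have "(fst i, snd i) \<in> K" using I C by auto
        from tm[OF this] show "\<bar>fst i - snd i\<bar> / Suc n \<le>
            norm (measure lborel (cball (c i) (r i)) *\<^sub>R v (fst i) - integral (cball (c i) (r i)) v)"
          by simp
      qed
      also have "\<dots> = (\<Sum>(x,k)\<in>p. norm (measure lborel k *\<^sub>R v x - integral k v))"
        unfolding p_def by (subst sum.reindex[OF inj]) simp
      also have "\<dots> < e'" by (rule H[OF tp fn])
      finally have "(\<Sum>i\<in>I. \<bar>fst i - snd i\<bar>) / Suc n < e / Suc n"
        by (simp add: sum_divide_distrib e'_def)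
      then have s: "(\<Sum>i\<in>I. \<bar>fst i - snd i\<bar>) < e" by (simp add: divide_less_cancel)
      have "measure lebesgue (\<Union>i\<in>I. cball (c i) (r i)) \<le> (\<Sum>i\<in>I. measure lebesgue (cball (c i) (r i)))"
        using I by (intro measure_UNION_le) auto
      also have "\<dots> = (\<Sum>i\<in>I. \<bar>fst i - snd i\<bar>)"
        by (rule sum.cong) (auto simp: cb closed_segment_eq_real_ivl)
      finally show ?thesis using s by simp
    qed
    have U: "(\<Union>i\<in>C. cball (c i) (r i)) \<in> lmeasurable \<and> measure lebesgue (\<Union>i\<in>C. cball (c i) (r i)) \<le> e"
      using C fin e
      by (intro conjI fmeasurable_UN_bound[of C _ lebesgue e] measure_UN_bound[of C _ lebesgue e]) auto
    show "\<exists>T. B n \<subseteq> T \<and> T \<in> lmeasurable \<and> measure lebesgue T \<le> e"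
    proof (intro exI conjI)
      let ?N = "B n - (\<Union>i\<in>C. cball (c i) (r i))"
      show "B n \<subseteq> (\<Union>i\<in>C. cball (c i) (r i)) \<union> ?N" by auto
      show "(\<Union>i\<in>C. cball (c i) (r i)) \<union> ?N \<in> lmeasurable"
        using U N by (intro fmeasurable.Un) (auto simp: negligible_imp_measurable)
      show "measure lebesgue ((\<Union>i\<in>C. cball (c i) (r i)) \<union> ?N) \<le> e"
        using U N measure_Un_null_set[of "\<Union>i\<in>C. cball (c i) (r i)" lebesgue ?N]
        by (simp add: negligible_iff_null_sets fmeasurableD)
    qed
  qed
  have "{t\<in>{a..b}. \<not> (F has_vector_derivative v t) (at t within {a..b})} \<subseteq> (\<Union>n. B n)"
  proof (rule subsetI, rule ccontr)
    fix t assume t: "t \<in> {t\<in>{a..b}. \<not> (F has_vector_derivative v t) (at t within {a..b})}" and nB: "t \<notin> (\<Union>n. B n)"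
    have "(F has_vector_derivative v t) (at t within {a..b})"
      unfolding has_vector_derivative_def has_derivative_within_alt
    proof (intro conjI allI impI)
      show "bounded_linear (\<lambda>x. x *\<^sub>R v t)" by (rule bounded_linear_scaleR_left)
      fix e :: real assume "e > 0"
      then obtain n where n: "inverse (real (Suc n)) < e" using reals_Archimedean by blast
      from nB have "t \<notin> B n" by blast
      then obtain d where d: "d > 0" "\<And>y. y \<in> {a..b} \<Longrightarrow> y \<noteq> t \<Longrightarrow> \<bar>y - t\<bar> < d \<Longrightarrow> norm (F y - F t - (y - t) *\<^sub>R v t) \<le> \<bar>y - t\<bar> / Suc n"
        using t unfolding B_def by force
      show "\<exists>d>0. \<forall>y\<in>{a..b}. norm (y - t) < d \<longrightarrow> norm (F y - F t - (y - t) *\<^sub>R v t) \<le> e * norm (y - t)"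
      proof (intro exI[of _ d] conjI ballI impI d)
        fix y assume y: "y \<in> {a..b}" "norm (y - t) < d"
        show "norm (F y - F t - (y - t) *\<^sub>R v t) \<le> e * norm (y - t)"
        proof (cases "y = t")
          case False
          have "\<bar>y - t\<bar> / Suc n \<le> e * \<bar>y - t\<bar>"
            using mult_right_mono[OF less_imp_le[OF n], of "\<bar>y - t\<bar>"] by (simp add: divide_inverse mult.commute)
          then show ?thesis using d(2)[OF y(1) False] y by simp
        qed simp
      qed
    qed
    with t show False by simp
  qed
  moreover have "negligible (\<Union>n. B n)" using neg by (intro negligible_countable_Union) auto
  ultimately show ?thesis unfolding AE_on_lebesgue_iff F_def [symmetric]
    using negligible_subset by blast
qed

section \<open>Differential inequalities\<close>

text \<open>The right-hand side of the integral inequality, damped by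
  \<open>exp (- L * (t - a))\<close>, has a nonpositive derivative.\<close>

lemma gronwall:
  fixes u :: "real \<Rightarrow> real"
  assumes u: "continuous_on {a..b} u" and L: "L \<ge> 0"
    and le: "\<And>t. t \<in> {a..b} \<Longrightarrow> u t \<le> c + L * integral {a..t} u"
    and t: "t \<in> {a..b}"
  shows "u t \<le> c * exp (L * (t - a))"
proof -
  define W where "W t = (c + L * integral {a..t} u) * exp (- L * (t - a))" for t
  have cW: "continuous_on {a..b} W"
    unfolding W_def using u
    by (intro continuous_intros indefinite_integral_continuous_1 integrable_continuous_real)
  have dW: "(W has_real_derivative (L * u s - L * (c + L * integral {a..s} u)) * exp (- L * (s - a))) (at s)"
    if s: "a < s" "s < b" for s
  proof -
    have "((\<lambda>t. integral {a..t} u) has_vector_derivative u s) (at s within {a..b})"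
      by (rule integral_has_vector_derivative[OF u]) (use s in auto)
    then have "((\<lambda>t. integral {a..t} u) has_real_derivative u s) (at s)"
      using s by (simp add: has_real_derivative_iff_has_vector_derivative at_within_Icc_at)
    then show ?thesis
      unfolding W_def by (auto intro!: derivative_eq_intros simp: algebra_simps)
  qed
  have "W t \<le> W a"
  proof (cases "a = t")
    case False
    with t have at: "a < t" by auto
    show ?thesis
    proof (rule DERIV_nonpos_imp_decreasing_open[OF less_imp_le[OF at]])
      show "\<exists>y. (W has_real_derivative y) (at s) \<and> y \<le> 0" if s: "a < s" "s < t" for s
      proof (intro exI conjI)
        show "(W has_real_derivative (L * u s - L * (c + L * integral {a..s} u)) * exp (- L * (s - a))) (at s)"
          by (rule dW) (use s t in auto)
        show "(L * u s - L * (c + L * integral {a..s} u)) * exp (- L * (s - a)) \<le> 0"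
          using le[of s] L s t by (intro mult_nonpos_nonneg) (auto simp: mult_left_mono)
      qed
    qed (use cW t in \<open>auto intro: continuous_on_subset\<close>)
  qed simp
  then have "(c + L * integral {a..t} u) * exp (- L * (t - a)) \<le> c" by (simp add: W_def)
  then have "(c + L * integral {a..t} u) * exp (- L * (t - a)) * exp (L * (t - a)) \<le> c * exp (L * (t - a))"
    by (intro mult_right_mono) auto
  then have "c + L * integral {a..t} u \<le> c * exp (L * (t - a))"
    by (simp add: mult.assoc flip: exp_add)
  with le[OF t] show ?thesis by linarith
qed

lemma gronwall_backward:
  fixes u :: "real \<Rightarrow> real"
  assumes u: "continuous_on {a..b} u" and L: "L \<ge> 0"
    and le: "\<And>t. t \<in> {a..b} \<Longrightarrow> u t \<le> c + L * integral {t..b} u"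
    and t: "t \<in> {a..b}"
  shows "u t \<le> c * exp (L * (b - t))"
proof -
  have "u (- (- t)) \<le> c * exp (L * (- t - - b))"
  proof (rule gronwall[of "- b" "- a" "\<lambda>s. u (- s)"])
    show "continuous_on {- b..- a} (\<lambda>s. u (- s))"
      by (rule continuous_on_compose2[OF u]) (auto intro: continuous_intros)
    show "u (- s) \<le> c + L * integral {- b..s} (\<lambda>s. u (- s))" if "s \<in> {- b..- a}" for s
      using le[of "- s"] that Henstock_Kurzweil_Integration.integral_reflect_real[of b "- s" u] by auto
  qed (use L t in auto)
  then show ?thesis by (simp add: algebra_simps)
qed

text \<open>The growth of \<open>\<psi>\<close> is compared with a barrier. On the null set
  \<open>E\<close> only the crude rate \<open>C\<close> is known, so the barrier is allowed to rise
  at that rate inside an open set of small measure around \<open>E\<close>. The uniform bound on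
  upward jumps replaces continuity when the comparison is continued past a supremum.\<close>

lemma right_dini_nonpos_imp_le:
  fixes \<psi> :: "real \<Rightarrow> real"
  assumes ab: "a < b" and C: "C \<ge> 0" and E: "negligible E"
    and lsc: "\<And>e. e > 0 \<Longrightarrow> \<exists>d>0. \<forall>s t. a \<le> s \<and> s \<le> t \<and> t \<le> b \<and> t - s < d \<longrightarrow> \<psi> t \<le> \<psi> s + e"
    and bd: "\<And>t. a < t \<Longrightarrow> t < b \<Longrightarrow> \<forall>\<^sub>F h in at_right 0. \<psi> (t + h) \<le> \<psi> t + C * h"
    and ae: "\<And>t e. a < t \<Longrightarrow> t < b \<Longrightarrow> t \<notin> E \<Longrightarrow> e > 0 \<Longrightarrow> \<forall>\<^sub>F h in at_right 0. \<psi> (t + h) \<le> \<psi> t + e * h"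
  shows "\<psi> b \<le> \<psi> a"
proof (rule field_le_epsilon)
  fix \<epsilon> :: real assume \<epsilon>: "\<epsilon> > 0"
  obtain d where d: "d > 0" "\<And>s t. a \<le> s \<Longrightarrow> s \<le> t \<Longrightarrow> t \<le> b \<Longrightarrow> t - s < d \<Longrightarrow> \<psi> t \<le> \<psi> s + \<epsilon>/3"
    using lsc[of "\<epsilon>/3"] \<epsilon> by auto
  \<comment> \<open>The rates are known only in the open interval, so the barrier starts slightly to
    the right of \<open>a\<close>; this costs one third of \<open>\<epsilon>\<close>.\<close>
  define a' where "a' = a + min (d/2) ((b-a)/2)"
  have a': "a < a'" "a' < b" "a' - a < d"
    using d ab by (auto simp: a'_def min_def field_simps)
  define e where "e = \<epsilon> / (3 * (b - a))"
  have e: "e > 0" using \<epsilon> ab by (simp add: e_def)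
  have "\<epsilon> / (3 * (C + 1)) > 0" using \<epsilon> C by simp
  from negligible_subset_open[OF E this] obtain U where
    U: "open U" "E \<subseteq> U" "U \<in> lmeasurable" "measure lebesgue U < \<epsilon> / (3 * (C + 1))" by blast
  define m where "m t = measure lebesgue (U \<inter> {a'..t})" for t
  \<comment> \<open>Slope \<open>e\<close> everywhere and additional slope \<open>C\<close> inside
    \<open>U\<close>. Over the whole interval either part rises by at most
    \<open>\<epsilon>/3\<close>.\<close>
  define \<Phi> where "\<Phi> t = \<psi> a' + e * (t - a') + C * m t" for t
  have Us: "U \<inter> {s..t} \<in> lmeasurable" for s t
    using U by (intro fmeasurable_Int_fmeasurable) auto
  have mmono: "m s \<le> m t" if "s \<le> t" for s t
    unfolding m_def using Us that by (intro measure_mono_fmeasurable) (auto intro: fmeasurableD)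
  have \<Phi>mono: "\<Phi> s \<le> \<Phi> t" if "s \<le> t" for s t
    unfolding \<Phi>_def using mmono[OF that] e C that by (intro add_mono mult_left_mono) auto
  define S where "S = {t\<in>{a'..b}. \<forall>s\<in>{a'..t}. \<psi> s \<le> \<Phi> s}"
  have aS: "a' \<in> S" using a' C by (auto simp: S_def \<Phi>_def m_def)
  have bdd: "bdd_above S" by (auto simp: S_def intro!: bdd_aboveI[of _ b])
  define t where "t = Sup S"
  have t: "a' \<le> t" unfolding t_def using aS bdd by (rule cSup_upper)
  have "t \<le> b" unfolding t_def by (rule cSup_least) (use aS in \<open>auto simp: S_def\<close>)
  note t = t this
  have below: "\<psi> s \<le> \<Phi> s" if "a' \<le> s" "s < t" for s
  proof -
    have "\<exists>r\<in>S. s < r" using aS less_cSupD[of S s] that(2)[unfolded t_def] by blast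
    then obtain r where "r \<in> S" "s < r" by blast
    then show ?thesis using that by (auto simp: S_def)
  qed
  \<comment> \<open>The supremum itself still satisfies the comparison, because
    \<open>\<psi>\<close> cannot jump upward on arriving at \<open>t\<close>.\<close>
  have at: "\<psi> t \<le> \<Phi> t"
  proof (cases "t = a'")
    case True then show ?thesis using C by (simp add: \<Phi>_def m_def)
  next
    case False
    with t have ta: "a' < t" by simp
    show ?thesis
    proof (rule field_le_epsilon)
      fix \<eta> :: real assume "\<eta> > 0"
      then obtain d where d: "d > 0" "\<And>s t. a \<le> s \<Longrightarrow> s \<le> t \<Longrightarrow> t \<le> b \<Longrightarrow> t - s < d \<Longrightarrow> \<psi> t \<le> \<psi> s + \<eta>"
        using lsc[of \<eta>] by auto
      define s where "s = max a' (t - d/2)"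
      have s: "a' \<le> s" "s < t" "t - s < d" using d ta by (auto simp: s_def)
      have "\<psi> t \<le> \<psi> s + \<eta>" using d(2)[of s t] s a' t by auto
      also have "\<psi> s \<le> \<Phi> t" using below[OF s(1,2)] \<Phi>mono[of s t] s by linarith
      finally show "\<psi> t \<le> \<Phi> t + \<eta>" by simp
    qed
  qed
  have "t = b"
  proof (rule ccontr)
    assume "t \<noteq> b"
    with t have tb: "t < b" by simp
    have "\<forall>\<^sub>F h in at_right 0. \<psi> (t + h) \<le> \<Phi> (t + h)"
    proof (cases "t \<in> E")
      case False
      have ev: "\<forall>\<^sub>F h in at_right 0. (0::real) < h" by (simp add: eventually_at_right_less)
      have "\<forall>\<^sub>F h in at_right 0. \<psi> (t + h) \<le> \<psi> t + e * h"
        using ae[of t e] False tb t a' e by auto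
      then show ?thesis using ev
      proof eventually_elim
        case (elim h)
        have "\<psi> (t + h) \<le> \<psi> t + e * h" by (rule elim)
        also have "\<dots> \<le> \<Phi> t + e * h" using at by simp
        also have "\<dots> \<le> \<Phi> (t + h)"
          using mult_left_mono[OF mmono[of t "t + h"] C] elim by (simp add: \<Phi>_def algebra_simps)
        finally show ?case .
      qed
    next
      case True
      then obtain r where r: "r > 0" "ball t r \<subseteq> U" using U by (meson open_contains_ball subsetD)
      have ev: "\<forall>\<^sub>F h in at_right 0. h \<in> {0<..<r}" using r eventually_at_right_real by blast
      have "\<forall>\<^sub>F h in at_right 0. \<psi> (t + h) \<le> \<psi> t + C * h"
        using bd[of t] tb t a' by auto
      then show ?thesis using ev
      proof eventually_elim
        case (elim h)
        \<comment> \<open>Immediately to the right of a point of \<open>E\<close> the measure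
          \<open>m\<close> grows at unit rate, so \<open>C * m\<close> pays for the crude
          slope.\<close>
        have "{t<..t + h} \<subseteq> U" using r elim by (auto simp: dist_real_def subset_iff)
        then have sub: "U \<inter> {a'..t} \<union> {t<..t+h} \<subseteq> U \<inter> {a'..t + h}" using t elim by auto
        have "m t + h = measure lebesgue (U \<inter> {a'..t}) + measure lebesgue {t<..t+h}"
          using elim by (simp add: m_def)
        also have "\<dots> = measure lebesgue (U \<inter> {a'..t} \<union> {t<..t+h})"
          using fmeasurableD2[OF Us[of a' t]] fmeasurableD[OF Us[of a' t]] elim
          by (intro measure_Union [symmetric]) auto
        also have "\<dots> \<le> m (t + h)"
          unfolding m_def using Us sub by (intro measure_mono_fmeasurable) (auto intro: fmeasurableD)
        finally have mh: "m t + h \<le> m (t + h)" .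
        have eh: "0 \<le> e * h" using e elim by simp
        have "\<psi> (t + h) \<le> \<psi> t + C * h" by (rule elim)
        also have "\<dots> \<le> \<Phi> t + C * h" using at by simp
        also have "\<dots> \<le> \<Phi> (t + h)"
          using mult_left_mono[OF mh C] eh by (simp add: \<Phi>_def algebra_simps)
        finally show ?case .
      qed
    qed
    then obtain r where r: "r > 0" "\<And>h. 0 < h \<Longrightarrow> h < r \<Longrightarrow> \<psi> (t + h) \<le> \<Phi> (t + h)"
      unfolding eventually_at_right_field by auto
    define u where "u = min b (t + r/2)"
    have u: "t < u" "u \<le> b" "u - t < r" using r tb by (auto simp: u_def)
    have "\<psi> s \<le> \<Phi> s" if "s \<in> {a'..u}" for s
      using below[of s] at r(2)[of "s - t"] u that by (cases "s < t"; cases "s = t") auto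
    then have "u \<in> S" using u t by (auto simp: S_def)
    then have "u \<le> t" unfolding t_def using bdd by (rule cSup_upper)
    with u show False by simp
  qed
  with at have "\<psi> b \<le> \<psi> a' + e * (b - a') + C * m b" by (simp add: \<Phi>_def)
  moreover have "\<psi> a' \<le> \<psi> a + \<epsilon>/3" using d(2)[of a a'] a' by auto
  moreover have "e * (b - a') \<le> \<epsilon>/3"
  proof -
    have "e * (b - a') \<le> e * (b - a)" using e a' by (intro mult_left_mono) auto
    also have "e * (b - a) = \<epsilon>/3"
    proof -
      define l where "l = b - a"
      have "l \<noteq> 0" using ab by (simp add: l_def)
      then show ?thesis by (simp add: e_def flip: l_def)
    qed
    finally show ?thesis .
  qed
  moreover have "C * m b \<le> \<epsilon>/3"
  proof -
    have "m b \<le> measure lebesgue U"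
      unfolding m_def using Us U by (intro measure_mono_fmeasurable) (auto intro: fmeasurableD)
    then have "C * m b \<le> (C + 1) * (\<epsilon> / (3 * (C + 1)))"
      using U C by (intro mult_mono) (auto simp: m_def)
    also have "\<dots> = \<epsilon>/3"
    proof -
      define l where "l = C + 1"
      have "l \<noteq> 0" using C by (simp add: l_def)
      then show ?thesis by (simp flip: l_def)
    qed
    finally show ?thesis .
  qed
  ultimately show "\<psi> b \<le> \<psi> a + \<epsilon>" by linarith
qed

section \<open>Filippov's existence theorem\<close>

lemma compact_slice_closed:
  fixes S :: "('a::t2_space \<times> 'b::t2_space) set"
  assumes "compact S" shows "compact {w. (s,w) \<in> S}"
proof -
  have "compact (S \<inter> {s} \<times> UNIV)" using assms by (intro compact_Int_closed closed_Times) auto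
  then have "compact (snd ` (S \<inter> {s} \<times> UNIV))" by (intro compact_continuous_image continuous_intros)
  also have "snd ` (S \<inter> {s} \<times> UNIV) = {w. (s,w) \<in> S}" by force
  finally show ?thesis .
qed

text \<open>The projection lies in a closed set \<open>D\<close> exactly when, for every rational
  \<open>r\<close>, the existence of a point of \<open>C s\<close> within \<open>r\<close> of
  \<open>u s\<close> implies the existence of such a point in \<open>C s \<inter> D\<close>. These
  are countably many measurable conditions.\<close>

lemma closest_point_measurable:
  fixes C :: "real \<Rightarrow> 'a::euclidean_space set" and u :: "real \<Rightarrow> 'a"
  assumes cpt: "compact {(s,w). s \<in> {a..b} \<and> w \<in> C s}"
    and ne: "\<And>s. s \<in> {a..b} \<Longrightarrow> C s \<noteq> {}" and cv: "\<And>s. s \<in> {a..b} \<Longrightarrow> convex (C s)"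
    and u: "u \<in> borel_measurable (lebesgue_on {a..b})"
  shows "(\<lambda>s. closest_point (C s) (u s)) \<in> borel_measurable (lebesgue_on {a..b})"
proof (rule borel_measurableI)
  let ?M = "lebesgue_on {a..b}" and ?\<Gamma> = "{(s,w). s \<in> {a..b} \<and> w \<in> C s}"
  let ?g = "\<lambda>s. closest_point (C s) (u s)"
  \<comment> \<open>For closed \<open>D\<close> this is the sum of a compact set and a compact ball,
    hence closed, so its preimage under \<open>\<lambda>s. (s, u s)\<close> is measurable.\<close>
  define A where "A D r = {(s,z). \<exists>c. s \<in> {a..b} \<and> c \<in> C s \<and> c \<in> D \<and> norm (z - c) \<le> r}" for D :: "'a set" and r
  have Acl: "closed (A D r)" if "closed D" for D r
  proof -
    have "compact (?\<Gamma> \<inter> UNIV \<times> D)" using cpt that by (intro compact_Int_closed closed_Times) auto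
    moreover have "compact ({0} \<times> cball (0::'a) r)" for r :: real by (intro compact_Times) auto
    ultimately have "compact {p + q | p q. p \<in> ?\<Gamma> \<inter> UNIV \<times> D \<and> q \<in> {0} \<times> cball (0::'a) r}"
      by (rule compact_sums)
    also have "{p + q | p q. p \<in> ?\<Gamma> \<inter> UNIV \<times> D \<and> q \<in> {0} \<times> cball (0::'a) r} = A D r"
    proof (intro set_eqI iffI)
      fix sz assume "sz \<in> {p + q | p q. p \<in> ?\<Gamma> \<inter> UNIV \<times> D \<and> q \<in> {0} \<times> cball (0::'a) r}"
      then show "sz \<in> A D r" by (auto simp: A_def)
    next
      fix sz assume "sz \<in> A D r"
      then obtain c where c: "fst sz \<in> {a..b}" "c \<in> C (fst sz)" "c \<in> D" "norm (snd sz - c) \<le> r"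
        by (auto simp: A_def case_prod_unfold)
      have "sz = (fst sz, c) + (0, snd sz - c)" by (simp add: prod_eq_iff)
      moreover have "(fst sz, c) \<in> ?\<Gamma> \<inter> UNIV \<times> D" "(0, snd sz - c) \<in> {0} \<times> cball (0::'a) r" using c by auto
      ultimately show "sz \<in> {p + q | p q. p \<in> ?\<Gamma> \<inter> UNIV \<times> D \<and> q \<in> {0} \<times> cball (0::'a) r}" by blast
    qed
    finally show ?thesis by (rule compact_imp_closed)
  qed
  have Ccl: "compact (C s)" if "s \<in> {a..b}" for s
    using compact_slice_closed[OF cpt, of s] that by simp
  have pm: "(\<lambda>s. (s, u s)) \<in> ?M \<rightarrow>\<^sub>M borel"
    using u by (intro borel_measurable_Pair) (auto intro!: continuous_imp_measurable_on_sets_lebesgue continuous_intros)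
  have pre: "{s \<in> {a..b}. (s, u s) \<in> B} \<in> sets ?M" if "closed B" for B
  proof -
    have "(\<lambda>s. (s, u s)) -` B \<inter> space ?M \<in> sets ?M"
      by (rule measurable_sets[OF pm]) (use that in auto)
    moreover have "(\<lambda>s. (s, u s)) -` B \<inter> space ?M = {s \<in> {a..b}. (s, u s) \<in> B}" by auto
    ultimately show ?thesis by simp
  qed
  have clo: "{s \<in> {a..b}. ?g s \<in> D} \<in> sets ?M" if D: "closed D" for D
  proof -
    have eq: "{s \<in> {a..b}. ?g s \<in> D} =
        (\<Inter>r\<in>\<rat>. ({a..b} - {s \<in> {a..b}. (s, u s) \<in> A UNIV r}) \<union> {s \<in> {a..b}. (s, u s) \<in> A D r})" (is "?L = ?R")
    proof (intro set_eqI iffI)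
      fix s assume s: "s \<in> ?L"
      then have gC: "?g s \<in> C s" using Ccl ne by (intro closest_point_in_set compact_imp_closed) auto
      show "s \<in> ?R"
      proof (intro INT_I)
        fix r :: real assume "r \<in> \<rat>"
        have "(s, u s) \<in> A D r" if su: "(s, u s) \<in> A UNIV r"
        proof -
          obtain c where c: "c \<in> C s" "norm (u s - c) \<le> r" using su by (auto simp: A_def)
          have "dist (u s) (?g s) \<le> dist (u s) c"
            using c s Ccl by (intro closest_point_le compact_imp_closed) auto
          then have "norm (u s - ?g s) \<le> r" using c by (simp add: dist_norm)
          then show ?thesis using s gC unfolding A_def by blast
        qed
        then show "s \<in> ({a..b} - {s \<in> {a..b}. (s, u s) \<in> A UNIV r}) \<union> {s \<in> {a..b}. (s, u s) \<in> A D r}"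
          using s by auto
      qed
    next
      fix s assume s: "s \<in> ?R"
      have "s \<in> ({a..b} - {s \<in> {a..b}. (s, u s) \<in> A UNIV 0}) \<union> {s \<in> {a..b}. (s, u s) \<in> A D 0}"
        using s Rats_0 by blast
      then have sab: "s \<in> {a..b}" by auto
      have gC: "?g s \<in> C s" using Ccl ne sab by (intro closest_point_in_set compact_imp_closed) auto
      define m where "m = norm (u s - ?g s)"
      have ex: "\<exists>c. c \<in> C s \<inter> D \<and> norm (u s - c) \<le> r" if "r \<in> \<rat>" "m \<le> r" for r
      proof -
        have "(s, u s) \<in> A UNIV r" using that sab gC by (auto simp: A_def m_def)
        then have "(s, u s) \<in> A D r" using s that by blast
        then show ?thesis by (auto simp: A_def)
      qed
      have cC: "compact (C s \<inter> D)" using Ccl sab D by (intro compact_Int_closed) auto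
      have neD: "C s \<inter> D \<noteq> {}"
      proof -
        obtain r where "r \<in> \<rat>" "m < r" using Rats_dense_in_real[of m "m+1"] by auto
        then show ?thesis using ex[of r] by auto
      qed
      obtain c where c: "c \<in> C s \<inter> D" "\<And>z. z \<in> C s \<inter> D \<Longrightarrow> dist (u s) c \<le> dist (u s) z"
        using distance_attains_inf[OF compact_imp_closed[OF cC] neD] by metis
      \<comment> \<open>Rational radii slightly above \<open>m\<close> give points of
        \<open>C s \<inter> D\<close> almost as close as the projection; the nearest point
        \<open>c\<close> of this compact set therefore attains \<open>m\<close>, and uniqueness
        identifies it with the projection.\<close>
      have "norm (u s - c) \<le> m"
      proof (rule field_le_epsilon)
        fix e :: real assume "e > 0"
        then obtain r where r: "r \<in> \<rat>" "m < r" "r < m + e" using Rats_dense_in_real[of m "m+e"] by auto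
        then obtain z where "z \<in> C s \<inter> D" "norm (u s - z) \<le> r" using ex[of r] by auto
        then show "norm (u s - c) \<le> m + e" using c(2)[of z] r by (simp add: dist_norm)
      qed
      moreover have "m \<le> dist (u s) z" if "z \<in> C s" for z
        unfolding m_def dist_norm[symmetric]
        using that Ccl sab by (intro closest_point_le compact_imp_closed) auto
      ultimately have "\<forall>z\<in>C s. dist (u s) c \<le> dist (u s) z" by (force simp: dist_norm)
      then have "c = ?g s"
        using c(1) cv Ccl sab by (intro closest_point_unique compact_imp_closed) auto
      then show "s \<in> ?L" using c(1) sab by auto
    qed
    have abM: "{a..b} \<in> sets ?M" by (simp add: sets_restrict_space_iff)
    have el: "({a..b} - {s \<in> {a..b}. (s, u s) \<in> A UNIV r}) \<union> {s \<in> {a..b}. (s, u s) \<in> A D r} \<in> sets ?M" for r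
      by (intro sets.Un sets.Diff abM pre Acl D closed_UNIV)
    have "?R \<in> sets ?M"
      by (rule sets.countable_INT') (use el countable_rat Rats_0 in blast)+
    then show ?thesis unfolding eq .
  qed
  fix S :: "'a set" assume "open S"
  have "{a..b} - {s \<in> {a..b}. ?g s \<in> - S} \<in> sets ?M"
    by (intro sets.Diff clo) (use \<open>open S\<close> in \<open>auto simp: sets_restrict_space_iff\<close>)
  also have "{a..b} - {s \<in> {a..b}. ?g s \<in> - S} = ?g -` S \<inter> space ?M" by auto
  finally show "?g -` S \<inter> space ?M \<in> sets ?M" .
qed

lemma geometric_steps_convergent:
  fixes f :: "nat \<Rightarrow> 'a::banach"
  assumes "\<And>k. norm (f (Suc k) - f k) \<le> B / 2 ^ k"
  shows "\<exists>l. f \<longlonglongrightarrow> l \<and> (\<forall>k. norm (l - f k) \<le> 2 * B / 2 ^ k)"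
proof -
  let ?d = "\<lambda>n. f (Suc n) - f n"
  have g: "summable (\<lambda>n. B * (1/2) ^ n)" by (intro summable_mult summable_geometric) simp
  have sn: "summable (\<lambda>n. norm (?d n))"
  proof (rule summable_comparison_test'[OF g, of 0])
    show "norm (norm (?d n)) \<le> B * (1/2) ^ n" for n
      using assms[of n] by (simp add: power_one_over)
  qed
  have s: "summable ?d" using sn by (rule summable_norm_cancel)
  have conv: "f \<longlonglongrightarrow> f 0 + suminf ?d"
  proof -
    have "(\<lambda>n. f 0 + (\<Sum>i<n. ?d i)) \<longlonglongrightarrow> f 0 + suminf ?d"
      by (intro tendsto_add tendsto_const summable_LIMSEQ s)
    then show ?thesis by (simp add: sum_lessThan_telescope)
  qed
  have "norm (f 0 + suminf ?d - f k) \<le> 2 * B / 2 ^ k" for k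
  proof -
    have "f 0 + suminf ?d - f k = (\<Sum>n. ?d (n + k))"
      using suminf_minus_initial_segment[OF s, of k] by (simp add: sum_lessThan_telescope)
    also have "norm \<dots> \<le> (\<Sum>n. norm (?d (n + k)))"
      using sn by (intro summable_norm) (simp add: summable_iff_shift[of "\<lambda>n. norm (?d n)"])
    also have "\<dots> \<le> (\<Sum>n. B / 2 ^ k * (1/2) ^ n)"
    proof (rule suminf_le)
      show "norm (?d (n + k)) \<le> B / 2 ^ k * (1/2) ^ n" for n
        using assms[of "n + k"] by (simp add: power_add power_one_over field_simps)
      show "summable (\<lambda>n. norm (?d (n + k)))" using sn by (simp add: summable_iff_shift[of "\<lambda>n. norm (?d n)"])
      show "summable (\<lambda>n. B / 2 ^ k * (1/2) ^ n)" by (intro summable_mult summable_geometric) simp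
    qed
    also have "\<dots> = 2 * B / 2 ^ k"
      using suminf_mult[OF summable_geometric[of "1/2::real"], of "B / 2 ^ k"] suminf_geometric[of "1/2::real"] by simp
    finally show ?thesis .
  qed
  with conv show ?thesis by blast
qed

lemma bounded_measurable_integrable_on:
  fixes v :: "real \<Rightarrow> 'a::euclidean_space"
  assumes "v \<in> borel_measurable (lebesgue_on {a..b})" "\<And>s. s \<in> {a..b} \<Longrightarrow> norm (v s) \<le> M"
  shows "v integrable_on {a..b}"
  by (rule measurable_bounded_by_integrable_imp_integrable[where g="\<lambda>_. M"]) (use assms in auto)

lemma indefinite_integral_lipschitz_on:
  fixes v :: "real \<Rightarrow> 'a::euclidean_space"
  assumes v: "v integrable_on {a..b}" and M: "\<And>s. s \<in> {a..b} \<Longrightarrow> norm (v s) \<le> M" "M \<ge> 0"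
    and y: "\<And>t. t \<in> {a..b} \<Longrightarrow> y t = y0 + integral {a..t} v"
  shows "M-lipschitz_on {a..b} y"
proof -
  have *: "norm (y t - y s) \<le> M * (t - s)" if "s \<in> {a..b}" "t \<in> {a..b}" "s \<le> t" for s t
  proof -
    have at: "v integrable_on {a..t}" using v that by (auto intro: integrable_on_subinterval)
    then have st: "v integrable_on {s..t}" using that by (auto intro: integrable_on_subinterval)
    have "y t - y s = integral {s..t} v"
      using Henstock_Kurzweil_Integration.integral_combine[of a s t v] that at
        y[OF that(1)] y[OF that(2)] by (simp add: algebra_simps)
    then show ?thesis
      using has_integral_bound_real[OF M(2), of "{}" v _ s t] integrable_integral[OF st] M that by auto
  qed
  show ?thesis
  proof (rule lipschitz_onI[OF _ M(2)])
    fix s t assume "s \<in> {a..b}" "t \<in> {a..b}"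
    then show "dist (y s) (y t) \<le> M * dist s t"
      using *[of s t] *[of t s] by (cases "s \<le> t") (auto simp: dist_norm norm_minus_commute)
  qed
qed

text \<open>Existence with an estimate: the velocities are corrected successively by projecting the \<open>k\<close>-th
  velocity onto the value of \<open>G\<close> along the \<open>k\<close>-th arc. Weighting the distance of consecutive arcs by
  \<open>exp (2 * L * (t - a))\<close> makes each correction half as large as the preceding one.\<close>

lemma filippov:
  fixes G :: "real \<Rightarrow> 'a::euclidean_space \<Rightarrow> 'a set" and v0 x :: "real \<Rightarrow> 'a"
  assumes ab: "a \<le> b"
    and ne: "\<And>s y. s \<in> {a..b} \<Longrightarrow> G s y \<noteq> {}"
    and cv: "\<And>s y. s \<in> {a..b} \<Longrightarrow> convex (G s y)"
    and graph: "closed {(s,y,w). s \<in> {a..b} \<and> w \<in> G s y}"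
    and growth: "\<And>s y w. s \<in> {a..b} \<Longrightarrow> w \<in> G s y \<Longrightarrow> norm w \<le> M * (1 + norm y)"
    and L: "L > 0"
    and lip: "\<And>s y y' w. s \<in> {a..b} \<Longrightarrow> w \<in> G s y \<Longrightarrow> \<exists>w'\<in>G s y'. norm (w' - w) \<le> L * norm (y' - y)"
    and v0: "v0 \<in> borel_measurable (lebesgue_on {a..b})" "\<And>s. s \<in> {a..b} \<Longrightarrow> norm (v0 s) \<le> M0"
    and x: "\<And>t. t \<in> {a..b} \<Longrightarrow> x t = x a + integral {a..t} v0"
    and \<gamma>: "\<gamma> integrable_on {a..b}"
    and defect: "\<And>s. s \<in> {a..b} \<Longrightarrow> \<exists>w\<in>G s (x s). norm (w - v0 s) \<le> \<gamma> s"
  obtains y v B where "v integrable_on {a..b}" "\<And>s. s \<in> {a..b} \<Longrightarrow> norm (v s) \<le> B"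
    "\<And>s. s \<in> {a..b} \<Longrightarrow> v s \<in> G s (y s)"
    "\<And>t. t \<in> {a..b} \<Longrightarrow> y t = y0 + integral {a..t} v"
    "\<And>t. t \<in> {a..b} \<Longrightarrow> norm (y t - x t) \<le> 3 * exp (2 * L * (b - a)) * (integral {a..b} \<gamma> + norm (y0 - x a))"
proof -
  define arc where "arc v t = y0 + integral {a..t} v" for v :: "real \<Rightarrow> 'a" and t
  define step where "step v s = closest_point (G s (arc v s)) (v s)" for v :: "real \<Rightarrow> 'a" and s
  define vs where "vs k = (step ^^ k) v0" for k
  define ys where "ys k = arc (vs k)" for k
  have vs0: "vs 0 = v0" and vsS: "vs (Suc k) s = closest_point (G s (ys k s)) (vs k s)" for k s
    by (simp_all add: vs_def ys_def step_def)
  have Gcl: "closed (G s y)" if "s \<in> {a..b}" for s y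
  proof -
    have "closed ((\<lambda>w. (s,y,w)) -` {(s,y,w). s \<in> {a..b} \<and> w \<in> G s y})"
      by (intro closed_vimage graph continuous_intros)
    also have "(\<lambda>w. (s,y,w)) -` {(s,y,w). s \<in> {a..b} \<and> w \<in> G s y} = G s y" using that by auto
    finally show ?thesis .
  qed
  have arc_cont: "continuous_on {a..b} (arc v)" if "v integrable_on {a..b}" for v
    unfolding arc_def by (intro continuous_intros indefinite_integral_continuous_1 that)
  \<comment> \<open>Measurability and boundedness have to be carried along together: the bound makes
    the next arc continuous and the set of velocities along it compact, and compactness makes the
    next projection measurable.\<close>
  have inv: "vs k \<in> borel_measurable (lebesgue_on {a..b}) \<and> (\<exists>B. \<forall>s\<in>{a..b}. norm (vs k s) \<le> B)" for k
  proof (induction k)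
    case 0 then show ?case unfolding vs0 using v0 by blast
  next
    case (Suc k)
    then obtain B where B: "\<And>s. s \<in> {a..b} \<Longrightarrow> norm (vs k s) \<le> B" by blast
    have int: "vs k integrable_on {a..b}" using Suc B bounded_measurable_integrable_on by blast
    have yc: "continuous_on {a..b} (ys k)" unfolding ys_def by (rule arc_cont[OF int])
    then have "bounded (ys k ` {a..b})" by (intro compact_imp_bounded compact_continuous_image) auto
    then obtain Y where Y: "\<And>s. s \<in> {a..b} \<Longrightarrow> norm (ys k s) \<le> Y" unfolding bounded_iff by blast
    have M0: "0 \<le> M"
    proof -
      obtain w where "w \<in> G a 0" using ne[of a 0] ab by auto
      then have "norm w \<le> M" using growth[of a w 0] ab by simp
      then show ?thesis using norm_ge_zero order_trans by blast
    qed
    have gb: "norm w \<le> M * (1 + Y)" if "s \<in> {a..b}" "w \<in> G s (ys k s)" for s w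
    proof -
      have "norm w \<le> M * (1 + norm (ys k s))" by (rule growth[OF that])
      also have "\<dots> \<le> M * (1 + Y)" using Y[OF that(1)] M0 by (intro mult_left_mono) auto
      finally show ?thesis .
    qed
    have cpt: "compact {(s,w). s \<in> {a..b} \<and> w \<in> G s (ys k s)}"
    proof -
      have "closed ({a..b} \<times> UNIV \<inter> (\<lambda>(s,w). (s, ys k s, w)) -` {(s,y,w). s \<in> {a..b} \<and> w \<in> G s y})"
        unfolding case_prod_unfold
        by (intro continuous_closed_preimage graph[unfolded case_prod_unfold] continuous_intros closed_Times
            continuous_on_compose2[OF yc]) auto
      also have "{a..b} \<times> UNIV \<inter> (\<lambda>(s,w). (s, ys k s, w)) -` {(s,y,w). s \<in> {a..b} \<and> w \<in> G s y} =
          {(s,w). s \<in> {a..b} \<and> w \<in> G s (ys k s)}" by auto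
      finally have "closed {(s,w). s \<in> {a..b} \<and> w \<in> G s (ys k s)}" .
      moreover have "{(s,w). s \<in> {a..b} \<and> w \<in> G s (ys k s)} \<subseteq> {a..b} \<times> cball 0 (M * (1 + Y))"
        using gb by auto
      moreover have "bounded ({a..b} \<times> cball (0::'a) (M * (1 + Y)))" by (intro bounded_Times) auto
      ultimately show ?thesis using bounded_subset compact_eq_bounded_closed by blast
    qed
    have "(\<lambda>s. closest_point (G s (ys k s)) (vs k s)) \<in> borel_measurable (lebesgue_on {a..b})"
      by (rule closest_point_measurable[OF cpt]) (use ne cv Suc in auto)
    moreover have "norm (vs (Suc k) s) \<le> M * (1 + Y)" if "s \<in> {a..b}" for s
      unfolding vsS by (rule gb[OF that closest_point_in_set]) (intro Gcl ne that)+
    moreover have "vs (Suc k) = (\<lambda>s. closest_point (G s (ys k s)) (vs k s))" by (rule ext) (rule vsS)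
    ultimately show ?case by (metis (no_types, lifting))
  qed
  then have int: "vs k integrable_on {a..b}" for k using bounded_measurable_integrable_on by blast
  then have intt: "vs k integrable_on {a..t}" if "t \<in> {a..b}" for k t
    by (rule integrable_on_subinterval[of "vs k" "{a..b}"]) (use that int in auto)
  have ysc: "continuous_on {a..b} (ys k)" for k unfolding ys_def by (rule arc_cont[OF int])
  have vG: "vs (Suc k) s \<in> G s (ys k s)" if "s \<in> {a..b}" for k s
    unfolding vsS by (intro closest_point_in_set Gcl ne that)
  have vle: "norm (vs (Suc k) s - vs k s) \<le> norm (w - vs k s)" if "s \<in> {a..b}" "w \<in> G s (ys k s)" for s k w
    using closest_point_le[OF Gcl[OF that(1)] that(2), of "vs k s"] unfolding vsS
    by (simp add: dist_norm norm_minus_commute)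
  define \<eta> where "\<eta> = norm (y0 - x a)"
  \<comment> \<open>The zeroth arc has the velocity of \<open>x\<close> but starts at
    \<open>y0\<close>, so it is a translate of \<open>x\<close>.\<close>
  have ys0: "ys 0 t - x t = y0 - x a" if "t \<in> {a..b}" for t
    using x[OF that] by (simp add: ys_def arc_def vs0)
  \<comment> \<open>A velocity that is admissible along \<open>x\<close> is carried over to the
    translate by the Lipschitz condition, at the cost \<open>L * \<eta>\<close>.\<close>
  have v1: "norm (vs 1 s - vs 0 s) \<le> \<gamma> s + L * \<eta>" if s: "s \<in> {a..b}" for s
  proof -
    obtain w where w: "w \<in> G s (x s)" "norm (w - v0 s) \<le> \<gamma> s" using defect[OF s] by blast
    obtain w' where w': "w' \<in> G s (ys 0 s)" "norm (w' - w) \<le> L * norm (ys 0 s - x s)" using lip[OF s w(1)] by blast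
    have "norm (vs 1 s - vs 0 s) \<le> norm (w' - v0 s)" using vle[OF s w'(1)] by (simp add: vs0)
    also have "\<dots> \<le> norm (w' - w) + norm (w - v0 s)" using norm_triangle_ineq[of "w' - w" "w - v0 s"] by simp
    finally show ?thesis using w w' ys0[OF s] by (simp add: \<eta>_def)
  qed
  have v2: "norm (vs (Suc (Suc k)) s - vs (Suc k) s) \<le> L * norm (ys (Suc k) s - ys k s)" if s: "s \<in> {a..b}" for s k
  proof -
    obtain w where w: "w \<in> G s (ys (Suc k) s)" "norm (w - vs (Suc k) s) \<le> L * norm (ys (Suc k) s - ys k s)"
      using lip[OF s vG[OF s, of k]] by blast
    then show ?thesis using vle[OF s w(1)] by linarith
  qed
  define K where "K = integral {a..b} \<gamma> + \<eta>"
  have \<gamma>0: "0 \<le> \<gamma> s" if "s \<in> {a..b}" for s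
    using defect[OF that] norm_ge_zero order_trans by blast
  have \<gamma>i: "0 \<le> integral {a..b} \<gamma>" using \<gamma>0 by (intro Henstock_Kurzweil_Integration.integral_nonneg \<gamma>) auto
  have K: "K \<ge> \<eta>" "\<eta> \<ge> 0" "K \<ge> 0" using \<gamma>i by (auto simp: K_def \<eta>_def)
  have ydiff: "ys (Suc k) t - ys k t = integral {a..t} (\<lambda>s. vs (Suc k) s - vs k s)" if "t \<in> {a..b}" for k t
    using intt[OF that] by (simp add: ys_def arc_def Henstock_Kurzweil_Integration.integral_diff)
  have yd: "norm (ys (Suc k) t - ys k t) \<le> K * exp (2 * L * (t - a)) / 2 ^ k" if "t \<in> {a..b}" for k t
    using that
  proof (induction k arbitrary: t)
    case 0
    have gi: "\<gamma> integrable_on {a..t}" using \<gamma> 0 by (auto intro: integrable_on_subinterval)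
    have "norm (ys 1 t - ys 0 t) \<le> integral {a..t} (\<lambda>s. \<gamma> s + L * \<eta>)"
      using ydiff[OF 0, of 0] v1 0 intt[OF 0] gi
      by (auto intro!: Henstock_Kurzweil_Integration.integral_norm_bound_integral integrable_diff integrable_add)
    also have "\<dots> = integral {a..t} \<gamma> + L * \<eta> * (t - a)"
      using gi 0 by (subst Henstock_Kurzweil_Integration.integral_add) auto
    also have "\<dots> \<le> integral {a..b} \<gamma> + \<eta> * (L * (t - a))"
      using gi \<gamma> 0 \<gamma>0 by (auto intro!: integral_subset_le simp: algebra_simps)
    also have "\<dots> \<le> integral {a..b} \<gamma> * exp (2 * L * (t - a)) + \<eta> * exp (2 * L * (t - a))"
    proof (intro add_mono mult_left_mono)
      have nn: "0 \<le> L * (t - a)" using L 0 by simp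
      then have "1 \<le> exp (2 * L * (t - a))" by simp
      then show "integral {a..b} \<gamma> \<le> integral {a..b} \<gamma> * exp (2 * L * (t - a))"
        using \<gamma>i by (simp add: mult_le_cancel_left1)
      show "L * (t - a) \<le> exp (2 * L * (t - a))"
        using exp_ge_add_one_self[of "2 * L * (t - a)"] nn by linarith
    qed (use K in auto)
    finally show ?case by (simp add: K_def algebra_simps)
  next
    case (Suc k)
    let ?f = "\<lambda>s. L * (K * exp (2 * L * (s - a)) / 2 ^ k)"
    have fi: "(?f has_integral (K * exp (2 * L * (t - a)) / 2 ^ Suc k - K * exp (2 * L * (a - a)) / 2 ^ Suc k)) {a..t}"
    proof (rule fundamental_theorem_of_calculus)
      show "a \<le> t" using Suc by simp
      fix s
      have "((\<lambda>s. K * exp (2 * L * (s - a)) / 2 ^ Suc k) has_real_derivative ?f s) (at s within {a..t})"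
        by (auto intro!: derivative_eq_intros simp: field_simps)
      then show "((\<lambda>s. K * exp (2 * L * (s - a)) / 2 ^ Suc k) has_vector_derivative ?f s) (at s within {a..t})"
        by (simp add: has_real_derivative_iff_has_vector_derivative)
    qed
    have "norm (ys (Suc (Suc k)) t - ys (Suc k) t) \<le> integral {a..t} ?f"
      unfolding ydiff[OF Suc.prems]
    proof (rule Henstock_Kurzweil_Integration.integral_norm_bound_integral)
      show "(\<lambda>s. vs (Suc (Suc k)) s - vs (Suc k) s) integrable_on {a..t}"
        using intt[OF Suc.prems] by (intro integrable_diff)
      show "?f integrable_on {a..t}" using fi by blast
      fix s assume "s \<in> {a..t}"
      then have s: "s \<in> {a..b}" using Suc.prems by auto
      show "norm (vs (Suc (Suc k)) s - vs (Suc k) s) \<le> ?f s"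
        using v2[OF s, of k] mult_left_mono[OF Suc.IH[OF s] less_imp_le[OF L]] by linarith
    qed
    also have "\<dots> = K * exp (2 * L * (t - a)) / 2 ^ Suc k - K / 2 ^ Suc k"
      using integral_unique[OF fi] by simp
    also have "\<dots> \<le> K * exp (2 * L * (t - a)) / 2 ^ Suc k" using K by simp
    finally show ?case .
  qed
  define B where "B = K * exp (2 * L * (b - a))"
  have B: "norm (ys (Suc k) t - ys k t) \<le> B / 2 ^ k" if "t \<in> {a..b}" for k t
  proof -
    have "K * exp (2 * L * (t - a)) \<le> B" using that L K by (auto simp: B_def intro!: mult_left_mono)
    then show ?thesis using yd[OF that, of k] by (meson divide_right_mono order_trans zero_le_numeral zero_le_power)
  qed
  have Bv: "norm (vs (Suc (Suc k)) s - vs (Suc k) s) \<le> L * B / 2 ^ k" if "s \<in> {a..b}" for s k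
    using v2[OF that, of k] mult_left_mono[OF B[OF that, of k] less_imp_le[OF L]] by simp
  \<comment> \<open>The velocities are indexed from one: the first correction is governed by
    \<open>\<gamma>\<close>, which is merely integrable, and only the later ones decay uniformly in
    \<open>s\<close>.\<close>
  have "\<exists>l. \<forall>s\<in>{a..b}. (\<lambda>k. vs (Suc k) s) \<longlonglongrightarrow> l s \<and> (\<forall>k. norm (l s - vs (Suc k) s) \<le> 2 * (L * B) / 2 ^ k)"
    by (intro bchoice ballI geometric_steps_convergent Bv)
  then obtain v where v: "\<And>s. s \<in> {a..b} \<Longrightarrow> (\<lambda>k. vs (Suc k) s) \<longlonglongrightarrow> v s"
    "\<And>s k. s \<in> {a..b} \<Longrightarrow> norm (v s - vs (Suc k) s) \<le> 2 * (L * B) / 2 ^ k" by blast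
  have vm: "v \<in> borel_measurable (lebesgue_on {a..b})"
    by (rule borel_measurable_LIMSEQ_metric[where f="\<lambda>k. vs (Suc k)"]) (use inv v in auto)
  obtain B1 where B1: "\<And>s. s \<in> {a..b} \<Longrightarrow> norm (vs 1 s) \<le> B1" using inv[of 1] by blast
  have vb: "norm (v s) \<le> B1 + 2 * (L * B)" if "s \<in> {a..b}" for s
    using v(2)[OF that, of 0] B1[OF that] norm_triangle_ineq[of "v s - vs 1 s" "vs 1 s"] by simp
  have vint: "v integrable_on {a..b}" by (rule bounded_measurable_integrable_on[OF vm vb])
  have yB: "\<exists>l. (\<lambda>k. ys k t) \<longlonglongrightarrow> l \<and> (\<forall>k. norm (l - ys k t) \<le> 2 * B / 2 ^ k)" if "t \<in> {a..b}" for t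
    by (intro geometric_steps_convergent B that)
  have ylim: "(\<lambda>k. ys (Suc k) t) \<longlonglongrightarrow> arc v t" if t: "t \<in> {a..b}" for t
  proof -
    have vt: "v integrable_on {a..t}" using vint t by (auto intro: integrable_on_subinterval)
    have bd: "norm (ys (Suc k) t - arc v t) \<le> 2 * (L * B) / 2 ^ k * (t - a)" for k
    proof -
      have "arc v t - ys (Suc k) t = integral {a..t} (\<lambda>s. v s - vs (Suc k) s)"
        using vt intt[OF t] by (simp add: ys_def arc_def Henstock_Kurzweil_Integration.integral_diff)
      also have "norm \<dots> \<le> integral {a..t} (\<lambda>s. 2 * (L * B) / 2 ^ k)"
        using vt intt[OF t] v(2) t
        by (intro Henstock_Kurzweil_Integration.integral_norm_bound_integral integrable_diff) auto
      finally show ?thesis using t by (simp add: norm_minus_commute mult_ac)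
    qed
    have "(\<lambda>k. 2 * (L * B) * (t - a) * (1/2) ^ k) \<longlonglongrightarrow> 2 * (L * B) * (t - a) * 0"
      by (intro tendsto_intros LIMSEQ_realpow_zero) auto
    then have "(\<lambda>k. 2 * (L * B) / 2 ^ k * (t - a)) \<longlonglongrightarrow> 0"
      by (simp add: power_one_over mult_ac)
    then have "(\<lambda>k. ys (Suc k) t - arc v t) \<longlonglongrightarrow> 0"
      by (rule Lim_null_comparison[rotated]) (use bd in auto)
    then show ?thesis by (simp add: LIM_zero_iff)
  qed
  show thesis
  proof (rule that[of v "B1 + 2 * (L * B)" "arc v"])
    show "v s \<in> G s (arc v s)" if s: "s \<in> {a..b}" for s
    proof -
      have lim: "(\<lambda>k. (s, ys (Suc k) s, vs (Suc (Suc k)) s)) \<longlonglongrightarrow> (s, arc v s, v s)"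
        using LIMSEQ_Suc[OF v(1)[OF s]] by (intro tendsto_intros ylim[OF s]) auto
      have "(s, ys (Suc k) s, vs (Suc (Suc k)) s) \<in> {(s,y,w). s \<in> {a..b} \<and> w \<in> G s y}" for k
        using vG[OF s] s by auto
      then have "(s, arc v s, v s) \<in> {(s,y,w). s \<in> {a..b} \<and> w \<in> G s y}"
        by (rule closed_sequentially[OF graph _ lim])
      then show ?thesis by simp
    qed
    show "norm (arc v t - x t) \<le> 3 * exp (2 * L * (b - a)) * (integral {a..b} \<gamma> + norm (y0 - x a))"
      if t: "t \<in> {a..b}" for t
    proof -
      obtain l where l: "(\<lambda>k. ys k t) \<longlonglongrightarrow> l" "\<And>k. norm (l - ys k t) \<le> 2 * B / 2 ^ k" using yB[OF t] by blast
      have "l = arc v t" using LIMSEQ_Suc[OF l(1)] ylim[OF t] by (rule LIMSEQ_unique)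
      \<comment> \<open>The constant 3 in the estimate is \<open>2 * B\<close> for the geometric
        series of corrections plus \<open>B\<close> for the translation from \<open>x\<close> to the
        zeroth arc.\<close>
      then have "norm (arc v t - ys 0 t) \<le> 2 * B" using l(2)[of 0] by simp
      moreover have "norm (ys 0 t - x t) \<le> B"
      proof -
        have "1 \<le> exp (2 * L * (b - a))" using L ab by simp
        then have "K \<le> B" using K mult_left_mono[of 1 "exp (2 * L * (b - a))" K] by (simp add: B_def)
        then show ?thesis using K ys0[OF t] by (simp add: \<eta>_def)
      qed
      ultimately have "norm (arc v t - x t) \<le> 3 * B"
        using norm_triangle_ineq[of "arc v t - ys 0 t" "ys 0 t - x t"] by simp
      then show ?thesis by (simp add: B_def K_def \<eta>_def mult_ac)
    qed
  qed (use vint vb in \<open>auto simp: arc_def\<close>)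
qed

section \<open>Semiconvexity, generalized differentials and strong convexity\<close>

lemma frechet_subdiff_iff:
  "p \<in> frechet_subdiff S f x \<longleftrightarrow>
    (\<forall>e>0. \<forall>\<^sub>F y in at x within S. f y - f x - p \<bullet> (y - x) \<ge> - e * norm (y - x))"
proof -
  have ev: "\<forall>\<^sub>F y in at x within S. y \<noteq> x" by (simp add: eventually_at_filter)
  have key: "\<forall>\<^sub>F y in at x within S. f y - f x - p \<bullet> (y - x) \<ge> - e * norm (y - x)"
    if "\<forall>\<^sub>F y in at x within S. - e < (f y - f x - p \<bullet> (y - x)) / norm (y - x)" for e
    using that ev
  proof eventually_elim
    case (elim y)
    then have n: "0 < norm (y - x)" by simp
    show ?case using elim(1) unfolding pos_less_divide_eq[OF n] by simp
  qed
  have key2: "\<forall>\<^sub>F y in at x within S. - e < (f y - f x - p \<bullet> (y - x)) / norm (y - x)"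
    if "\<forall>\<^sub>F y in at x within S. f y - f x - p \<bullet> (y - x) \<ge> - (e/2) * norm (y - x)" "e > 0" for e
    using that(1) ev
  proof eventually_elim
    case (elim y)
    then have n: "0 < norm (y - x)" by simp
    then have "- (e / 2) \<le> (f y - f x - p \<bullet> (y - x)) / norm (y - x)"
      using elim by (simp add: pos_le_divide_eq)
    then show ?case using that(2) by linarith
  qed
  show ?thesis
  proof
    assume p: "p \<in> frechet_subdiff S f x"
    show "\<forall>e>0. \<forall>\<^sub>F y in at x within S. f y - f x - p \<bullet> (y - x) \<ge> - e * norm (y - x)"
    proof (intro allI impI key)
      fix e :: real assume "e > 0"
      then have "ereal (- e) < 0" by simp
      then have "\<forall>\<^sub>F y in at x within S. ereal (- e) < ereal ((f y - f x - p \<bullet> (y - x)) / norm (y - x))"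
        using p unfolding frechet_subdiff_def le_Liminf_iff by blast
      then show "\<forall>\<^sub>F y in at x within S. - e < (f y - f x - p \<bullet> (y - x)) / norm (y - x)" by simp
    qed
  next
    assume R: "\<forall>e>0. \<forall>\<^sub>F y in at x within S. f y - f x - p \<bullet> (y - x) \<ge> - e * norm (y - x)"
    show "p \<in> frechet_subdiff S f x"
      unfolding frechet_subdiff_def le_Liminf_iff
    proof (intro CollectI allI impI)
      fix c :: ereal assume c: "c < 0"
      then obtain r where r: "c < ereal r" "ereal r < 0" using ereal_dense2 by blast
      then have r0: "- r > 0" by simp
      have "\<forall>\<^sub>F y in at x within S. - (- r) < (f y - f x - p \<bullet> (y - x)) / norm (y - x)"
      proof (rule key2)
        show "\<forall>\<^sub>F y in at x within S. f y - f x - p \<bullet> (y - x) \<ge> - (- r / 2) * norm (y - x)"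
          using R r0 by (meson half_gt_zero)
      qed (rule r0)
      then show "\<forall>\<^sub>F y in at x within S. c < ereal ((f y - f x - p \<bullet> (y - x)) / norm (y - x))"
        by eventually_elim (use r in \<open>auto intro: less_trans\<close>)
    qed
  qed
qed

lemma frechet_superdiff_eq_subdiff_neg: "p \<in> frechet_superdiff S f x \<longleftrightarrow> - p \<in> frechet_subdiff S (\<lambda>y. - f y) x"
proof -
  have *: "((- f y) - (- f x) - (- p) \<bullet> (y - x)) / norm (y - x) = - ((f y - f x - p \<bullet> (y - x)) / norm (y - x))" for y
    by (simp add: minus_divide_left)
  show ?thesis
    unfolding frechet_superdiff_def frechet_subdiff_def mem_Collect_eq * uminus_ereal.simps(1)[symmetric] ereal_Liminf_uminus
    by (simp add: ereal_0_le_uminus_iff)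
qed

lemma frechet_superdiff_iff:
  "p \<in> frechet_superdiff S f x \<longleftrightarrow>
    (\<forall>e>0. \<forall>\<^sub>F y in at x within S. f y - f x - p \<bullet> (y - x) \<le> e * norm (y - x))"
proof -
  have *: "(- f y - - f x - - p \<bullet> (y - x) \<ge> - e * norm (y - x)) \<longleftrightarrow> f y - f x - p \<bullet> (y - x) \<le> e * norm (y - x)" for y e
    by (auto simp: algebra_simps)
  show ?thesis unfolding frechet_superdiff_eq_subdiff_neg frechet_subdiff_iff * ..
qed

text \<open>Subtract the chord. If the remainder had a positive maximum on the segment, the midpoint
  inequality at the leftmost maximizer would produce a maximizer further to the left.\<close>

lemma midpoint_convex_imp_convex_on:
  fixes u :: "'a::real_normed_vector \<Rightarrow> real"
  assumes A: "convex A" and cont: "continuous_on A u"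
    and mid: "\<And>x h. closed_segment (x - h) (x + h) \<subseteq> A \<Longrightarrow> u (x + h) + u (x - h) \<ge> 2 * u x"
  shows "convex_on A u"
proof (rule convex_onI[OF _ A])
  fix t :: real and x y assume t: "0 < t" "t < 1" and xy: "x \<in> A" "y \<in> A"
  define z where "z s = (1 - s) *\<^sub>R x + s *\<^sub>R y" for s
  define g where "g s = u (z s) - ((1 - s) * u x + s * u y)" for s
  have zA: "z s \<in> A" if "s \<in> {0..1}" for s
    using that xy A unfolding z_def by (intro convexD) auto
  have cg: "continuous_on {0..1} g"
    unfolding g_def by (intro continuous_intros continuous_on_compose2[OF cont]) (auto simp: z_def intro!: continuous_intros zA[unfolded z_def])
  have g01: "g 0 = 0" "g 1 = 0" by (auto simp: g_def z_def)
  obtain m where m: "m \<in> {0..1}" "\<And>s. s \<in> {0..1} \<Longrightarrow> g s \<le> g m"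
    using continuous_attains_sup[OF compact_Icc _ cg] by auto
  have "g m \<le> 0"
  proof (rule ccontr)
    assume pos: "\<not> g m \<le> 0"
    define W where "W = {s\<in>{0..1}. g s = g m}"
    have "W = {0..1} \<inter> g -` {g m}" by (auto simp: W_def)
    moreover have "closed ({0..1} \<inter> g -` {g m})" by (intro continuous_closed_preimage cg) auto
    ultimately have cW: "closed W" by simp
    have bW: "bdd_below W" unfolding W_def by (rule bdd_belowI[of _ 0]) auto
    define w where "w = Inf W"
    have "m \<in> W" using m by (simp add: W_def)
    then have w: "w \<in> W" unfolding w_def using closed_contains_Inf[OF _ bW cW] by blast
    then have w01: "0 < w" "w < 1" using g01 pos by (auto simp: W_def less_le)
    define h where "h = min w (1 - w)"
    have h: "h > 0" "w - h \<in> {0..1}" "w + h \<in> {0..1}" using w01 by (auto simp: h_def)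
    have e: "z (w - h) = z w - h *\<^sub>R (y - x)" "z (w + h) = z w + h *\<^sub>R (y - x)"
      by (simp_all add: z_def algebra_simps)
    have "closed_segment (z w - h *\<^sub>R (y - x)) (z w + h *\<^sub>R (y - x)) \<subseteq> A"
      using zA[OF h(2)] zA[OF h(3)] A unfolding e by (intro closed_segment_subset) auto
    then have "2 * g w \<le> g (w + h) + g (w - h)"
      using mid[of "z w" "h *\<^sub>R (y - x)"] unfolding e[symmetric] by (simp add: g_def algebra_simps)
    then have "g (w - h) = g m" using m(2)[OF h(2)] m(2)[OF h(3)] w by (auto simp: W_def)
    then have "w - h \<in> W" using h by (simp add: W_def)
    then have "w \<le> w - h" unfolding w_def by (intro cInf_lower bW)
    with h show False by simp
  qed
  then have "g t \<le> 0" using m(2)[of t] t by auto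
  then show "u ((1 - t) *\<^sub>R x + t *\<^sub>R y) \<le> (1 - t) * u x + t * u y" by (simp add: g_def z_def)
qed

text \<open>By the parallelogram identity the second difference of the quadratic term is exactly
  \<open>C * (norm h)\<^sup>2\<close>. The centre \<open>z\<close> is left free so that it can be
  put at the point of interest, where the quadratic has zero value and zero slope.\<close>

lemma semiconvex_imp_convex_on:
  fixes u :: "'a::real_inner \<Rightarrow> real"
  assumes u: "semiconvex_on_with C A u" and A: "convex A"
  shows "convex_on A (\<lambda>y. u y + C / 2 * (norm (y - z))\<^sup>2)"
proof (rule midpoint_convex_imp_convex_on[OF A])
  show "continuous_on A (\<lambda>y. u y + C / 2 * (norm (y - z))\<^sup>2)"
    using u continuous_on_minus[of A "\<lambda>x. - u x"]
    by (intro continuous_intros) (simp add: semiconvex_on_with_def semiconcave_on_with_def)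
  fix x h assume "closed_segment (x - h) (x + h) \<subseteq> A"
  then have "- u (x + h) - u (x - h) + 2 * u x \<le> C * (norm h)\<^sup>2"
    using u by (force simp: semiconvex_on_with_def semiconcave_on_with_def)
  moreover have par: "(norm (x + h - z))\<^sup>2 + (norm (x - h - z))\<^sup>2 = 2 * (norm (x - z))\<^sup>2 + 2 * (norm h)\<^sup>2"
    by (simp add: power2_norm_eq_inner inner_diff_left inner_diff_right inner_add_left inner_add_right inner_commute)
  have "C / 2 * (norm (x + h - z))\<^sup>2 + C / 2 * (norm (x - h - z))\<^sup>2 = C * (norm (x - z))\<^sup>2 + C * (norm h)\<^sup>2"
    unfolding distrib_left[symmetric] par by (simp add: algebra_simps)
  ultimately show "u (x + h) + C / 2 * (norm (x + h - z))\<^sup>2 + (u (x - h) + C / 2 * (norm (x - h - z))\<^sup>2)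
      \<ge> 2 * (u x + C / 2 * (norm (x - z))\<^sup>2)"
    by (simp add: algebra_simps)
qed

text \<open>First-order information at \<open>x\<close> spreads over all of \<open>A\<close>: after
  adding the quadratic the function is convex, so its slope over a tiny step towards
  \<open>y\<close> is at most its slope over the whole segment.\<close>

lemma semiconvex_frechet_subdiff_ge:
  fixes u :: "'a::real_inner \<Rightarrow> real"
  assumes u: "semiconvex_on_with C A u" and A: "convex A" and xy: "x \<in> A" "y \<in> A"
    and w: "w \<in> frechet_subdiff UNIV u x"
  shows "u y \<ge> u x + w \<bullet> (y - x) - C / 2 * (norm (y - x))\<^sup>2"
proof (rule field_le_epsilon)
  fix e :: real assume e: "e > 0"
  show "u x + w \<bullet> (y - x) - C / 2 * (norm (y - x))\<^sup>2 \<le> u y + e"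
  proof (cases "x = y")
    case False
    define d where "d = y - x"
    have d: "norm d > 0" using False by (simp add: d_def)
    define g where "g y = u y + C / 2 * (norm (y - x))\<^sup>2" for y
    have cg: "convex_on A g" unfolding g_def by (rule semiconvex_imp_convex_on[OF u A])
    have "\<forall>\<^sub>F y in at x. u y - u x - w \<bullet> (y - x) \<ge> - (e / (2 * norm d)) * norm (y - x)"
      using w e d unfolding frechet_subdiff_iff by (metis divide_pos_pos mult_pos_pos zero_less_numeral)
    then obtain r where r: "r > 0" "\<And>y. y \<noteq> x \<Longrightarrow> dist y x < r \<Longrightarrow> u y - u x - w \<bullet> (y - x) \<ge> - (e / (2 * norm d)) * norm (y - x)"
      unfolding eventually_at by auto
    define \<kappa> where "\<kappa> = \<bar>C\<bar> / 2 * (norm d)\<^sup>2"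
    have \<kappa>: "\<kappa> \<ge> 0" by (simp add: \<kappa>_def)
    \<comment> \<open>The three bounds keep the step inside the segment, keep it within the radius
      \<open>r\<close> of the first-order estimate, and make the quadratic error
      \<open>t * \<kappa>\<close> at most \<open>e / 2\<close>. The absolute value in
      \<open>\<kappa>\<close> allows for either sign of \<open>C\<close>.\<close>
    define t where "t = min (1/2) (min (r / (2 * norm d)) (e / (2 * (\<kappa> + 1))))"
    have t: "0 < t" "t < 1" "t \<le> r / (2 * norm d)" "t \<le> e / (2 * (\<kappa> + 1))"
      using r d e \<kappa> by (auto simp: t_def)
    have "t * norm d < r"
    proof -
      have "t * norm d \<le> r / (2 * norm d) * norm d" using t d by (intro mult_right_mono) auto
      also have "\<dots> < r" using d r by simp
      finally show ?thesis .
    qed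
    then have "u (x + t *\<^sub>R d) - u x - w \<bullet> (t *\<^sub>R d) \<ge> - (e / (2 * norm d)) * norm (t *\<^sub>R d)"
      using r(2)[of "x + t *\<^sub>R d"] d t by (simp add: dist_norm)
    then have 1: "u (x + t *\<^sub>R d) - u x \<ge> t * (w \<bullet> d - e / 2)"
      using d t by (simp add: algebra_simps)
    have "g ((1 - t) *\<^sub>R x + t *\<^sub>R y) \<le> (1 - t) * g x + t * g y"
      by (rule convex_onD[OF cg]) (use t xy in auto)
    moreover have "(1 - t) *\<^sub>R x + t *\<^sub>R y = x + t *\<^sub>R d" by (simp add: d_def algebra_simps)
    moreover have gv: "g (x + t *\<^sub>R d) = u (x + t *\<^sub>R d) + C / 2 * (t * norm d)\<^sup>2" "g x = u x"
      "g y = u y + C / 2 * (norm d)\<^sup>2"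
      using t by (simp_all add: g_def d_def)
    ultimately have "g (x + t *\<^sub>R d) - g x \<le> t * (g y - g x)" by (simp add: algebra_simps)
    then have 2: "u (x + t *\<^sub>R d) - u x + C / 2 * (t * norm d)\<^sup>2 \<le> t * (u y - u x + C / 2 * (norm d)\<^sup>2)"
      unfolding gv by (simp add: algebra_simps)
    have "- (t * (t * \<kappa>)) \<le> C / 2 * (t * norm d)\<^sup>2"
    proof -
      have "- \<bar>C\<bar> * ((t * norm d)\<^sup>2 / 2) \<le> C * ((t * norm d)\<^sup>2 / 2)" by (intro mult_right_mono) auto
      then show ?thesis by (simp add: \<kappa>_def power2_eq_square algebra_simps)
    qed
    then have "t * (w \<bullet> d - e / 2 - t * \<kappa>) \<le> t * (u y - u x + C / 2 * (norm d)\<^sup>2)"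
      using 1 2 by (simp add: algebra_simps)
    then have 3: "w \<bullet> d - e / 2 - t * \<kappa> \<le> u y - u x + C / 2 * (norm d)\<^sup>2"
      using t by simp
    have "t * \<kappa> \<le> e / (2 * (\<kappa> + 1)) * (\<kappa> + 1)" using t \<kappa> e by (intro mult_mono) auto
    also have "\<dots> = e / 2"
    proof -
      define l where "l = \<kappa> + 1"
      have "l \<noteq> 0" using \<kappa> by (simp add: l_def)
      then show ?thesis by (simp flip: l_def)
    qed
    finally show ?thesis using 3 unfolding d_def by linarith
  qed (use e in simp)
qed

text \<open>A hyperplane separates the epigraph from the open cone below the graph of
  \<open>\<lambda>y. - K * norm (y - x)\<close>. Lying above the cone bounds its slope by
  \<open>K\<close>; this bound is what later yields Lipschitz dependence of subgradients on the
  costate.\<close>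

lemma convex_minorant_exists:
  fixes k :: "'a::euclidean_space \<Rightarrow> real"
  assumes k: "convex_on S k" and x: "x \<in> S" "k x = 0" and K: "K \<ge> 0"
    and lb: "\<And>y. y \<in> S \<Longrightarrow> k y \<ge> - K * norm (y - x)"
  obtains l where "norm l \<le> K" "\<And>y. y \<in> S \<Longrightarrow> k y \<ge> l \<bullet> (y - x)"
proof -
  define P where "P = {z::'a \<times> real. snd z < - K * norm (fst z - x)}"
  define Q where "Q = epigraph S k"
  have cvP: "convex P"
  proof (rule convexI)
    fix z z' :: "'a \<times> real" and u v :: real
    assume z: "z \<in> P" "z' \<in> P" and uv: "0 \<le> u" "0 \<le> v" "u + v = 1"
    have e: "u *\<^sub>R fst z + v *\<^sub>R fst z' - x = u *\<^sub>R (fst z - x) + v *\<^sub>R (fst z' - x)"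
      using uv by (simp add: algebra_simps flip: scaleR_add_left)
    have "norm (u *\<^sub>R fst z + v *\<^sub>R fst z' - x) \<le> u * norm (fst z - x) + v * norm (fst z' - x)"
      unfolding e using uv by (intro order_trans[OF norm_triangle_ineq]) auto
    then have 1: "- K * (u * norm (fst z - x) + v * norm (fst z' - x)) \<le> - K * norm (u *\<^sub>R fst z + v *\<^sub>R fst z' - x)"
      using K by (intro mult_left_mono_neg) auto
    have "u * snd z + v * snd z' < u * (- K * norm (fst z - x)) + v * (- K * norm (fst z' - x))"
    proof (cases "u = 0")
      case True then show ?thesis using z uv by (simp add: P_def)
    next
      case False
      then have "u * snd z < u * (- K * norm (fst z - x))" using z uv by (intro mult_strict_left_mono) (auto simp: P_def)
      moreover have "v * snd z' \<le> v * (- K * norm (fst z' - x))" using z uv by (intro mult_left_mono) (auto simp: P_def)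
      ultimately show ?thesis by linarith
    qed
    with 1 show "u *\<^sub>R z + v *\<^sub>R z' \<in> P" by (simp add: P_def algebra_simps)
  qed
  have cvQ: "convex Q" unfolding Q_def using k by (rule convex_epigraphI)
  have inP: "(y, - K * norm (y - x) - e) \<in> P" if "e > 0" for y e using that by (simp add: P_def)
  have neP: "P \<noteq> {}" using inP[of 1 x] by auto
  have xQ: "(x, 0) \<in> Q" using x by (simp add: Q_def epigraph_def)
  have disj: "P \<inter> Q = {}" using lb by (force simp: P_def Q_def epigraph_def)
  obtain a b where ab: "a \<noteq> 0" "\<forall>z\<in>P. a \<bullet> z \<le> b" "\<forall>z\<in>Q. b \<le> a \<bullet> z"
    using separating_hyperplane_sets[OF cvP cvQ neP _ disj] xQ by blast
  obtain \<alpha> \<beta> where a: "a = (\<alpha>, \<beta>)" by (cases a)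
  have P': "\<alpha> \<bullet> y - \<beta> * (K * norm (y - x)) - \<beta> * e \<le> b" if "e > 0" for y e
    using ab(2) inP[OF that, of y] by (fastforce simp: a algebra_simps)
  have Q': "b \<le> \<alpha> \<bullet> y + \<beta> * k y" if "y \<in> S" for y
    using ab(3) that by (auto simp: Q_def epigraph_def a)
  have bx: "b \<le> \<alpha> \<bullet> x" using Q'[of x] x by simp
  have \<beta>0: "\<beta> \<ge> 0" using P'[of 1 x] bx by simp
  \<comment> \<open>A vertical hyperplane is impossible because the cone projects onto the whole
    space.\<close>
  have \<beta>: "\<beta> > 0"
  proof (rule ccontr)
    assume "\<not> \<beta> > 0"
    with \<beta>0 have b0: "\<beta> = 0" by simp
    have "\<alpha> \<bullet> (x + \<alpha>) \<le> \<alpha> \<bullet> x" using P'[of 1 "x + \<alpha>"] bx b0 by simp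
    then have "\<alpha> \<bullet> \<alpha> \<le> 0" by (simp add: inner_add_right)
    then have "\<alpha> = 0" using inner_ge_zero[of \<alpha>] by (simp add: order_antisym)
    with ab(1) a b0 show False by (simp add: zero_prod_def)
  qed
  have P2: "\<alpha> \<bullet> y - \<beta> * (K * norm (y - x)) \<le> b" for y
  proof (rule field_le_epsilon)
    fix e :: real assume "e > 0"
    then show "\<alpha> \<bullet> y - \<beta> * (K * norm (y - x)) \<le> b + e" using P'[of "e / \<beta>" y] \<beta> by simp
  qed
  have bx': "b = \<alpha> \<bullet> x" using bx P2[of x] by simp
  define l where "l = - (1 / \<beta>) *\<^sub>R \<alpha>"
  have l: "l \<bullet> z = - (\<alpha> \<bullet> z) / \<beta>" for z by (simp add: l_def)
  have l1: "- (l \<bullet> (y - x)) \<le> K * norm (y - x)" for y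
    using P2[of y] \<beta> by (simp add: l bx' inner_diff_right field_simps)
  have "norm l \<le> K"
  proof (cases "l = 0")
    case False
    have "l \<bullet> l \<le> K * norm l" using l1[of "x - l"] by simp
    then have "norm l * norm l \<le> K * norm l" by (simp flip: power2_norm_eq_inner power2_eq_square)
    then show ?thesis using False by simp
  qed (use K in simp)
  moreover have "k y \<ge> l \<bullet> (y - x)" if "y \<in> S" for y
    using Q'[OF that] \<beta> by (simp add: l bx' inner_diff_right field_simps)
  ultimately show thesis using that by blast
qed

text \<open>Pairs closer than a Lebesgue number of the cover share one of finitely many balls, and
  for all other pairs the uniform bound \<open>B\<close> is at most a multiple of the distance. The
  index \<open>i\<close> keeps the constant uniform over a family.\<close>

lemma locally_lipschitz_bound_compact:
  fixes D :: "'i \<Rightarrow> 'a::heine_borel \<Rightarrow> 'a \<Rightarrow> real"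
  assumes K: "compact K"
    and B: "\<And>i y z. i \<in> I \<Longrightarrow> y \<in> K \<Longrightarrow> z \<in> K \<Longrightarrow> D i y z \<le> B"
    and loc: "\<And>x. x \<in> K \<Longrightarrow> \<exists>e>0. \<exists>L. \<forall>i\<in>I. \<forall>y\<in>K \<inter> ball x e. \<forall>z\<in>K \<inter> ball x e. D i y z \<le> L * dist y z"
  shows "\<exists>L>0. \<forall>i\<in>I. \<forall>y\<in>K. \<forall>z\<in>K. D i y z \<le> L * dist y z"
proof -
  obtain e L where e: "\<And>x. x \<in> K \<Longrightarrow> e x > 0"
    and L: "\<And>x i y z. x \<in> K \<Longrightarrow> i \<in> I \<Longrightarrow> y \<in> K \<inter> ball x (e x) \<Longrightarrow> z \<in> K \<inter> ball x (e x) \<Longrightarrow> D i y z \<le> L x * dist y z"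
    using loc by metis
  have "K \<subseteq> (\<Union>x\<in>K. ball x (e x))" using e by fastforce
  then obtain C where C: "C \<subseteq> K" "finite C" "K \<subseteq> (\<Union>x\<in>C. ball x (e x))"
    using compactE_image[OF K, of K "\<lambda>x. ball x (e x)"] by auto
  obtain \<delta> where \<delta>: "\<delta> > 0" "\<forall>x\<in>K. \<exists>G\<in>(\<lambda>x. ball x (e x)) ` C. ball x \<delta> \<subseteq> G"
  proof (rule Heine_Borel_lemma[OF K, of "(\<lambda>x. ball x (e x)) ` C"])
    show "K \<subseteq> \<Union> ((\<lambda>x. ball x (e x)) ` C)" using C(3) by simp
  qed (use that in auto)
  \<comment> \<open>The terms serve, in order, positivity, distant pairs, and pairs inside a common
    ball.\<close>
  define L' where "L' = 1 + \<bar>B\<bar> / \<delta> + (\<Sum>x\<in>C. \<bar>L x\<bar>)"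
  have L'1: "\<bar>B\<bar> / \<delta> \<le> L'" using sum_nonneg[of C "\<lambda>x. \<bar>L x\<bar>"] by (simp add: L'_def)
  have L'2: "L x \<le> L'" if "x \<in> C" for x
  proof -
    have "\<bar>L x\<bar> \<le> (\<Sum>x\<in>C. \<bar>L x\<bar>)" using that C by (intro member_le_sum) auto
    moreover have "0 \<le> \<bar>B\<bar> / \<delta>" using \<delta> by simp
    ultimately show ?thesis unfolding L'_def by linarith
  qed
  show ?thesis
  proof (intro exI[of _ L'] conjI ballI)
    have "0 \<le> \<bar>B\<bar> / \<delta>" using \<delta> by simp
    moreover have "0 \<le> (\<Sum>x\<in>C. \<bar>L x\<bar>)" by (intro sum_nonneg) simp
    ultimately show "L' > 0" unfolding L'_def by linarith
    fix i y z assume iyz: "i \<in> I" "y \<in> K" "z \<in> K"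
    show "D i y z \<le> L' * dist y z"
    proof (cases "dist y z < \<delta>")
      case True
      obtain x where x: "x \<in> C" "ball y \<delta> \<subseteq> ball x (e x)" using \<delta>(2) iyz by blast
      have "y \<in> ball y \<delta>" "z \<in> ball y \<delta>" using True \<delta>(1) by auto
      then have "y \<in> ball x (e x)" "z \<in> ball x (e x)" using x(2) by blast+
      then have "D i y z \<le> L x * dist y z" using L[of x i y z] x C iyz by auto
      also have "\<dots> \<le> L' * dist y z" using L'2[OF x(1)] by (intro mult_right_mono) auto
      finally show ?thesis .
    next
      case False
      have "D i y z \<le> B" using B iyz by auto
      also have "B \<le> \<bar>B\<bar> / \<delta> * \<delta>" using \<delta> by simp
      also have "\<dots> \<le> L' * dist y z" using L'1 False \<delta> \<open>L' > 0\<close> by (intro mult_mono) auto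
      finally show ?thesis .
    qed
  qed
qed

section \<open>Hausdorff distance and strongly convex sets\<close>

lemma hausdorff_dist_approx:
  fixes A B :: "'a::heine_borel set"
  assumes A: "compact A" "a \<in> A" and B: "compact B" "B \<noteq> {}"
  shows "\<exists>b\<in>B. dist b a \<le> hausdorff_dist A B"
proof -
  obtain b where b: "b \<in> B" "infdist a B = dist a b"
    using infdist_attains_inf[OF compact_imp_closed[OF B(1)] B(2), of a] by metis
  have "bdd_above ((\<lambda>a. infdist a B) ` A)"
    by (intro bounded_imp_bdd_above compact_imp_bounded compact_continuous_image continuous_intros A)
  then have "infdist a B \<le> (SUP a\<in>A. infdist a B)" using A(2) by (intro cSUP_upper)
  with b show ?thesis by (auto simp: hausdorff_dist_def dist_commute intro!: bexI[of _ b])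
qed

lemma hausdorff_dist_le:
  fixes A B :: "'a::metric_space set"
  assumes "A \<noteq> {}" "B \<noteq> {}" "\<And>a b. a \<in> A \<Longrightarrow> b \<in> B \<Longrightarrow> dist a b \<le> d"
  shows "hausdorff_dist A B \<le> d"
  unfolding hausdorff_dist_def
proof (intro max.boundedI cSUP_least assms(1,2))
  show "infdist a B \<le> d" if "a \<in> A" for a
    using assms that by (meson all_not_in_conv infdist_le2)
  show "infdist b A \<le> d" if "b \<in> B" for b
    using assms that by (metis all_not_in_conv dist_commute infdist_le2)
qed

lemma maximizer_in_frontier:
  fixes A :: "'a::real_inner set"
  assumes "closed A" "z \<in> A" "n \<noteq> 0" "\<And>v. v \<in> A \<Longrightarrow> v \<bullet> n \<le> z \<bullet> n"
  shows "z \<in> frontier A"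
proof -
  have "z \<notin> interior A"
  proof
    assume "z \<in> interior A"
    then obtain e where e: "e > 0" "ball z e \<subseteq> A" by (auto simp: mem_interior)
    have "z + (e / (2 * norm n)) *\<^sub>R n \<in> ball z e" using e assms(3) by (simp add: dist_norm)
    then have "(z + (e / (2 * norm n)) *\<^sub>R n) \<bullet> n \<le> z \<bullet> n" using e assms(4) by blast
    then have "e / (2 * norm n) * (n \<bullet> n) \<le> 0" by (simp add: inner_add_left)
    moreover have "e / (2 * norm n) * (n \<bullet> n) > 0" using e assms(3) by (intro mult_pos_pos) auto
    ultimately show False by simp
  qed
  then show ?thesis using assms by (simp add: frontier_def closure_closed)
qed

text \<open>Recasts \<open>R_convex\<close> for maximizers: a unit vector is normal to the set at a
  point exactly when the point maximizes the corresponding linear functional, and such a point lies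
  on the boundary.\<close>

lemma R_convex_maximizers:
  fixes A :: "'a::real_inner set"
  assumes A: "R_convex R A"
    and z: "z \<in> A" "norm n = 1" "\<And>v. v \<in> A \<Longrightarrow> v \<bullet> n \<le> z \<bullet> n"
    and y: "y \<in> A" "norm m = 1" "\<And>v. v \<in> A \<Longrightarrow> v \<bullet> m \<le> y \<bullet> m"
  shows "norm (z - y) \<le> R * norm (n - m)"
proof -
  have c: "closed A" using A by (simp add: R_convex_def compact_imp_closed)
  have "z \<in> frontier A" by (rule maximizer_in_frontier[OF c z(1) _ z(3)]) (use z in auto)
  moreover have "y \<in> frontier A" by (rule maximizer_in_frontier[OF c y(1) _ y(3)]) (use y in auto)
  moreover have "n \<in> normal_cone A z" "m \<in> normal_cone A y"
    using z y by (auto simp: normal_cone_def inner_diff_right inner_commute)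
  ultimately show ?thesis using A z(2) y(2) unfolding R_convex_def by blast
qed

text \<open>The set lies in the ball of radius \<open>2 * R\<close> that touches it at \<open>z\<close> with outer normal \<open>n\<close>.\<close>

lemma R_convex_gap:
  fixes A :: "'a::real_inner set"
  assumes A: "R_convex R A" and R: "R > 0"
    and z: "z \<in> A" "norm n = 1" "\<And>v. v \<in> A \<Longrightarrow> v \<bullet> n \<le> z \<bullet> n" and v: "v \<in> A"
  shows "(norm (v - z))\<^sup>2 / (4 * R) \<le> (z - v) \<bullet> n"
proof -
  define c where "c = z - (2 * R) *\<^sub>R n"
  have nn: "n \<bullet> n = 1" using z(2) by (simp add: dot_square_norm)
  have "norm (v - c) \<le> 2 * R"
  proof (cases "v = c")
    case False
    define m where "m = (v - c) /\<^sub>R norm (v - c)"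
    have m: "norm m = 1" using False by (simp add: m_def)
    have mm: "m \<bullet> m = 1" using m by (simp add: dot_square_norm)
    have "compact A" using A by (simp add: R_convex_def)
    then obtain y where y: "y \<in> A" "\<And>v. v \<in> A \<Longrightarrow> v \<bullet> m \<le> y \<bullet> m"
    proof -
      have "continuous_on A (\<lambda>v. v \<bullet> m)" by (intro continuous_intros)
      then show thesis using continuous_attains_sup[OF \<open>compact A\<close>, of "\<lambda>v. v \<bullet> m"] z(1) that by blast
    qed
    \<comment> \<open>With \<open>m\<close> the direction from the centre \<open>c\<close> to
      \<open>v\<close> and \<open>y\<close> the maximizer in direction \<open>m\<close>, the chain
      bounds the support function: \<open>(norm (m - n))\<^sup>2 = 2 * (1 - m \<bullet> n)\<close>
      for unit vectors, so \<open>(y - c) \<bullet> m \<le> 2 * R\<close>.\<close>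
    have "(y - z) \<bullet> m = (y - z) \<bullet> (m - n) + (y - z) \<bullet> n" by (simp add: inner_diff_right)
    also have "\<dots> \<le> norm (y - z) * norm (m - n) + 0"
      using z(3)[OF y(1)] by (intro add_mono norm_cauchy_schwarz) (auto simp: inner_diff_left)
    also have "\<dots> \<le> R * norm (m - n) * norm (m - n)"
      using R_convex_maximizers[OF A y(1) m y(2) z] by (simp add: mult_right_mono)
    also have "\<dots> = 2 * R * (1 - m \<bullet> n)"
      using nn mm by (simp add: mult.assoc inner_diff_left inner_diff_right inner_commute algebra_simps flip: dot_square_norm power2_eq_square)
    finally have "(y - z) \<bullet> m \<le> 2 * R * (1 - m \<bullet> n)" .
    moreover have "(v - c) \<bullet> m = (v - z) \<bullet> m + 2 * R * (m \<bullet> n)"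
      by (simp add: c_def inner_diff_left inner_add_left inner_commute[of n m])
    moreover have "(v - c) \<bullet> m = norm (v - c)"
      using False by (simp add: m_def dot_square_norm power2_eq_square)
    ultimately show ?thesis using y(2)[OF v] by (simp add: inner_diff_left algebra_simps)
  qed (use R in simp)
  then have "(norm (v - c))\<^sup>2 \<le> (2 * R)\<^sup>2" using R by (intro power_mono) auto
  moreover have "v - c = (v - z) + (2 * R) *\<^sub>R n" by (simp add: c_def)
  moreover have "(norm ((v - z) + (2 * R) *\<^sub>R n))\<^sup>2 = (norm (v - z))\<^sup>2 + 4 * R * ((v - z) \<bullet> n) + 4 * R\<^sup>2"
    unfolding power2_norm_eq_inner inner_add_left inner_add_right
    using nn by (simp add: inner_commute[of n "v - z"] power2_eq_square)
  ultimately have "(norm (v - z))\<^sup>2 + 4 * R * ((v - z) \<bullet> n) + 4 * R\<^sup>2 \<le> 4 * R\<^sup>2"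
    by (simp add: power_mult_distrib)
  then have "(norm (v - z))\<^sup>2 \<le> 4 * R * ((z - v) \<bullet> n)" by (simp add: inner_diff_left algebra_simps)
  then show ?thesis using R by (simp add: field_simps)
qed

section \<open>Semiconcave functions and their superdifferentials\<close>

lemma locally_semiconcave_ball:
  assumes "locally_semiconcave u"
  obtains r C where "r > 0" "C \<ge> 0" "semiconvex_on_with C (ball x r) (\<lambda>y. - u y)"
proof -
  obtain U C where U: "open U" "x \<in> U" "semiconcave_on_with C U u"
    using assms unfolding locally_semiconcave_def by blast
  obtain r where r: "r > 0" "ball x r \<subseteq> U" using U by (meson open_contains_ball)
  have "semiconvex_on_with (max C 0) (ball x r) (\<lambda>y. - u y)"
    unfolding semiconvex_on_with_def semiconcave_on_with_def minus_minus
  proof (intro conjI allI impI)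
    show "continuous_on (ball x r) u"
      using U(3) r continuous_on_subset unfolding semiconcave_on_with_def by blast
    fix y h assume "closed_segment (y - h) (y + h) \<subseteq> ball x r"
    then have "u (y + h) + u (y - h) - 2 * u y \<le> C * (norm h)\<^sup>2"
      using U(3) r unfolding semiconcave_on_with_def by blast
    also have "\<dots> \<le> max C 0 * (norm h)\<^sup>2" by (intro mult_right_mono) auto
    finally show "u (y + h) + u (y - h) - 2 * u y \<le> max C 0 * (norm h)\<^sup>2" .
  qed
  with r show thesis using that[of r "max C 0"] by simp
qed

lemma locally_semiconcave_continuous:
  assumes "locally_semiconcave u"
  shows "continuous_on UNIV u"
proof -
  have "isCont u x" for x
  proof -
    obtain r C where r: "r > 0" "semiconvex_on_with C (ball x r) (\<lambda>y. - u y)"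
      using locally_semiconcave_ball[OF assms] by metis
    then have "continuous_on (ball x r) u" by (simp add: semiconvex_on_with_def semiconcave_on_with_def)
    then show ?thesis using r by (simp add: continuous_on_eq_continuous_at)
  qed
  then show ?thesis by (simp add: continuous_at_imp_continuous_on)
qed

lemma locally_semiconcave_superdiff_le:
  fixes u :: "'a::real_inner \<Rightarrow> real"
  assumes u: "locally_semiconcave u" and q: "q \<in> frechet_superdiff UNIV u x"
  obtains r C where "r > 0" "C \<ge> 0" "\<And>y. norm (y - x) < r \<Longrightarrow> u y \<le> u x + q \<bullet> (y - x) + C * (norm (y - x))\<^sup>2"
proof -
  obtain r C where r: "r > 0" "C \<ge> 0" "semiconvex_on_with C (ball x r) (\<lambda>y. - u y)"
    using locally_semiconcave_ball[OF u] by metis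
  have "u y \<le> u x + q \<bullet> (y - x) + C / 2 * (norm (y - x))\<^sup>2" if "norm (y - x) < r" for y
    using semiconvex_frechet_subdiff_ge[OF r(3) convex_ball, of x y "- q"] q r that
    by (simp add: frechet_superdiff_eq_subdiff_neg dist_norm norm_minus_commute)
  with r show thesis using that[of r "C / 2"] by simp
qed

text \<open>Adding a quadratic to \<open>- u\<close> gives a convex function. An upper bound on a
  ball turns into a lower bound on slopes at the centre, so \<open>convex_minorant_exists\<close>
  supplies a subgradient there, and the quadratic is invisible to first order.\<close>

lemma locally_semiconcave_superdiff_nonempty:
  fixes u :: "'a::euclidean_space \<Rightarrow> real"
  assumes u: "locally_semiconcave u"
  shows "frechet_superdiff UNIV u x \<noteq> {}"
proof -
  obtain r0 C where r0: "r0 > 0" "C \<ge> 0" "semiconvex_on_with C (ball x r0) (\<lambda>y. - u y)"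
    using locally_semiconcave_ball[OF u] by metis
  define r where "r = r0 / 2"
  have r: "r > 0" "cball x r \<subseteq> ball x r0" using r0 by (auto simp: r_def)
  define k where "k y = - u y + C / 2 * (norm (y - x))\<^sup>2 + u x" for y
  have ck: "convex_on (ball x r0) k"
    using convex_on_add[OF semiconvex_imp_convex_on[OF r0(3) convex_ball, of x] convex_on_const[THEN iffD2, OF convex_ball]]
    by (simp add: k_def[abs_def])
  have k0: "k x = 0" by (simp add: k_def)
  have "continuous_on (cball x r) k"
    unfolding k_def by (intro continuous_intros continuous_on_subset[OF locally_semiconcave_continuous[OF u]]) auto
  then obtain M where M: "\<And>y. y \<in> cball x r \<Longrightarrow> k y \<le> M"
  proof -
    assume *: "continuous_on (cball x r) k"
    obtain y where "\<forall>z\<in>cball x r. k z \<le> k y"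
      using continuous_attains_sup[OF compact_cball _ *] r by fastforce
    then show thesis using that by blast
  qed
  have M0: "M \<ge> 0" using M[of x] r k0 by simp
  have lb: "k y \<ge> - (M / r) * norm (y - x)" if "y \<in> cball x r" for y
  proof (cases "y = x")
    case False
    define d where "d = norm (y - x)"
    have d: "0 < d" "d \<le> r" using False that by (auto simp: d_def dist_norm norm_minus_commute)
    \<comment> \<open>The point at distance \<open>r\<close> from \<open>x\<close> opposite to
      \<open>y\<close>: since \<open>x\<close> lies between \<open>y\<close> and \<open>z\<close>,
      convexity and the bound \<open>M\<close> at \<open>z\<close> limit how far \<open>k\<close>
      can drop at \<open>y\<close>.\<close>
    define z where "z = x - (r / d) *\<^sub>R (y - x)"
    have z: "z \<in> cball x r" using d by (simp add: z_def dist_norm flip: d_def)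
    define t where "t = d / (d + r)"
    have t: "0 < t" "t < 1" using d r by (auto simp: t_def)
    have t1: "1 - t = r / (d + r)" using d r by (simp add: t_def field_simps)
    have e: "(1 - t) *\<^sub>R y + t *\<^sub>R z = x"
    proof -
      have "t * (r / d) = 1 - t" unfolding t1 using d r by (simp add: t_def)
      then have "t *\<^sub>R z = t *\<^sub>R x - (1 - t) *\<^sub>R (y - x)" by (simp add: z_def scaleR_diff_right)
      then show ?thesis by (simp add: algebra_simps)
    qed
    have "k ((1 - t) *\<^sub>R y + t *\<^sub>R z) \<le> (1 - t) * k y + t * k z"
      by (rule convex_onD[OF ck]) (use t that z r in auto)
    then have "0 \<le> (1 - t) * k y + t * M"
      using mult_left_mono[OF M[OF z], of t] t unfolding e k0 by linarith
    then have "0 \<le> (d + r) * ((1 - t) * k y + t * M)" using d r by (intro mult_nonneg_nonneg) auto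
    also have "\<dots> = r * k y + d * M" unfolding t1 using d r by (simp add: t_def distrib_left)
    finally show ?thesis using r by (simp add: field_simps d_def)
  qed (simp add: k0)
  have ck': "convex_on (cball x r) k" by (rule convex_on_subset[OF ck r(2) convex_cball])
  obtain l where l: "\<And>y. y \<in> cball x r \<Longrightarrow> k y \<ge> l \<bullet> (y - x)"
    using convex_minorant_exists[OF ck' _ k0, of "M / r"] r M0 lb by (metis centre_in_cball divide_nonneg_pos less_imp_le)
  have "- l \<in> frechet_superdiff UNIV u x"
    unfolding frechet_superdiff_iff
  proof (intro allI impI)
    fix e :: real assume e: "e > 0"
    define \<delta> where "\<delta> = min r (e / (C + 1))"
    have \<delta>: "\<delta> > 0" using r e r0 by (simp add: \<delta>_def)
    show "\<forall>\<^sub>F y in at x. u y - u x - - l \<bullet> (y - x) \<le> e * norm (y - x)"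
      unfolding eventually_at
    proof (intro exI[of _ \<delta>] conjI ballI impI \<delta>)
      fix y assume "y \<noteq> x \<and> dist y x < \<delta>"
      then have y: "y \<in> cball x r" "norm (y - x) \<le> e / (C + 1)" by (auto simp: \<delta>_def dist_norm norm_minus_commute)
      have "C / 2 * norm (y - x) \<le> (C + 1) * (e / (C + 1))" using y r0 by (intro mult_mono) auto
      also have "\<dots> = e" using r0 by (simp add: add_nonneg_eq_0_iff)
      finally have "C / 2 * norm (y - x) * norm (y - x) \<le> e * norm (y - x)" by (intro mult_right_mono) auto
      then show "u y - u x - - l \<bullet> (y - x) \<le> e * norm (y - x)"
        using l[OF y(1)] by (simp add: k_def power2_eq_square)
    qed
  qed
  then show ?thesis by blast
qed

section \<open>The Hamiltonian\<close>

locale mayer_problem =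
  fixes F :: "real^'n \<Rightarrow> (real^'n) set" and \<phi> :: "real^'n \<Rightarrow> real" and T :: real
  assumes T_pos: "T > 0"
    and F_values: "\<And>x. F x \<noteq> {} \<and> convex (F x) \<and> compact (F x)"
    and lipschitz: "locally_hausdorff_lipschitz F"
    and growth: "\<exists>\<rho>>0. \<forall>x. \<forall>v\<in>F x. norm v \<le> \<rho> * (1 + norm x)"
    and H_semiconvex: "\<And>K. K \<noteq> {} \<Longrightarrow> convex K \<Longrightarrow> compact K \<Longrightarrow>
      \<exists>c\<ge>0. \<forall>p. semiconvex_on_with (c * norm p) K (\<lambda>x. hamiltonian F x p)"
    and H_gradient: "\<And>K. K \<noteq> {} \<Longrightarrow> convex K \<Longrightarrow> compact K \<Longrightarrow>
      \<exists>G. (\<forall>x\<in>K. \<forall>p. p \<noteq> 0 \<longrightarrow> GDERIV (hamiltonian F x) p :> G x p) \<and>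
          (\<forall>P. compact P \<and> P \<subseteq> - {0} \<longrightarrow>
            (\<forall>x\<in>K. \<exists>e>0. \<exists>L. \<forall>p\<in>P. lipschitz_on L (K \<inter> ball x e) (\<lambda>y. G y p)))"
    and \<phi>_semiconcave: "locally_semiconcave \<phi>"
    and strongly_convex: "locally_strongly_convex F"
begin

abbreviation H :: "real^'n \<Rightarrow> real^'n \<Rightarrow> real" where "H \<equiv> hamiltonian F"

definition \<rho> :: real where "\<rho> = (SOME \<rho>. \<rho> > 0 \<and> (\<forall>x. \<forall>v\<in>F x. norm v \<le> \<rho> * (1 + norm x)))"

lemma \<rho>: "\<rho> > 0" "v \<in> F x \<Longrightarrow> norm v \<le> \<rho> * (1 + norm x)"
  using someI_ex[of "\<lambda>\<rho>. \<rho> > 0 \<and> (\<forall>x. \<forall>v\<in>F x. norm v \<le> \<rho> * (1 + norm x))"] growth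
  unfolding \<rho>_def by blast+

lemma velocity_le:
  assumes "v \<in> F x" "1 + norm x \<le> r"
  shows "norm v \<le> \<rho> * r"
  by (rule order_trans[OF \<rho>(2)[OF assms(1)] mult_left_mono[OF assms(2) less_imp_le[OF \<rho>(1)]]])

lemma F_ne: "F x \<noteq> {}" and F_convex: "convex (F x)" and F_compact: "compact (F x)"
  using F_values by auto

lemma H_max: "\<exists>v\<in>F x. v \<bullet> p = H x p \<and> (\<forall>w\<in>F x. w \<bullet> p \<le> H x p)"
proof -
  have "continuous_on (F x) (\<lambda>v. v \<bullet> p)" by (intro continuous_intros)
  then obtain v where v: "v \<in> F x" "\<And>w. w \<in> F x \<Longrightarrow> w \<bullet> p \<le> v \<bullet> p"
    using continuous_attains_sup[OF F_compact F_ne, of x "\<lambda>v. v \<bullet> p"] by blast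
  have "H x p = v \<bullet> p"
    unfolding hamiltonian_def by (intro antisym cSUP_least F_ne v(2) cSUP_upper v(1) bdd_aboveI2[where M="v \<bullet> p"])
  with v show ?thesis by auto
qed

lemma H_ge: "v \<in> F x \<Longrightarrow> v \<bullet> p \<le> H x p"
  using H_max by blast

lemma H_0 [simp]: "H x 0 = 0"
  using H_max[of x 0] by auto

lemma H_diff_le_p: "\<bar>H x p - H x p'\<bar> \<le> \<rho> * (1 + norm x) * norm (p - p')"
proof -
  have *: "H x p - H x p' \<le> \<rho> * (1 + norm x) * norm (p - p')" for p p'
  proof -
    obtain v where v: "v \<in> F x" "v \<bullet> p = H x p" using H_max by blast
    have "H x p - H x p' \<le> v \<bullet> (p - p')" using H_ge[OF v(1), of p'] v by (simp add: inner_diff_right)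
    also have "\<dots> \<le> norm v * norm (p - p')" by (rule norm_cauchy_schwarz)
    also have "\<dots> \<le> \<rho> * (1 + norm x) * norm (p - p')" by (intro mult_right_mono \<rho>(2) v norm_ge_zero)
    finally show ?thesis .
  qed
  show ?thesis using *[of p p'] *[of p' p] by (simp add: norm_minus_commute abs_le_iff)
qed

text \<open>Gives one constant on a whole ball, in the pointwise form that Filippov's theorem asks
  for.\<close>

lemma F_lipschitz: "\<exists>L>0. \<forall>y\<in>cball 0 r. \<forall>z\<in>cball 0 r. \<forall>v\<in>F y. \<exists>w\<in>F z. norm (w - v) \<le> L * norm (z - y)"
proof -
  have "\<exists>L>0. \<forall>i\<in>UNIV::unit set. \<forall>y\<in>cball 0 r. \<forall>z\<in>cball 0 r. hausdorff_dist (F y) (F z) \<le> L * dist y z"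
  proof (rule locally_lipschitz_bound_compact)
    show "compact (cball (0::real^'n) r)" by simp
    fix y z :: "real^'n" assume yz: "y \<in> cball 0 r" "z \<in> cball 0 r"
    show "hausdorff_dist (F y) (F z) \<le> 2 * (\<rho> * (1 + r))"
    proof (rule hausdorff_dist_le[OF F_ne F_ne])
      fix a b assume "a \<in> F y" "b \<in> F z"
      then have "norm a \<le> \<rho> * (1 + norm y)" "norm b \<le> \<rho> * (1 + norm z)" by (auto intro: \<rho>)
      moreover have "\<rho> * (1 + norm y) \<le> \<rho> * (1 + r)" "\<rho> * (1 + norm z) \<le> \<rho> * (1 + r)"
        using yz \<rho>(1) by auto
      ultimately show "dist a b \<le> 2 * (\<rho> * (1 + r))"
        using norm_triangle_ineq4[of a b] by (simp add: dist_norm)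
    qed
  next
    fix x :: "real^'n"
    obtain e L where "e > 0" "L \<ge> 0" "\<forall>y\<in>ball x e. \<forall>z\<in>ball x e. hausdorff_dist (F y) (F z) \<le> L * dist y z"
      using lipschitz unfolding locally_hausdorff_lipschitz_def by blast
    then show "\<exists>e>0. \<exists>L. \<forall>i\<in>UNIV::unit set. \<forall>y\<in>cball 0 r \<inter> ball x e. \<forall>z\<in>cball 0 r \<inter> ball x e.
        hausdorff_dist (F y) (F z) \<le> L * dist y z" by blast
  qed
  then obtain L where L: "L > 0" "\<And>y z. y \<in> cball 0 r \<Longrightarrow> z \<in> cball 0 r \<Longrightarrow> hausdorff_dist (F y) (F z) \<le> L * dist y z"
    by blast
  show ?thesis
  proof (intro exI[of _ L] conjI ballI L(1))
    fix y z v :: "real^'n" assume yz: "y \<in> cball 0 r" "z \<in> cball 0 r" and v: "v \<in> F y"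
    obtain w where "w \<in> F z" "dist w v \<le> hausdorff_dist (F y) (F z)"
      using hausdorff_dist_approx[OF F_compact v F_compact F_ne] by blast
    then show "\<exists>w\<in>F z. norm (w - v) \<le> L * norm (z - y)"
      using L(2)[OF yz] by (auto simp: dist_norm norm_minus_commute intro!: bexI[of _ w])
  qed
qed

lemma H_lipschitz: "\<exists>L>0. \<forall>y\<in>cball 0 r. \<forall>z\<in>cball 0 r. \<forall>p. \<bar>H y p - H z p\<bar> \<le> L * norm p * norm (y - z)"
proof -
  obtain L where L: "L > 0" "\<forall>y\<in>cball 0 r. \<forall>z\<in>cball 0 r. \<forall>v\<in>F y. \<exists>w\<in>F z. norm (w - v) \<le> L * norm (z - y)"
    using F_lipschitz by blast
  have *: "H y p - H z p \<le> L * norm p * norm (y - z)" if yz: "y \<in> cball 0 r" "z \<in> cball 0 r" for y z p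
  proof -
    obtain v where v: "v \<in> F y" "v \<bullet> p = H y p" using H_max by blast
    obtain w where w: "w \<in> F z" "norm (w - v) \<le> L * norm (z - y)" using L(2) yz v by blast
    have "H y p - H z p \<le> (v - w) \<bullet> p" using H_ge[OF w(1), of p] v by (simp add: inner_diff_left)
    also have "\<dots> \<le> norm (v - w) * norm p" by (rule norm_cauchy_schwarz)
    also have "\<dots> \<le> L * norm (z - y) * norm p" using w by (intro mult_right_mono) (auto simp: norm_minus_commute)
    finally show ?thesis by (simp add: norm_minus_commute mult_ac)
  qed
  show ?thesis
  proof (intro exI[of _ L] conjI ballI allI L(1))
    fix y z p assume yz: "y \<in> cball (0::real^'n) r" "z \<in> cball (0::real^'n) r"
    show "\<bar>H y p - H z p\<bar> \<le> L * norm p * norm (y - z)"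
      using *[OF yz, of p] *[OF yz(2,1), of p] by (simp add: norm_minus_commute abs_le_iff)
  qed
qed

section \<open>The maximizing velocity\<close>

definition f :: "real^'n \<Rightarrow> real^'n \<Rightarrow> real^'n" where
  "f x p = (SOME v. v \<in> F x \<and> v \<bullet> p = H x p)"

lemma f: "f x p \<in> F x" "f x p \<bullet> p = H x p"
  using someI_ex[of "\<lambda>v. v \<in> F x \<and> v \<bullet> p = H x p"] H_max[of x p] unfolding f_def by blast+

lemma f_max: "v \<in> F x \<Longrightarrow> v \<bullet> p \<le> f x p \<bullet> p"
  using H_ge f by simp

lemma f_max_unit: "v \<in> F x \<Longrightarrow> v \<bullet> (p /\<^sub>R norm p) \<le> f x p \<bullet> (p /\<^sub>R norm p)"
  unfolding inner_scaleR_right by (intro mult_left_mono f_max) auto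

lemma F_R_convex: "\<exists>R>0. \<forall>x\<in>cball 0 r. R_convex R (F x)"
  using strongly_convex compact_cball unfolding locally_strongly_convex_def by blast

lemma f_diff_le_p:
  assumes R: "R_convex R (F x)" and p: "p \<noteq> 0" "p' \<noteq> 0"
  shows "norm (f x p - f x p') \<le> R * norm (p /\<^sub>R norm p - p' /\<^sub>R norm p')"
  by (rule R_convex_maximizers[OF R f(1) _ f_max_unit f(1) _ f_max_unit]) (use p in auto)

text \<open>Two maximizers in the same direction have equal unit normals, so R-convexity puts them
  at distance zero. At \<open>p = 0\<close> every velocity is a maximizer and \<open>f x p\<close>
  is an arbitrary choice.\<close>

lemma f_unique:
  assumes p: "p \<noteq> 0" and v: "v \<in> F x" "v \<bullet> p = H x p"
  shows "v = f x p"
proof -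
  have "x \<in> cball 0 (norm x)" by simp
  then obtain R where R: "R_convex R (F x)" using F_R_convex[of "norm x"] by blast
  have m: "w \<bullet> (p /\<^sub>R norm p) \<le> v \<bullet> (p /\<^sub>R norm p)" if "w \<in> F x" for w
    using f_max_unit[OF that, of p] f(2)[of x p] v by simp
  have "norm (v - f x p) \<le> R * norm (p /\<^sub>R norm p - p /\<^sub>R norm p)"
    by (rule R_convex_maximizers[OF R v(1) _ m f(1) _ f_max_unit]) (use p in auto)
  then show ?thesis by simp
qed

lemma H_scale: "0 \<le> a \<Longrightarrow> H x (a *\<^sub>R p) = a * H x p"
proof -
  assume a: "0 \<le> a"
  obtain v where v: "v \<in> F x" "v \<bullet> (a *\<^sub>R p) = H x (a *\<^sub>R p)" using H_max by blast
  have "H x (a *\<^sub>R p) \<le> a * H x p" using v H_ge[OF v(1), of p] a by (metis inner_scaleR_right mult_left_mono)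
  moreover have "a * H x p \<le> H x (a *\<^sub>R p)" using H_ge[OF f(1), of x p "a *\<^sub>R p"] f(2)[of x p] by simp
  ultimately show ?thesis by simp
qed

lemma f_scale: "p \<noteq> 0 \<Longrightarrow> a > 0 \<Longrightarrow> f x (a *\<^sub>R p) = f x p"
  by (rule f_unique[symmetric]) (auto simp: f H_scale)

text \<open>An envelope argument: \<open>\<lambda>q. H x q - f x p \<bullet> q\<close> is minimal at
  \<open>q = p\<close>, so its derivative vanishes there. The assumed regularity of the gradient
  thereby becomes regularity of \<open>f\<close>.\<close>

lemma GDERIV_H_imp_f:
  assumes p: "p \<noteq> 0" and g: "GDERIV (H x) p :> g"
  shows "g = f x p"
proof -
  have d: "((\<lambda>q. H x q - f x p \<bullet> q) has_derivative (\<lambda>h. h \<bullet> g - f x p \<bullet> h)) (at p)"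
    using g unfolding gderiv_def by (intro derivative_intros)
  have "(\<lambda>h. h \<bullet> g - f x p \<bullet> h) = (\<lambda>h. 0)"
  proof (rule has_derivative_local_min[OF d])
    show "\<forall>\<^sub>F q in at p. H x p - f x p \<bullet> p \<le> H x q - f x p \<bullet> q"
      using H_ge[OF f(1)[of x p]] f(2)[of x p] by auto
  qed
  then have "(g - f x p) \<bullet> g - f x p \<bullet> (g - f x p) = 0" by (rule fun_cong)
  then have "(g - f x p) \<bullet> (g - f x p) = 0"
    by (simp add: inner_diff_left inner_diff_right inner_commute)
  then show ?thesis by simp
qed

lemma GDERIV_H: "p \<noteq> 0 \<Longrightarrow> GDERIV (H x) p :> f x p"
proof -
  assume p: "p \<noteq> 0"
  obtain G where "\<forall>x'\<in>{x}. \<forall>p. p \<noteq> 0 \<longrightarrow> GDERIV (H x') p :> G x' p"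
    using H_gradient[OF insert_not_empty convex_singleton compact_sing[of x]] by blast
  then have "GDERIV (H x) p :> G x p" using p by blast
  with GDERIV_H_imp_f[OF p this] show ?thesis by simp
qed

text \<open>\<open>f\<close> is homogeneous of degree zero in \<open>p\<close>, so the gradient
  hypothesis on the unit sphere, a compact set avoiding the origin, yields a constant valid for all
  nonzero \<open>p\<close>.\<close>

lemma f_lipschitz_x: "\<exists>L>0. \<forall>x\<in>cball 0 r. \<forall>y\<in>cball 0 r. \<forall>p. p \<noteq> 0 \<longrightarrow> norm (f x p - f y p) \<le> L * norm (x - y)"
proof (cases "r \<ge> 0")
  case False then show ?thesis by (intro exI[of _ 1]) auto
next
  case True
  let ?K = "cball (0::real^'n) r" and ?S = "sphere (0::real^'n) 1"
  have "compact ?S \<and> ?S \<subseteq> - {0}" by auto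
  moreover obtain G where G: "\<And>x p. x \<in> ?K \<Longrightarrow> p \<noteq> 0 \<Longrightarrow> GDERIV (H x) p :> G x p"
    "\<And>P. compact P \<and> P \<subseteq> - {0} \<Longrightarrow> \<forall>x\<in>?K. \<exists>e>0. \<exists>L. \<forall>p\<in>P. lipschitz_on L (?K \<inter> ball x e) (\<lambda>y. G y p)"
  proof -
    have "?K \<noteq> {}" using True by simp
    then show thesis using H_gradient[OF _ convex_cball compact_cball, of 0 r] that by blast
  qed
  ultimately have loc: "\<forall>x\<in>?K. \<exists>e>0. \<exists>L. \<forall>p\<in>?S. lipschitz_on L (?K \<inter> ball x e) (\<lambda>y. G y p)" by blast
  have Gf: "G x p = f x p" if "x \<in> ?K" "p \<noteq> 0" for x p
    using G(1)[OF that] GDERIV_H_imp_f that by blast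
  have "\<exists>L>0. \<forall>p\<in>?S. \<forall>y\<in>?K. \<forall>z\<in>?K. dist (f y p) (f z p) \<le> L * dist y z"
  proof (rule locally_lipschitz_bound_compact)
    fix p y z assume "p \<in> ?S" "y \<in> ?K" "z \<in> ?K"
    then have "\<rho> * (1 + norm y) \<le> \<rho> * (1 + r)" "\<rho> * (1 + norm z) \<le> \<rho> * (1 + r)"
      using \<rho>(1) by auto
    moreover have "norm (f y p) \<le> \<rho> * (1 + norm y)" "norm (f z p) \<le> \<rho> * (1 + norm z)"
      by (rule \<rho>(2)[OF f(1)])+
    ultimately show "dist (f y p) (f z p) \<le> 2 * (\<rho> * (1 + r))"
      using norm_triangle_ineq4[of "f y p" "f z p"] by (simp add: dist_norm)
  next
    fix x assume "x \<in> ?K"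
    with loc obtain e L where e: "e > 0" "\<forall>p\<in>?S. lipschitz_on L (?K \<inter> ball x e) (\<lambda>y. G y p)" by blast
    have "dist (f y p) (f z p) \<le> L * dist y z" if "p \<in> ?S" "y \<in> ?K \<inter> ball x e" "z \<in> ?K \<inter> ball x e" for p y z
    proof -
      have "p \<noteq> 0" using that by auto
      then show ?thesis using lipschitz_onD[of L "?K \<inter> ball x e" "\<lambda>y. G y p" y z] e that Gf by auto
    qed
    then show "\<exists>e>0. \<exists>L. \<forall>p\<in>?S. \<forall>y\<in>?K \<inter> ball x e. \<forall>z\<in>?K \<inter> ball x e. dist (f y p) (f z p) \<le> L * dist y z"
      using e(1) by blast
  qed simp
  then obtain L where L: "L > 0" "\<And>p y z. p \<in> ?S \<Longrightarrow> y \<in> ?K \<Longrightarrow> z \<in> ?K \<Longrightarrow> dist (f y p) (f z p) \<le> L * dist y z"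
    by blast
  have "norm (f x p - f y p) \<le> L * norm (x - y)" if "x \<in> ?K" "y \<in> ?K" "p \<noteq> 0" for x y p
  proof -
    have "f z (p /\<^sub>R norm p) = f z p" for z using that by (intro f_scale) auto
    then show ?thesis using L(2)[of "p /\<^sub>R norm p" x y] that by (simp add: dist_norm)
  qed
  with L(1) show ?thesis by blast
qed

text \<open>The gap scales linearly in \<open>p\<close> while \<open>f\<close> depends on the
  direction only; hence the factor \<open>norm p\<close> in front of the estimate for unit
  normals.\<close>

lemma H_gap:
  assumes R: "R_convex R (F x)" "R > 0" and p: "p \<noteq> 0" and v: "v \<in> F x"
  shows "norm p * (norm (v - f x p))\<^sup>2 / (4 * R) \<le> H x p - v \<bullet> p"
proof -
  have "(norm (v - f x p))\<^sup>2 / (4 * R) \<le> (f x p - v) \<bullet> (p /\<^sub>R norm p)"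
    by (rule R_convex_gap[OF R f(1) _ f_max_unit v]) (use p in auto)
  then have "norm p * ((norm (v - f x p))\<^sup>2 / (4 * R)) \<le> norm p * ((f x p - v) \<bullet> (p /\<^sub>R norm p))"
    by (intro mult_left_mono) auto
  also have "\<dots> = H x p - v \<bullet> p" using p f(2)[of x p] by (simp add: inner_diff_left)
  finally show ?thesis by simp
qed

text \<open>Away from the origin this is the mean value theorem for \<open>\<lambda>p. H y p - H x p\<close>. If the
  segment from \<open>p\<close> to \<open>p'\<close> meets the origin, then \<open>norm (p - p') = norm p + norm p'\<close> and the
  Lipschitz continuity of \<open>H\<close> in the state suffices.\<close>

lemma H_mixed_difference:
  "\<exists>L>0. \<forall>x\<in>cball 0 r. \<forall>y\<in>cball 0 r. \<forall>p p'.
    \<bar>(H y p - H x p) - (H y p' - H x p')\<bar> \<le> L * norm (p - p') * norm (y - x)"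
proof -
  obtain L1 where L1: "L1 > 0" "\<And>y z p. y \<in> cball 0 r \<Longrightarrow> z \<in> cball 0 r \<Longrightarrow> \<bar>H y p - H z p\<bar> \<le> L1 * norm p * norm (y - z)"
    using H_lipschitz[of r] by blast
  obtain L2 where L2: "L2 > 0" "\<And>x y p. x \<in> cball 0 r \<Longrightarrow> y \<in> cball 0 r \<Longrightarrow> p \<noteq> 0 \<Longrightarrow> norm (f x p - f y p) \<le> L2 * norm (x - y)"
    using f_lipschitz_x[of r] by blast
  define L where "L = max L1 L2"
  show ?thesis
  proof (intro exI[of _ L] conjI ballI allI)
    show "L > 0" using L1 by (simp add: L_def)
    fix x y p p' :: "real^'n" assume xy: "x \<in> cball 0 r" "y \<in> cball 0 r"
    show "\<bar>(H y p - H x p) - (H y p' - H x p')\<bar> \<le> L * norm (p - p') * norm (y - x)"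
    proof (cases "0 \<in> closed_segment p p'")
      case True
      then have "dist p p' = norm p + norm p'"
        unfolding between_mem_segment[symmetric] between by simp
      then have n: "norm (p - p') = norm p + norm p'" by (simp add: dist_norm)
      have "\<bar>(H y p - H x p) - (H y p' - H x p')\<bar> \<le> L1 * norm p * norm (y - x) + L1 * norm p' * norm (y - x)"
        using L1(2)[OF xy(2,1), of p] L1(2)[OF xy(2,1), of p'] by linarith
      also have "\<dots> = L1 * (norm (p - p') * norm (y - x))" unfolding n by (simp add: algebra_simps)
      also have "\<dots> \<le> L * (norm (p - p') * norm (y - x))" by (intro mult_right_mono) (auto simp: L_def)
      finally show ?thesis by (simp add: mult.assoc)
    next
      case False
      have d: "((\<lambda>q. H y q - H x q) has_derivative (\<lambda>h. h \<bullet> f y q - h \<bullet> f x q)) (at q within closed_segment p p')"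
        if "q \<in> closed_segment p p'" for q
      proof -
        have "q \<noteq> 0" using that False by auto
        then show ?thesis using GDERIV_H[of q y] GDERIV_H[of q x] unfolding gderiv_def
          by (intro has_derivative_diff) (auto intro: has_derivative_at_withinI)
      qed
      have "norm ((H y p - H x p) - (H y p' - H x p')) \<le> L2 * norm (y - x) * norm (p - p')"
      proof (rule differentiable_bound[OF convex_closed_segment[of p p'] d])
        fix q assume q: "q \<in> closed_segment p p'"
        then have "q \<noteq> 0" using False by auto
        have "norm (h \<bullet> f y q - h \<bullet> f x q) \<le> L2 * norm (y - x) * norm h" for h
        proof -
          have "norm (h \<bullet> f y q - h \<bullet> f x q) = \<bar>h \<bullet> (f y q - f x q)\<bar>" by (simp add: inner_diff_right)
          also have "\<dots> \<le> norm h * norm (f y q - f x q)" by (rule Cauchy_Schwarz_ineq2)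
          also have "\<dots> \<le> norm h * (L2 * norm (y - x))" using L2(2)[OF xy(2,1) \<open>q \<noteq> 0\<close>] by (intro mult_left_mono) auto
          finally show ?thesis by (simp add: mult_ac)
        qed
        then show "onorm (\<lambda>h. h \<bullet> f y q - h \<bullet> f x q) \<le> L2 * norm (y - x)" by (rule onorm_le)
      qed auto
      then have "\<bar>(H y p - H x p) - (H y p' - H x p')\<bar> \<le> L2 * (norm (p - p') * norm (y - x))" by (simp add: mult_ac)
      also have "\<dots> \<le> L * (norm (p - p') * norm (y - x))" by (intro mult_right_mono) (auto simp: L_def)
      finally show ?thesis by (simp add: mult.assoc)
    qed
  qed
qed

end

section \<open>Trajectories\<close>

context mayer_problem
begin

text \<open>The Gronwall constant: an arc starting in the ball of radius \<open>B\<close> with speed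
  at most \<open>\<rho>\<close> times \<open>1 + norm (x t)\<close> keeps
  \<open>1 + norm (x t)\<close> below this value up to time \<open>T\<close>.\<close>

definition radius :: "real \<Rightarrow> real" where "radius B = (1 + B) * exp (\<rho> * T)"

lemma radius_ge:
  assumes "0 \<le> B"
  shows "B \<le> radius B"
proof -
  have "(1 + B) * 1 \<le> (1 + B) * exp (\<rho> * T)" using assms \<rho>(1) T_pos by (intro mult_left_mono) auto
  then show ?thesis by (simp add: radius_def)
qed

lemma arc_bound:
  assumes st: "s \<le> b" and g: "g integrable_on {s..b}"
    and x: "\<And>t. t \<in> {s..b} \<Longrightarrow> x t = y + integral {s..t} g"
    and le: "\<And>t. t \<in> {s..b} \<Longrightarrow> norm (g t) \<le> \<rho> * (1 + norm (x t :: real^'n))"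
    and t: "t \<in> {s..b}"
  shows "1 + norm (x t) \<le> (1 + norm y) * exp (\<rho> * (t - s))"
proof (rule gronwall[OF _ less_imp_le[OF \<rho>(1)] _ t])
  have "continuous_on {s..b} (\<lambda>t. y + integral {s..t} g)"
    by (intro continuous_intros indefinite_integral_continuous_1 g)
  then have xc: "continuous_on {s..b} x" by (rule continuous_on_eq) (simp add: x)
  then show "continuous_on {s..b} (\<lambda>t. 1 + norm (x t))" by (intro continuous_intros)
  fix u assume u: "u \<in> {s..b}"
  have gu: "g integrable_on {s..u}" by (rule integrable_on_subinterval[OF g]) (use u in auto)
  have "continuous_on {s..u} (\<lambda>t. 1 + norm (x t))"
    using u by (intro continuous_intros continuous_on_subset[OF xc]) auto
  then have iu: "(\<lambda>t. 1 + norm (x t)) integrable_on {s..u}" by (rule integrable_continuous_real)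
  have "norm (integral {s..u} g) \<le> integral {s..u} (\<lambda>t. \<rho> * (1 + norm (x t)))"
    using le u by (intro Henstock_Kurzweil_Integration.integral_norm_bound_integral gu integrable_on_mult_right iu) auto
  then have "norm (integral {s..u} g) \<le> \<rho> * integral {s..u} (\<lambda>t. 1 + norm (x t))" by simp
  then show "1 + norm (x u) \<le> 1 + norm y + \<rho> * integral {s..u} (\<lambda>t. 1 + norm (x t))"
    using x[OF u] norm_triangle_ineq[of y "integral {s..u} g"] by simp
qed

lemma arc_in_radius:
  assumes "0 \<le> s" "s \<le> T" "g integrable_on {s..T}"
    "\<And>t. t \<in> {s..T} \<Longrightarrow> x t = y + integral {s..t} g"
    "\<And>t. t \<in> {s..T} \<Longrightarrow> norm (g t) \<le> \<rho> * (1 + norm (x t :: real^'n))"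
    and t: "t \<in> {s..T}" and B: "norm y \<le> B"
  shows "1 + norm (x t) \<le> radius B"
proof -
  have "1 + norm (x t) \<le> (1 + norm y) * exp (\<rho> * (t - s))" by (rule arc_bound[OF assms(2-6)])
  also have "\<dots> \<le> radius B"
    unfolding radius_def
  proof (intro mult_mono)
    show "0 \<le> 1 + B" using B norm_ge_zero[of y] by linarith
  qed (use B assms(1,2) t \<rho>(1) in auto)
  finally show ?thesis .
qed

text \<open>The velocity is redefined on the exceptional set by an arbitrary choice from
  \<open>F (x t)\<close>, so membership, and with it every pointwise bound, holds at all
  times.\<close>

lemma trajectory_velocity:
  assumes tr: "trajectory F b s y x" and st: "s \<le> b"
  obtains g E where "negligible E" "g integrable_on {s..b}" "g \<in> borel_measurable (lebesgue_on {s..b})"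
    "\<And>t. t \<in> {s..b} \<Longrightarrow> g t \<in> F (x t)" "\<And>t. t \<in> {s..b} \<Longrightarrow> x t = y + integral {s..t} g"
    "\<And>t. t \<in> {s..b} - E \<Longrightarrow> (x has_vector_derivative g t) (at t within {s..b})"
proof -
  define E where "E = {t\<in>{s..b}. \<not> (\<exists>v\<in>F (x t). (x has_vector_derivative v) (at t within {s..b}))}"
  have E: "negligible E" using tr unfolding trajectory_def AE_on_lebesgue_iff E_def by blast
  have ac: "abs_continuous_on {s..b} x" "x s = y" using tr by (auto simp: trajectory_def)
  define g where "g t = (if t \<in> {s..b} - E then SOME v. v \<in> F (x t) \<and> (x has_vector_derivative v) (at t within {s..b})
    else SOME v. v \<in> F (x t))" for t
  have gE: "g t \<in> F (x t) \<and> (x has_vector_derivative g t) (at t within {s..b})" if "t \<in> {s..b} - E" for t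
    using someI_ex[of "\<lambda>v. v \<in> F (x t) \<and> (x has_vector_derivative v) (at t within {s..b})"] that
    by (auto simp: g_def E_def)
  have gF: "g t \<in> F (x t)" for t
  proof (cases "t \<in> {s..b} - E")
    case True then show ?thesis using gE by blast
  next
    case False
    then have "g t = (SOME v. v \<in> F (x t))" unfolding g_def by (rule if_not_P)
    then show ?thesis using F_ne[of "x t"] some_in_eq[of "F (x t)"] by simp
  qed
  have gi: "(g has_integral (x t - x s)) {s..t}" if "t \<in> {s..b}" for t
    by (rule abs_continuous_has_integral_subinterval[OF _ _ _ ac(1) E]) (use that gE in auto)
  have "g integrable_on {s..b}" using gi[of b] st by auto
  then show thesis
    using that[OF E _ _ gF, of ] gE gi integral_unique[OF gi] ac(2) integrable_imp_measurable[of g "{s..b}"]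
    by auto
qed

lemma trajectoryI:
  assumes st: "s \<le> b" and g: "g integrable_on {s..b}" "\<And>t. t \<in> {s..b} \<Longrightarrow> norm (g t) \<le> M"
    and F: "\<And>t. t \<in> {s..b} \<Longrightarrow> g t \<in> F (x t)"
    and x: "\<And>t. t \<in> {s..b} \<Longrightarrow> x t = y + integral {s..t} g"
  shows "trajectory F b s y x"
  unfolding trajectory_def
proof (intro conjI)
  have M: "M \<ge> 0" using g(2)[of s] st norm_ge_zero[of "g s"] by (meson atLeastAtMost_iff order_refl order_trans)
  show "abs_continuous_on {s..b} x"
    by (rule lipschitz_on_imp_abs_continuous_on[OF indefinite_integral_lipschitz_on[OF g M x]])
  show "x s = y" using x[of s] st by simp
  show "AE t\<in>{s..b} in lebesgue. \<exists>v\<in>F (x t). (x has_vector_derivative v) (at t within {s..b})"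
    using indefinite_integral_has_vector_derivative_AE[OF g(1)]
  proof eventually_elim
    case (elim t)
    show ?case
    proof
      assume t: "t \<in> {s..b}"
      then have "((\<lambda>t. y + integral {s..t} g) has_vector_derivative g t) (at t within {s..b})"
        using elim by (auto intro!: derivative_eq_intros)
      then have "(x has_vector_derivative g t) (at t within {s..b})"
        by (rule has_vector_derivative_transform[OF t, rotated]) (use x in auto)
      then show "\<exists>v\<in>F (x t). (x has_vector_derivative v) (at t within {s..b})" using F[OF t] by blast
    qed
  qed
qed

lemma trajectory_bound:
  assumes tr: "trajectory F T s y x" and s: "0 \<le> s" "s \<le> T" and B: "norm y \<le> B" and t: "t \<in> {s..T}"
  shows "1 + norm (x t) \<le> radius B"
proof -
  obtain g E where g: "g integrable_on {s..T}" "\<And>t. t \<in> {s..T} \<Longrightarrow> g t \<in> F (x t)"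
    "\<And>t. t \<in> {s..T} \<Longrightarrow> x t = y + integral {s..t} g"
    by (rule trajectory_velocity[OF tr s(2)]) blast
  show ?thesis by (rule arc_in_radius[OF s g(1,3) \<rho>(2)[OF g(2)] t B])
qed

lemma trajectory_lipschitz_on:
  assumes tr: "trajectory F T s y x" and s: "0 \<le> s" "s \<le> T" and B: "norm y \<le> B"
  shows "(\<rho> * radius B)-lipschitz_on {s..T} x"
proof -
  obtain g E where g: "g integrable_on {s..T}" "\<And>t. t \<in> {s..T} \<Longrightarrow> g t \<in> F (x t)"
    "\<And>t. t \<in> {s..T} \<Longrightarrow> x t = y + integral {s..t} g"
    by (rule trajectory_velocity[OF tr s(2)]) blast
  have "norm (g t) \<le> \<rho> * radius B" if "t \<in> {s..T}" for t
    by (rule velocity_le[OF g(2)[OF that] trajectory_bound[OF tr s B that]])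
  moreover have "0 \<le> \<rho> * radius B"
  proof -
    have "0 \<le> 1 + B" using B norm_ge_zero[of y] by linarith
    then show ?thesis using \<rho>(1) unfolding radius_def by (intro mult_nonneg_nonneg) auto
  qed
  ultimately show ?thesis using indefinite_integral_lipschitz_on[OF g(1) _ _ g(3)] by blast
qed

text \<open>Filippov's theorem for a submultifunction \<open>S t y\<close> of \<open>F y\<close> that is Lipschitz only on a large ball:
  \<open>y\<close> is replaced by its projection onto that ball, which the resulting arc never leaves.\<close>

lemma filippov_trajectory:
  fixes S :: "real \<Rightarrow> real^'n \<Rightarrow> (real^'n) set" and x v0 :: "real \<Rightarrow> real^'n"
  assumes s: "0 \<le> s" "s \<le> T" and r: "r \<ge> radius (norm y0)" "r \<ge> 0"
    and sub: "\<And>t y. t \<in> {s..T} \<Longrightarrow> y \<in> cball 0 r \<Longrightarrow> S t y \<subseteq> F y"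
    and ne: "\<And>t y. t \<in> {s..T} \<Longrightarrow> y \<in> cball 0 r \<Longrightarrow> S t y \<noteq> {}"
    and cv: "\<And>t y. t \<in> {s..T} \<Longrightarrow> y \<in> cball 0 r \<Longrightarrow> convex (S t y)"
    and graph: "closed {(t,y,w). t \<in> {s..T} \<and> y \<in> cball 0 r \<and> w \<in> S t y}"
    and L: "L > 0"
    and lip: "\<And>t y y' w. t \<in> {s..T} \<Longrightarrow> y \<in> cball 0 r \<Longrightarrow> y' \<in> cball 0 r \<Longrightarrow> w \<in> S t y \<Longrightarrow>
      \<exists>w'\<in>S t y'. norm (w' - w) \<le> L * norm (y' - y)"
    and v0: "v0 \<in> borel_measurable (lebesgue_on {s..T})" "\<And>t. t \<in> {s..T} \<Longrightarrow> norm (v0 t) \<le> M0"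
    and x: "\<And>t. t \<in> {s..T} \<Longrightarrow> x t = x s + integral {s..t} v0" "\<And>t. t \<in> {s..T} \<Longrightarrow> x t \<in> cball 0 r"
    and \<gamma>: "\<gamma> integrable_on {s..T}"
    and defect: "\<And>t. t \<in> {s..T} \<Longrightarrow> \<exists>w\<in>S t (x t). norm (w - v0 t) \<le> \<gamma> t"
  obtains y v where "trajectory F T s y0 y" "v integrable_on {s..T}"
    "\<And>t. t \<in> {s..T} \<Longrightarrow> v t \<in> S t (y t)" "\<And>t. t \<in> {s..T} \<Longrightarrow> y t = y0 + integral {s..t} v"
    "\<And>t. t \<in> {s..T} \<Longrightarrow> y t \<in> cball 0 r"
    "\<And>t. t \<in> {s..T} \<Longrightarrow> norm (y t - x t) \<le> 3 * exp (2 * L * T) * (integral {s..T} \<gamma> + norm (y0 - x s))"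
proof -
  define pr where "pr = closest_point (cball (0::real^'n) r)"
  have pr: "pr y \<in> cball 0 r" for y
    unfolding pr_def by (rule closest_point_in_set) (use r in auto)
  have prid: "pr y = y" if "y \<in> cball 0 r" for y
    unfolding pr_def by (rule closest_point_self[OF that])
  have prlip: "norm (pr y - pr z) \<le> norm (y - z)" for y z
    using closest_point_lipschitz[OF convex_cball closed_cball, of 0 r y z] r by (simp add: pr_def dist_norm)
  have prle: "norm (pr y) \<le> norm y" for y
    using prlip[of y 0] prid[of 0] r by simp
  have prc: "continuous_on UNIV pr"
    unfolding pr_def by (rule continuous_on_closest_point) (use r in auto)
  obtain y v B where y: "v integrable_on {s..T}" "\<And>t. t \<in> {s..T} \<Longrightarrow> norm (v t) \<le> B"
    "\<And>t. t \<in> {s..T} \<Longrightarrow> v t \<in> S t (pr (y t))"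
    "\<And>t. t \<in> {s..T} \<Longrightarrow> y t = y0 + integral {s..t} v"
    "\<And>t. t \<in> {s..T} \<Longrightarrow> norm (y t - x t) \<le> 3 * exp (2 * L * (T - s)) * (integral {s..T} \<gamma> + norm (y0 - x s))"
  proof (rule filippov[of s T "\<lambda>t y. S t (pr y)" \<rho> L v0 M0 x \<gamma> y0])
    have "closed ((\<lambda>(t,y,w). (t,pr y,w)) -` {(t,y,w). t \<in> {s..T} \<and> y \<in> cball 0 r \<and> w \<in> S t y})"
      unfolding case_prod_unfold
      by (intro closed_vimage graph[unfolded case_prod_unfold] continuous_intros continuous_on_compose2[OF prc]) auto
    also have "(\<lambda>(t,y,w). (t,pr y,w)) -` {(t,y,w). t \<in> {s..T} \<and> y \<in> cball 0 r \<and> w \<in> S t y} =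
        {(t,y,w). t \<in> {s..T} \<and> w \<in> S t (pr y)}" using pr by auto
    finally show "closed {(t,y,w). t \<in> {s..T} \<and> w \<in> S t (pr y)}" .
    show "norm w \<le> \<rho> * (1 + norm y)" if "t \<in> {s..T}" "w \<in> S t (pr y)" for t y w
    proof -
      have "norm w \<le> \<rho> * (1 + norm (pr y))" using sub[OF that(1) pr] that(2) by (intro \<rho>(2)) auto
      also have "\<dots> \<le> \<rho> * (1 + norm y)" using prle \<rho>(1) by (intro mult_left_mono) auto
      finally show ?thesis .
    qed
    show "\<exists>w'\<in>S t (pr y'). norm (w' - w) \<le> L * norm (y' - y)" if h: "t \<in> {s..T}" "w \<in> S t (pr y)" for t y y' w
    proof -
      obtain w' where w': "w' \<in> S t (pr y')" "norm (w' - w) \<le> L * norm (pr y' - pr y)"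
        using lip[OF h(1) pr pr h(2)] by blast
      have "L * norm (pr y' - pr y) \<le> L * norm (y' - y)" using prlip L by (intro mult_left_mono) auto
      with w' show ?thesis by (meson order_trans)
    qed
    show "\<exists>w\<in>S t (pr (x t)). norm (w - v0 t) \<le> \<gamma> t" if "t \<in> {s..T}" for t
      using defect[OF that] prid[OF x(2)[OF that]] by simp
  qed (use s ne cv pr L v0 x(1) \<gamma> in blast)+
  have vF: "v t \<in> F (pr (y t))" if "t \<in> {s..T}" for t using y(3)[OF that] sub[OF that pr] by blast
  \<comment> \<open>Projection does not increase norms, so the truncated problem obeys the original
    growth bound. The arc thus stays in the ball, where the projection is the identity and the
    truncation disappears.\<close>
  have yr: "y t \<in> cball 0 r" if t: "t \<in> {s..T}" for t
  proof -
    have "1 + norm (y t) \<le> radius (norm y0)"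
    proof (rule arc_in_radius[OF s y(1,4) _ t order_refl])
      show "norm (v u) \<le> \<rho> * (1 + norm (y u))" if "u \<in> {s..T}" for u
      proof -
        have "norm (v u) \<le> \<rho> * (1 + norm (pr (y u)))" by (rule \<rho>(2)[OF vF[OF that]])
        also have "\<dots> \<le> \<rho> * (1 + norm (y u))" using prle \<rho>(1) by (intro mult_left_mono) auto
        finally show ?thesis .
      qed
    qed
    then show ?thesis using r by simp
  qed
  have vS: "v t \<in> S t (y t)" if "t \<in> {s..T}" for t using y(3)[OF that] prid[OF yr[OF that]] by simp
  have nn: "0 \<le> integral {s..T} \<gamma> + norm (y0 - x s)"
  proof -
    have "0 \<le> \<gamma> t" if "t \<in> {s..T}" for t using defect[OF that] norm_ge_zero order_trans by blast
    then show ?thesis using \<gamma> by (intro add_nonneg_nonneg Henstock_Kurzweil_Integration.integral_nonneg) auto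
  qed
  show thesis
  proof (rule that[of y v])
    show "trajectory F T s y0 y"
      by (rule trajectoryI[OF s(2) y(1,2) _ y(4)]) (use vS sub yr in blast)+
    show "norm (y t - x t) \<le> 3 * exp (2 * L * T) * (integral {s..T} \<gamma> + norm (y0 - x s))" if "t \<in> {s..T}" for t
    proof -
      have "3 * exp (2 * L * (T - s)) * (integral {s..T} \<gamma> + norm (y0 - x s)) \<le>
          3 * exp (2 * L * T) * (integral {s..T} \<gamma> + norm (y0 - x s))"
        using nn L s by (intro mult_right_mono mult_left_mono) auto
      then show ?thesis using y(5)[OF that] by linarith
    qed
  qed (use y(1,4) vS yr in blast)+
qed

section \<open>Existence, restriction and concatenation of trajectories\<close>

lemma F_graph_closed: "closed {(t,y,w). t \<in> {a..b::real} \<and> y \<in> cball 0 r \<and> w \<in> F y}"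
proof (intro closed_sequential_limits[THEN iffD2] allI impI)
  fix X :: "nat \<Rightarrow> real \<times> (real^'n) \<times> (real^'n)" and l
  assume A: "(\<forall>n. X n \<in> {(t,y,w). t \<in> {a..b} \<and> y \<in> cball 0 r \<and> w \<in> F y}) \<and> X \<longlonglongrightarrow> l"
  define tt yy ww where "tt n = fst (X n)" and "yy n = fst (snd (X n))" and "ww n = snd (snd (X n))" for n
  obtain t y w where l: "l = (t,y,w)" by (cases l)
  have X: "tt n \<in> {a..b}" "yy n \<in> cball 0 r" "ww n \<in> F (yy n)" for n
    using A by (auto simp: tt_def yy_def ww_def case_prod_unfold)
  have lim: "tt \<longlonglongrightarrow> t" "yy \<longlonglongrightarrow> y" "ww \<longlonglongrightarrow> w"
    using tendsto_fst[of X l] tendsto_snd[of X l] tendsto_fst[of "\<lambda>n. snd (X n)" "snd l"] tendsto_snd[of "\<lambda>n. snd (X n)" "snd l"] A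
    by (auto simp: l tt_def[abs_def] yy_def[abs_def] ww_def[abs_def])
  have t: "t \<in> {a..b}" by (rule closed_sequentially[OF _ X(1) lim(1)]) auto
  have y: "y \<in> cball 0 r" by (rule closed_sequentially[OF _ X(2) lim(2)]) auto
  obtain L where L: "L > 0" "\<And>y z v. y \<in> cball 0 r \<Longrightarrow> z \<in> cball 0 r \<Longrightarrow> v \<in> F y \<Longrightarrow> \<exists>w\<in>F z. norm (w - v) \<le> L * norm (z - y)"
    using F_lipschitz[of r] by blast
  have "\<forall>n. \<exists>w'. w' \<in> F y \<and> norm (w' - ww n) \<le> L * norm (y - yy n)"
    using L(2)[OF X(2) y X(3)] by blast
  then obtain ww' where ww': "\<And>n. ww' n \<in> F y" "\<And>n. norm (ww' n - ww n) \<le> L * norm (y - yy n)" by metis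
  have "(\<lambda>n. L * norm (y - yy n)) \<longlonglongrightarrow> L * norm (y - y)" by (intro tendsto_intros lim)
  then have "(\<lambda>n. L * norm (y - yy n)) \<longlonglongrightarrow> 0" by simp
  then have "(\<lambda>n. ww' n - ww n) \<longlonglongrightarrow> 0"
    by (rule Lim_null_comparison[rotated]) (simp add: ww'(2))
  then have "(\<lambda>n. (ww' n - ww n) + ww n) \<longlonglongrightarrow> 0 + w" by (intro tendsto_add lim)
  then have "ww' \<longlonglongrightarrow> w" by simp
  then have "w \<in> F y" by (rule closed_sequentially[OF compact_imp_closed[OF F_compact] ww'(1)])
  with t y l show "l \<in> {(t,y,w). t \<in> {a..b} \<and> y \<in> cball 0 r \<and> w \<in> F y}" by simp
qed

text \<open>Filippov's theorem with the velocity of \<open>x\<close> as first guess and zero defect.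
  The constant depends on \<open>B\<close> only, so it serves all initial times at once.\<close>

lemma trajectory_exists_near:
  "\<exists>C>0. \<forall>s (y0::real^'n) x. 0 \<le> s \<and> s \<le> T \<and> norm (x s) \<le> B \<and> norm y0 \<le> B \<and> trajectory F T s (x s) x \<longrightarrow>
    (\<exists>y. trajectory F T s y0 y \<and> (\<forall>t\<in>{s..T}. norm (y t - x t) \<le> C * norm (y0 - x s)))"
proof -
  define r where "r = radius B"
  obtain L where L: "L > 0" "\<And>y z v. y \<in> cball 0 r \<Longrightarrow> z \<in> cball 0 r \<Longrightarrow> v \<in> F y \<Longrightarrow> \<exists>w\<in>F z. norm (w - v) \<le> L * norm (z - y)"
    using F_lipschitz[of r] by blast
  show ?thesis
  proof (intro exI[of _ "3 * exp (2 * L * T)"] conjI allI impI)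
    fix s and y0 :: "real^'n" and x :: "real \<Rightarrow> real^'n"
    assume A: "0 \<le> s \<and> s \<le> T \<and> norm (x s) \<le> B \<and> norm y0 \<le> B \<and> trajectory F T s (x s) x"
    then have s: "0 \<le> s" "s \<le> T" and B: "norm (x s) \<le> B" "norm y0 \<le> B" and tr: "trajectory F T s (x s) x" by auto
    obtain g E where g: "g integrable_on {s..T}" "g \<in> borel_measurable (lebesgue_on {s..T})"
      "\<And>t. t \<in> {s..T} \<Longrightarrow> g t \<in> F (x t)" "\<And>t. t \<in> {s..T} \<Longrightarrow> x t = x s + integral {s..t} g"
      by (rule trajectory_velocity[OF tr s(2)]) blast
    have xr: "1 + norm (x t) \<le> r" if "t \<in> {s..T}" for t
      unfolding r_def by (rule trajectory_bound[OF tr s B(1) that])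
    have rr: "radius (norm y0) \<le> r" using B by (simp add: r_def radius_def)
    have r0: "0 \<le> r" using xr[of s] s norm_ge_zero[of "x s"] by (meson add_nonneg_nonneg atLeastAtMost_iff order_refl order_trans zero_le_one)
    obtain y where "trajectory F T s y0 y"
      "\<And>t. t \<in> {s..T} \<Longrightarrow> norm (y t - x t) \<le> 3 * exp (2 * L * T) * (integral {s..T} (\<lambda>_. 0) + norm (y0 - x s))"
    proof (rule filippov_trajectory[OF s rr r0, of "\<lambda>_. F" L g "\<rho> * r" x "\<lambda>_. 0"])
      show "norm (g t) \<le> \<rho> * r" if "t \<in> {s..T}" for t by (rule velocity_le[OF g(3)[OF that] xr[OF that]])
      show "x t \<in> cball 0 r" if "t \<in> {s..T}" for t using xr[OF that] by simp
      show "\<exists>w\<in>F (x t). norm (w - g t) \<le> 0" if "t \<in> {s..T}" for t using g(3)[OF that] by force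
    qed (use F_ne F_convex F_graph_closed L g in blast)+
    then show "\<exists>y. trajectory F T s y0 y \<and> (\<forall>t\<in>{s..T}. norm (y t - x t) \<le> 3 * exp (2 * L * T) * norm (y0 - x s))"
      by (intro exI[of _ y]) auto
  qed simp
qed

lemma trajectory_exists:
  assumes s: "0 \<le> s" "s \<le> T"
  shows "\<exists>y. trajectory F T s y0 y"
proof -
  define r where "r = radius (norm y0)"
  have r1: "norm y0 \<le> r" unfolding r_def by (rule radius_ge) simp
  then have r0: "0 \<le> r" using norm_ge_zero order_trans by blast
  obtain L where L: "L > 0" "\<And>y z v. y \<in> cball 0 r \<Longrightarrow> z \<in> cball 0 r \<Longrightarrow> v \<in> F y \<Longrightarrow> \<exists>w\<in>F z. norm (w - v) \<le> L * norm (z - y)"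
    using F_lipschitz[of r] by blast
  show ?thesis
  \<comment> \<open>The first guess is the arc resting at \<open>y0\<close>; its defect is at most
    the largest admissible speed at \<open>y0\<close>.\<close>
  proof (rule filippov_trajectory[OF s _ r0, of y0 "\<lambda>_. F" L "\<lambda>_. 0" 0 "\<lambda>_. y0" "\<lambda>_. \<rho> * (1 + norm y0)"])
    show "\<exists>w\<in>F y0. norm (w - 0) \<le> \<rho> * (1 + norm y0)" using F_ne[of y0] \<rho>(2) by fastforce
    show "y0 \<in> cball 0 r" using r1 by simp
  qed (use F_ne F_convex F_graph_closed L r_def in \<open>auto simp del: mem_cball_0\<close>)
qed

lemma trajectory_restrict:
  assumes tr: "trajectory F T s y x" and t: "s \<le> t"
  shows "trajectory F T t (x t) x"
  unfolding trajectory_def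
proof (intro conjI refl)
  show "abs_continuous_on {t..T} x"
    by (rule abs_continuous_on_subset[of "{s..T}"]) (use tr t in \<open>auto simp: trajectory_def\<close>)
  have "AE u\<in>{s..T} in lebesgue. \<exists>v\<in>F (x u). (x has_vector_derivative v) (at u within {s..T})"
    using tr by (simp add: trajectory_def)
  then show "AE u\<in>{t..T} in lebesgue. \<exists>v\<in>F (x u). (x has_vector_derivative v) (at u within {t..T})"
  proof eventually_elim
    case (elim u)
    show ?case
    proof
      assume "u \<in> {t..T}"
      then obtain v where "v \<in> F (x u)" "(x has_vector_derivative v) (at u within {s..T})" using elim t by auto
      then show "\<exists>v\<in>F (x u). (x has_vector_derivative v) (at u within {t..T})"
        using t has_vector_derivative_within_subset[of x v u "{s..T}" "{t..T}"] by auto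
    qed
  qed
qed

lemma trajectory_concat:
  assumes x: "trajectory F T s y x" and z: "trajectory F T t (x t) z" and st: "0 \<le> s" "s \<le> t" "t \<le> T"
  shows "trajectory F T s y (\<lambda>\<tau>. if \<tau> \<le> t then x \<tau> else z \<tau>)"
  unfolding trajectory_def
proof (intro conjI)
  let ?c = "\<lambda>\<tau>. if \<tau> \<le> t then x \<tau> else z \<tau>"
  have xl: "(\<rho> * radius (norm y))-lipschitz_on {s..t} x"
    by (rule lipschitz_on_subset[OF trajectory_lipschitz_on[OF x]]) (use st in auto)
  have zl: "(\<rho> * radius (norm (x t)))-lipschitz_on {t..T} z"
    by (rule trajectory_lipschitz_on[OF z]) (use st in auto)
  have "x t = z t" using z by (simp add: trajectory_def)
  then show "abs_continuous_on {s..T} ?c"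
    by (rule lipschitz_on_imp_abs_continuous_on[OF lipschitz_on_concat_max[OF xl zl]])
  show "?c s = y" using x st by (simp add: trajectory_def)
  have "AE u\<in>{s..T} in lebesgue. \<exists>v\<in>F (x u). (x has_vector_derivative v) (at u within {s..T})"
    using x by (simp add: trajectory_def)
  moreover have "AE u\<in>{t..T} in lebesgue. \<exists>v\<in>F (z u). (z has_vector_derivative v) (at u within {t..T})"
    using z by (simp add: trajectory_def)
  \<comment> \<open>At \<open>t\<close> and \<open>T\<close> the derivative of \<open>z\<close> is
    only one-sided. Away from them it is a full derivative and survives the gluing.\<close>
  moreover have "AE u in lebesgue. u \<notin> {t,T}"
    by (rule AE_not_in) (simp add: negligible_iff_null_sets[symmetric])
  ultimately show "AE u\<in>{s..T} in lebesgue. \<exists>v\<in>F (?c u). (?c has_vector_derivative v) (at u within {s..T})"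
  proof eventually_elim
    case (elim u)
    show ?case
    proof
      assume u: "u \<in> {s..T}"
      show "\<exists>v\<in>F (?c u). (?c has_vector_derivative v) (at u within {s..T})"
      proof (cases "u < t")
        case True
        then obtain v where v: "v \<in> F (x u)" "(x has_vector_derivative v) (at u within {s..T})" using elim u by auto
        have "(?c has_vector_derivative v) (at u within {s..T})"
          by (rule has_vector_derivative_transform_within[OF v(2), of "t - u"])
            (use True u in \<open>auto simp: dist_real_def\<close>)
        then show ?thesis using v True by auto
      next
        case False
        then have u': "t < u" "u < T" using elim u by auto
        then obtain v where v: "v \<in> F (z u)" "(z has_vector_derivative v) (at u within {t..T})" using elim by auto
        then have "(z has_vector_derivative v) (at u)" using u' by (simp add: at_within_Icc_at)
        then have "(z has_vector_derivative v) (at u within {s..T})" by (rule has_vector_derivative_at_within)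
        then have "(?c has_vector_derivative v) (at u within {s..T})"
          by (rule has_vector_derivative_transform_within[of _ _ _ _ "u - t"])
            (use u u' in \<open>auto simp: dist_real_def\<close>)
        then show ?thesis using v u' by auto
      qed
    qed
  qed
qed

end

section \<open>The value function and adjoint arcs\<close>

lemma lipschitz_on_inner:
  fixes f g :: "real \<Rightarrow> 'a::real_inner"
  assumes f: "L-lipschitz_on S f" "\<And>t. t \<in> S \<Longrightarrow> norm (f t) \<le> A" "A \<ge> 0"
    and g: "M-lipschitz_on S g" "\<And>t. t \<in> S \<Longrightarrow> norm (g t) \<le> B" "B \<ge> 0"
  shows "(A * M + L * B)-lipschitz_on S (\<lambda>t. f t \<bullet> g t)"
proof (rule lipschitz_onI)
  have LM: "L \<ge> 0" "M \<ge> 0" using f(1) g(1) lipschitz_on_nonneg by blast+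
  show "0 \<le> A * M + L * B" using LM f(3) g(3) by simp
  fix s t assume st: "s \<in> S" "t \<in> S"
  have "f s \<bullet> g s - f t \<bullet> g t = f s \<bullet> (g s - g t) + (f s - f t) \<bullet> g t"
    by (simp add: inner_diff_left inner_diff_right)
  then have "\<bar>f s \<bullet> g s - f t \<bullet> g t\<bar> \<le> \<bar>f s \<bullet> (g s - g t)\<bar> + \<bar>(f s - f t) \<bullet> g t\<bar>" by simp
  also have "\<dots> \<le> norm (f s) * norm (g s - g t) + norm (f s - f t) * norm (g t)"
    by (intro add_mono Cauchy_Schwarz_ineq2)
  also have "\<dots> \<le> A * (M * dist s t) + L * dist s t * B"
    using lipschitz_onD[OF f(1) st] lipschitz_onD[OF g(1) st] f(2)[OF st(1)] g(2)[OF st(2)] f(3) g(3) LM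
    by (intro add_mono mult_mono) (auto simp: dist_norm)
  finally show "dist (f s \<bullet> g s) (f t \<bullet> g t) \<le> (A * M + L * B) * dist s t"
    by (simp add: dist_real_def algebra_simps)
qed

lemma integral_le_abs_continuous_increment:
  fixes h :: "real \<Rightarrow> real"
  assumes ab: "a \<le> b" and ac: "abs_continuous_on {a..b} h" and k: "k integrable_on {a..b}"
    and der: "AE t\<in>{a..b} in lebesgue. \<exists>d. (h has_vector_derivative d) (at t within {a..b}) \<and> k t \<le> d"
  shows "integral {a..b} k \<le> h b - h a"
proof -
  define E where "E = {t\<in>{a..b}. \<not> (\<exists>d. (h has_vector_derivative d) (at t within {a..b}) \<and> k t \<le> d)}"
  have E: "negligible E" using der unfolding AE_on_lebesgue_iff E_def .
  define g where "g t = (if t \<in> {a..b} - E then SOME d. (h has_vector_derivative d) (at t within {a..b}) \<and> k t \<le> d else k t)" for t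
  have g: "(h has_vector_derivative g t) (at t within {a..b}) \<and> k t \<le> g t" if "t \<in> {a..b} - E" for t
    using someI_ex[of "\<lambda>d. (h has_vector_derivative d) (at t within {a..b}) \<and> k t \<le> d"] that
    by (auto simp: g_def E_def)
  have kg: "k t \<le> g t" for t using g[of t] by (cases "t \<in> {a..b} - E") (auto simp: g_def)
  have "(g has_integral (h b - h a)) {a..b}"
    using abs_continuous_has_integral[OF ab ac E] g by blast
  then show ?thesis
    using has_integral_le[OF integrable_integral[OF k]] kg by blast
qed

text \<open>The Cauchy-Schwarz inequality, obtained by integrating the square of \<open>D\<close>
  minus its mean value.\<close>

lemma integral_square_le:
  fixes D :: "real \<Rightarrow> real"
  assumes ab: "a \<le> b" and D: "D integrable_on {a..b}" "(\<lambda>t. (D t)\<^sup>2) integrable_on {a..b}"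
  shows "(integral {a..b} D)\<^sup>2 \<le> (b - a) * integral {a..b} (\<lambda>t. (D t)\<^sup>2)"
proof (cases "a = b")
  case False
  define l where "l = b - a"
  have l: "l > 0" using ab False by (simp add: l_def)
  define I J where "I = integral {a..b} D" and "J = integral {a..b} (\<lambda>t. (D t)\<^sup>2)"
  define m where "m = I / l"
  have "0 \<le> integral {a..b} (\<lambda>t. (D t)\<^sup>2 - 2 * m * D t + m\<^sup>2)"
  proof (rule Henstock_Kurzweil_Integration.integral_nonneg)
    show "(\<lambda>t. (D t)\<^sup>2 - 2 * m * D t + m\<^sup>2) integrable_on {a..b}"
      using D by (intro integrable_add integrable_diff integrable_on_mult_right) auto
    show "0 \<le> (D t)\<^sup>2 - 2 * m * D t + m\<^sup>2" for t
      using zero_le_power2[of "D t - m"] by (simp add: power2_diff mult_ac)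
  qed
  also have "\<dots> = J - 2 * m * I + m\<^sup>2 * l"
  proof -
    have i: "(\<lambda>t. 2 * m * D t) integrable_on {a..b}" using D(1) by (rule integrable_on_mult_right)
    have "integral {a..b} (\<lambda>t. (D t)\<^sup>2 - 2 * m * D t + m\<^sup>2) =
        integral {a..b} (\<lambda>t. (D t)\<^sup>2 - 2 * m * D t) + integral {a..b} (\<lambda>_. m\<^sup>2)"
      using D i by (intro Henstock_Kurzweil_Integration.integral_add integrable_diff) auto
    also have "integral {a..b} (\<lambda>t. (D t)\<^sup>2 - 2 * m * D t) = J - integral {a..b} (\<lambda>t. 2 * m * D t)"
      unfolding J_def using D i by (intro Henstock_Kurzweil_Integration.integral_diff) auto
    also have "integral {a..b} (\<lambda>t. 2 * m * D t) = 2 * m * I" by (simp add: I_def)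
    finally show ?thesis using ab by (simp add: l_def mult.commute)
  qed
  also have "\<dots> = J - I\<^sup>2 / l" using l by (simp add: m_def power2_eq_square field_simps)
  finally have "I\<^sup>2 \<le> l * J" using l by (simp add: field_simps)
  then show ?thesis by (simp add: I_def J_def l_def)
qed simp

context mayer_problem
begin

section \<open>The value function\<close>

abbreviation V :: "real \<times> (real^'n) \<Rightarrow> real" where "V \<equiv> value_function F \<phi> T"

lemma \<phi>_continuous: "continuous_on A \<phi>"
  using continuous_on_subset[OF locally_semiconcave_continuous[OF \<phi>_semiconcave]] by blast

lemma V_bdd_below:
  assumes s: "0 \<le> s" "s \<le> T"
  shows "bdd_below ((\<lambda>x. \<phi> (x T)) ` {x. trajectory F T s y x})"
proof -
  have "bounded (\<phi> ` cball 0 (radius (norm y)))"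
    by (intro compact_imp_bounded compact_continuous_image \<phi>_continuous compact_cball)
  then obtain M where M: "\<And>z. z \<in> cball 0 (radius (norm y)) \<Longrightarrow> \<bar>\<phi> z\<bar> \<le> M" unfolding bounded_iff by force
  show ?thesis
  proof (rule bdd_belowI2)
    fix x assume "x \<in> {x. trajectory F T s y x}"
    then have "1 + norm (x T) \<le> radius (norm y)" using trajectory_bound[OF _ s order_refl, of y x T] s by auto
    then have "x T \<in> cball 0 (radius (norm y))" by simp
    then show "- M \<le> \<phi> (x T)" using M[of "x T"] by linarith
  qed
qed

lemma V_le: "0 \<le> s \<Longrightarrow> s \<le> T \<Longrightarrow> trajectory F T s y x \<Longrightarrow> V (s, y) \<le> \<phi> (x T)"
  unfolding value_function_def using V_bdd_below[of s y] by (auto intro!: cINF_lower)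

lemma V_greatest:
  assumes "0 \<le> s" "s \<le> T" "\<And>x. trajectory F T s y x \<Longrightarrow> c \<le> \<phi> (x T)"
  shows "c \<le> V (s, y)"
  unfolding value_function_def using trajectory_exists[OF assms(1,2), of y] assms(3) by (auto intro!: cINF_greatest)

lemma V_approx:
  assumes "0 \<le> s" "s \<le> T" "e > 0"
  shows "\<exists>x. trajectory F T s y x \<and> \<phi> (x T) < V (s, y) + e"
proof (rule ccontr)
  assume "\<not> ?thesis"
  then have "V (s, y) + e \<le> V (s, y)" using assms by (intro V_greatest) force+
  with assms show False by simp
qed

lemma V_T: "V (T, y) = \<phi> y"
proof (rule antisym)
  obtain x where x: "trajectory F T T y x" using trajectory_exists[of T y] T_pos by auto
  then have "x T = y" by (simp add: trajectory_def)
  with V_le[OF _ _ x] T_pos show "V (T, y) \<le> \<phi> y" by simp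
  show "\<phi> y \<le> V (T, y)" by (rule V_greatest) (use T_pos in \<open>auto simp: trajectory_def\<close>)
qed

text \<open>A nearly optimal arc from \<open>x s\<close> is still close to \<open>x t\<close> at
  time \<open>t\<close>, and a neighbouring trajectory started at \<open>x t\<close> then ends
  nearly as cheaply. This excludes upward jumps of the value along \<open>x\<close>, as
  \<open>right_dini_nonpos_imp_le\<close> demands.\<close>

lemma V_along_trajectory_lsc:
  assumes x: "trajectory F T t0 x0 x" and t0: "0 \<le> t0" "t0 \<le> T" and e: "e > 0"
  shows "\<exists>d>0. \<forall>s t. t0 \<le> s \<and> s \<le> t \<and> t \<le> T \<and> t - s < d \<longrightarrow> V (t, x t) \<le> V (s, x s) + e"
proof -
  define B1 where "B1 = radius (norm x0)"
  define B2 where "B2 = radius B1"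
  have xB: "norm (x t) \<le> B1" if "t \<in> {t0..T}" for t
    using trajectory_bound[OF x t0 order_refl that] by (simp add: B1_def)
  have B1: "B1 \<ge> 0" using xB[of t0] t0 norm_ge_zero order_trans by (metis atLeastAtMost_iff order_refl)
  have B12: "B1 \<le> B2" unfolding B2_def using B1 by (rule radius_ge)
  obtain C where C: "C > 0" "\<And>s y0 z. 0 \<le> s \<Longrightarrow> s \<le> T \<Longrightarrow> norm (z s) \<le> B2 \<Longrightarrow> norm y0 \<le> B2 \<Longrightarrow>
      trajectory F T s (z s) z \<Longrightarrow> \<exists>y. trajectory F T s y0 y \<and> (\<forall>t\<in>{s..T}. norm (y t - z t) \<le> C * norm (y0 - z s))"
    using trajectory_exists_near[of B2] by blast
  have "uniformly_continuous_on (cball 0 (radius B2)) \<phi>"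
    by (intro compact_uniformly_continuous \<phi>_continuous compact_cball)
  then obtain \<eta> where \<eta>: "\<eta> > 0" "\<And>y z. y \<in> cball 0 (radius B2) \<Longrightarrow> z \<in> cball 0 (radius B2) \<Longrightarrow> dist z y < \<eta> \<Longrightarrow> dist (\<phi> z) (\<phi> y) < e/2"
    using e unfolding uniformly_continuous_on_def by (meson half_gt_zero)
  \<comment> \<open>The speeds of \<open>x\<close> and of the nearly optimal arc add up, since both
    leave \<open>x s\<close> at time \<open>s\<close>.\<close>
  define M where "M = \<rho> * B1 + \<rho> * B2"
  have M: "M \<ge> 0" using B1 B12 \<rho>(1) by (simp add: M_def)
  define d where "d = \<eta> / (C * M + 1)"
  have CM: "C * M + 1 > 0" using C(1) M by (simp add: add_nonneg_pos)
  show ?thesis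
  proof (intro exI[of _ d] conjI allI impI)
    show "d > 0" using \<eta>(1) CM by (simp add: d_def)
    fix s t assume A: "t0 \<le> s \<and> s \<le> t \<and> t \<le> T \<and> t - s < d"
    then have s: "0 \<le> s" "s \<le> T" and t: "0 \<le> t" "t \<le> T" "t \<in> {s..T}" "s \<in> {s..T}" "s \<in> {t0..T}" "t \<in> {t0..T}"
      using t0 by auto
    obtain z where z: "trajectory F T s (x s) z" "\<phi> (z T) < V (s, x s) + e/2" using V_approx[OF s, of "e/2"] e by auto
    have zs: "z s = x s" using z(1) by (simp add: trajectory_def)
    have zB: "norm (z u) \<le> B2" if "u \<in> {s..T}" for u
      using trajectory_bound[OF z(1) s xB[OF t(5)] that] by (simp add: B2_def)
    have zt: "trajectory F T t (z t) z" by (rule trajectory_restrict[OF z(1)]) (use A in simp)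
    have "norm (x t) \<le> B2" using xB[OF t(6)] B12 by simp
    then obtain y where y: "trajectory F T t (x t) y" "\<And>u. u \<in> {t..T} \<Longrightarrow> norm (y u - z u) \<le> C * norm (x t - z t)"
      using C(2)[OF t(1,2) zB[OF t(3)] _ zt] by blast
    have "norm (x t - z t) \<le> norm (x t - x s) + norm (z s - z t)"
      using norm_triangle_ineq[of "x t - x s" "z s - z t"] zs by simp
    also have "\<dots> \<le> \<rho> * B1 * (t - s) + \<rho> * B2 * (t - s)"
      using lipschitz_onD[OF trajectory_lipschitz_on[OF x t0 order_refl] t(6,5)]
        lipschitz_onD[OF trajectory_lipschitz_on[OF z(1) s xB[OF t(5)]] t(4,3)] A
      by (simp add: dist_norm B1_def B2_def)
    also have "\<dots> = M * (t - s)" by (simp add: M_def algebra_simps)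
    finally have xz: "norm (x t - z t) \<le> M * (t - s)" .
    have "norm (y T - z T) \<le> C * norm (x t - z t)" using y(2)[of T] t by simp
    also have "\<dots> \<le> C * (M * (t - s))" using xz C(1) by (intro mult_left_mono) auto
    also have "\<dots> \<le> (C * M + 1) * (t - s)" using A by (simp add: algebra_simps)
    also have "\<dots> < (C * M + 1) * d" using A CM by (intro mult_strict_left_mono) auto
    also have "\<dots> = \<eta>" using CM by (simp add: d_def)
    finally have "dist (y T) (z T) < \<eta>" by (simp add: dist_norm)
    moreover have "y T \<in> cball 0 (radius B2)"
      using trajectory_bound[OF y(1) t(1,2) \<open>norm (x t) \<le> B2\<close>, of T] t by simp
    moreover have "z T \<in> cball 0 (radius B2)"
      using zB[of T] s radius_ge[of B2] B1 B12 by simp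
    ultimately have "dist (\<phi> (y T)) (\<phi> (z T)) < e/2" using \<eta>(2) by blast
    then have "\<phi> (y T) < \<phi> (z T) + e/2" unfolding dist_real_def by linarith
    then show "V (t, x t) \<le> V (s, x s) + e" using V_le[OF t(1,2) y(1)] z(2) by linarith
  qed
qed

text \<open>Dynamic programming: a cheaper continuation from \<open>x t\<close> could be appended to
  the initial part of \<open>x\<close> and would beat the optimal arc.\<close>

lemma optimal_V_eq:
  assumes x: "mayer_optimal F \<phi> T t0 x0 x" and t: "0 \<le> t0" "t0 \<le> t" "t \<le> T"
  shows "V (t, x t) = \<phi> (x T)"
proof (rule antisym)
  have tr: "trajectory F T t0 x0 x" and opt: "\<phi> (x T) = V (t0, x0)" using x by (auto simp: mayer_optimal_def)
  show "V (t, x t) \<le> \<phi> (x T)" by (rule V_le[OF _ _ trajectory_restrict[OF tr t(2)]]) (use t in auto)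
  show "\<phi> (x T) \<le> V (t, x t)"
  proof (rule V_greatest)
    fix z assume z: "trajectory F T t (x t) z"
    have "V (t0, x0) \<le> \<phi> (if T \<le> t then x T else z T)"
      by (rule V_le[OF t(1) _ trajectory_concat[OF tr z t]]) (use t in auto)
    moreover have "(if T \<le> t then x T else z T) = z T" using z t by (auto simp: trajectory_def)
    ultimately show "\<phi> (x T) \<le> \<phi> (z T)" by (simp add: opt)
  qed (use t in auto)
qed

section \<open>Subgradients of the Hamiltonian in the state variable\<close>

lemma H_subdiff_ge:
  "\<exists>c\<ge>0. \<forall>x\<in>cball 0 r. \<forall>y\<in>cball 0 r. \<forall>p w. w \<in> frechet_subdiff UNIV (\<lambda>y. H y p) x \<longrightarrow>
    H y p \<ge> H x p + w \<bullet> (y - x) - c * norm p * (norm (y - x))\<^sup>2"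
proof (cases "r \<ge> 0")
  case False then show ?thesis by (intro exI[of _ 0]) auto
next
  case True
  then have "cball (0::real^'n) r \<noteq> {}" by simp
  then obtain c where c: "c \<ge> 0" "\<forall>p. semiconvex_on_with (c * norm p) (cball 0 r) (\<lambda>x. H x p)"
    using H_semiconvex[OF _ convex_cball compact_cball] by blast
  show ?thesis
  proof (intro exI[of _ "c/2"] conjI ballI allI impI)
    fix x y p w :: "real^'n" assume "x \<in> cball 0 r" "y \<in> cball 0 r" "w \<in> frechet_subdiff UNIV (\<lambda>y. H y p) x"
    then show "H y p \<ge> H x p + w \<bullet> (y - x) - c / 2 * norm p * (norm (y - x))\<^sup>2"
      using semiconvex_frechet_subdiff_ge[OF c(2)[rule_format] convex_cball] by fastforce
  qed (use c in simp)
qed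

text \<open>Test the subgradient inequality at distance one in the direction of \<open>w\<close>;
  this is why the enlarged ball of radius \<open>r + 1\<close> appears. Linearity of the bound in
  \<open>norm p\<close> is what makes Gronwall's inequality applicable to adjoint arcs.\<close>

lemma H_subdiff_bound:
  "\<exists>C>0. \<forall>x\<in>cball 0 r. \<forall>p w. w \<in> frechet_subdiff UNIV (\<lambda>y. H y p) x \<longrightarrow> norm w \<le> C * norm p"
proof -
  obtain c where c: "c \<ge> 0" "\<And>x y p w. x \<in> cball 0 (r+1) \<Longrightarrow> y \<in> cball 0 (r+1) \<Longrightarrow>
      w \<in> frechet_subdiff UNIV (\<lambda>y. H y p) x \<Longrightarrow> H y p \<ge> H x p + w \<bullet> (y - x) - c * norm p * (norm (y - x))\<^sup>2"
    using H_subdiff_ge[of "r+1"] by blast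
  obtain L where L: "L > 0" "\<And>y z p. y \<in> cball 0 (r+1) \<Longrightarrow> z \<in> cball 0 (r+1) \<Longrightarrow> \<bar>H y p - H z p\<bar> \<le> L * norm p * norm (y - z)"
    using H_lipschitz[of "r+1"] by blast
  show ?thesis
  proof (intro exI[of _ "L + c"] conjI ballI allI impI)
    fix x p w assume x: "x \<in> cball (0::real^'n) r" and w: "w \<in> frechet_subdiff UNIV (\<lambda>y. H y p) x"
    show "norm w \<le> (L + c) * norm p"
    proof (cases "w = 0")
      case False
      define d where "d = w /\<^sub>R norm w"
      have d: "norm d = 1" "w \<bullet> d = norm w" using False by (auto simp: d_def dot_square_norm power2_eq_square)
      have xr: "x \<in> cball 0 (r+1)" "x + d \<in> cball 0 (r+1)"
        using x d norm_triangle_ineq[of x d] by auto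
      show ?thesis using c(2)[OF xr w] L(2)[OF xr(2,1), of p] d by (simp add: algebra_simps abs_le_iff)
    qed (use L c in simp)
  qed (use L c in auto)
qed

text \<open>Converse to \<open>H_subdiff_ge\<close>, needed because subgradients are later
  represented by this quadratic inequality. Strictness of \<open>norm x < r\<close> makes the ball a
  neighbourhood of \<open>x\<close>.\<close>

lemma frechet_subdiff_HI:
  assumes r: "norm x < r" and c: "c \<ge> 0"
    and ge: "\<And>y. y \<in> cball 0 r \<Longrightarrow> H y p \<ge> H x p + w \<bullet> (y - x) - c * norm p * (norm (y - x))\<^sup>2"
  shows "w \<in> frechet_subdiff UNIV (\<lambda>y. H y p) x"
  unfolding frechet_subdiff_iff
proof (intro allI impI)
  fix e :: real assume e: "e > 0"
  define k where "k = c * norm p"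
  have k: "k \<ge> 0" using c by (simp add: k_def)
  define \<delta> where "\<delta> = min (r - norm x) (e / (k + 1))"
  have \<delta>: "\<delta> > 0" using r e k by (simp add: \<delta>_def)
  show "\<forall>\<^sub>F y in at x. - e * norm (y - x) \<le> H y p - H x p - w \<bullet> (y - x)"
    unfolding eventually_at
  proof (intro exI[of _ \<delta>] conjI ballI impI \<delta>)
    fix y assume "y \<noteq> x \<and> dist y x < \<delta>"
    then have y: "norm (y - x) < r - norm x" "norm (y - x) \<le> e / (k + 1)" by (auto simp: \<delta>_def dist_norm)
    have "norm y \<le> r" using y(1) norm_triangle_ineq[of "y - x" x] by simp
    then have g: "H y p \<ge> H x p + w \<bullet> (y - x) - k * (norm (y - x))\<^sup>2" using ge[of y] by (simp add: k_def)
    have "k * norm (y - x) \<le> (k + 1) * (e / (k + 1))" using y k by (intro mult_mono) auto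
    also have "\<dots> = e" using k by (simp add: add_nonneg_eq_0_iff)
    finally have "k * norm (y - x) * norm (y - x) \<le> e * norm (y - x)" by (intro mult_right_mono) auto
    with g show "- e * norm (y - x) \<le> H y p - H x p - w \<bullet> (y - x)" by (simp add: power2_eq_square)
  qed
qed

text \<open>Since \<open>norm (p')\<close> is at most \<open>C * norm p\<close>, Gronwall's
  inequality runs in both time directions: a zero final value forces \<open>p\<close> to vanish, and
  a nonzero one keeps it away from zero.\<close>

lemma adjoint_arc_bounds:
  assumes p: "adjoint_arc F T a x p" and a: "a \<le> T" and x: "\<And>t. t \<in> {a..T} \<Longrightarrow> x t \<in> cball 0 r"
    and C: "C > 0" "\<forall>x\<in>cball 0 r. \<forall>p w. w \<in> frechet_subdiff UNIV (\<lambda>y. H y p) x \<longrightarrow> norm w \<le> C * norm p"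
    and t: "t \<in> {a..T}"
  shows "norm (p t) \<le> norm (p T) * exp (C * (T - t))" "norm (p T) \<le> norm (p t) * exp (C * (T - t))"
proof -
  have ac: "abs_continuous_on {a..T} p" using p by (simp add: adjoint_arc_def)
  have pc: "continuous_on {a..T} p" by (rule abs_continuous_on_imp_continuous_on[OF ac])
  have ae: "AE t\<in>{a..T} in lebesgue. \<exists>w. (p has_vector_derivative w) (at t within {a..T}) \<and>
        - w \<in> frechet_subdiff UNIV (\<lambda>y. H y (p t)) (x t)" using p by (simp add: adjoint_arc_def)
  define E where "E = {t\<in>{a..T}. \<not> (\<exists>w. (p has_vector_derivative w) (at t within {a..T}) \<and>
        - w \<in> frechet_subdiff UNIV (\<lambda>y. H y (p t)) (x t))}"
  have E: "negligible E" using ae unfolding AE_on_lebesgue_iff E_def .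
  define g where "g t = (if t \<in> {a..T} - E then SOME w. (p has_vector_derivative w) (at t within {a..T}) \<and>
        - w \<in> frechet_subdiff UNIV (\<lambda>y. H y (p t)) (x t) else 0)" for t
  have g: "(p has_vector_derivative g t) (at t within {a..T}) \<and> - g t \<in> frechet_subdiff UNIV (\<lambda>y. H y (p t)) (x t)"
    if "t \<in> {a..T} - E" for t
    using someI_ex[of "\<lambda>w. (p has_vector_derivative w) (at t within {a..T}) \<and>
        - w \<in> frechet_subdiff UNIV (\<lambda>y. H y (p t)) (x t)"] that
    by (auto simp: g_def E_def)
  have gC: "norm (g t) \<le> C * norm (p t)" if "t \<in> {a..T}" for t
  proof (cases "t \<in> E")
    case True then show ?thesis using C by (simp add: g_def)
  next
    case False
    then have "- g t \<in> frechet_subdiff UNIV (\<lambda>y. H y (p t)) (x t)" using g that by blast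
    then have "norm (- g t) \<le> C * norm (p t)" using C(2) x[OF that] by blast
    then show ?thesis by simp
  qed
  have inc: "norm (p v - p u) \<le> C * integral {u..v} (\<lambda>t. norm (p t))" if uv: "a \<le> u" "u \<le> v" "v \<le> T" for u v
  proof -
    have gi: "(g has_integral (p v - p u)) {u..v}"
      by (rule abs_continuous_has_integral_subinterval[OF uv ac E]) (use g in blast)
    have pi: "(\<lambda>t. norm (p t)) integrable_on {u..v}"
      using uv by (intro integrable_continuous_real continuous_intros continuous_on_subset[OF pc]) auto
    have "norm (integral {u..v} g) \<le> integral {u..v} (\<lambda>t. C * norm (p t))"
      using gi pi gC uv by (intro Henstock_Kurzweil_Integration.integral_norm_bound_integral integrable_on_mult_right) auto
    then show ?thesis using integral_unique[OF gi] by simp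
  qed
  show "norm (p t) \<le> norm (p T) * exp (C * (T - t))"
  proof (rule gronwall_backward[OF _ less_imp_le[OF C(1)] _ t])
    show "continuous_on {a..T} (\<lambda>t. norm (p t))" by (intro continuous_intros pc)
    show "norm (p u) \<le> norm (p T) + C * integral {u..T} (\<lambda>t. norm (p t))" if "u \<in> {a..T}" for u
      using inc[of u T] that norm_triangle_ineq2[of "p u" "p T"] by (simp add: norm_minus_commute)
  qed
  show "norm (p T) \<le> norm (p t) * exp (C * (T - t))"
  proof (rule gronwall[OF _ less_imp_le[OF C(1)], of t T])
    show "continuous_on {t..T} (\<lambda>t. norm (p t))"
      using t by (intro continuous_intros continuous_on_subset[OF pc]) auto
    show "norm (p u) \<le> norm (p t) + C * integral {t..u} (\<lambda>t. norm (p t))" if "u \<in> {t..T}" for u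
      using inc[of t u] that t norm_triangle_ineq2[of "p u" "p t"] by simp
  qed (use t in auto)
qed

end

section \<open>Maximizing arcs and existence of adjoint arcs\<close>

lemma norm_diff_power_integrable_on:
  fixes g h :: "real \<Rightarrow> 'a::euclidean_space"
  assumes g: "g integrable_on {a..b}" "\<And>t. t \<in> {a..b} \<Longrightarrow> norm (g t) \<le> M"
    and h: "continuous_on {a..b} h"
  shows "(\<lambda>t. norm (g t - h t) ^ n) integrable_on {a..b}"
proof -
  have "bounded (h ` {a..b})" by (intro compact_imp_bounded compact_continuous_image h) auto
  then obtain N where N: "\<And>t. t \<in> {a..b} \<Longrightarrow> norm (h t) \<le> N" unfolding bounded_iff by blast
  have hm: "h \<in> borel_measurable (lebesgue_on {a..b})"
    by (rule continuous_imp_measurable_on_sets_lebesgue[OF h]) simp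
  have gm: "g \<in> borel_measurable (lebesgue_on {a..b})" using g(1) by (rule integrable_imp_measurable)
  have m: "(\<lambda>t. norm (g t - h t) ^ n) \<in> borel_measurable (lebesgue_on {a..b})"
    using hm gm by measurable
  have "norm (norm (g t - h t) ^ n) \<le> (M + N) ^ n" if "t \<in> {a..b}" for t
  proof -
    have "norm (g t - h t) \<le> M + N"
      using norm_triangle_ineq4[of "g t" "h t"] g(2)[OF that] N[OF that] by linarith
    then show ?thesis by (simp add: norm_power power_mono)
  qed
  then show ?thesis using bounded_measurable_integrable_on[OF m] by blast
qed

context mayer_problem
begin

text \<open>A change of state is controlled by the Lipschitz constant of \<open>f\<close>, a change
  of time by R-convexity, because time enters only through the direction of \<open>p t\<close>,
  which is continuous as long as \<open>p\<close> has no zeros.\<close>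

lemma f_continuous_on:
  assumes p: "continuous_on {a..b} p" "\<And>t. t \<in> {a..b} \<Longrightarrow> p t \<noteq> 0"
  shows "continuous_on ({a..b} \<times> cball 0 r) (\<lambda>(t,y). f y (p t))"
  unfolding continuous_on_def
proof
  fix z0 assume z0: "z0 \<in> {a..b} \<times> cball (0::real^'n) r"
  let ?S = "{a..b} \<times> cball (0::real^'n) r" and ?u = "\<lambda>t. p t /\<^sub>R norm (p t)"
  obtain L where L: "L > 0" "\<And>x y p. x \<in> cball 0 r \<Longrightarrow> y \<in> cball 0 r \<Longrightarrow> p \<noteq> 0 \<Longrightarrow> norm (f x p - f y p) \<le> L * norm (x - y)"
    using f_lipschitz_x[of r] by blast
  obtain R where R: "R > 0" "\<And>x. x \<in> cball 0 r \<Longrightarrow> R_convex R (F x)" using F_R_convex[of r] by blast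
  let ?b = "\<lambda>z. L * norm (snd z - snd z0) + R * norm (?u (fst z) - ?u (fst z0))"
  have uc: "continuous_on {a..b} ?u" using p by (intro continuous_intros) auto
  have bc: "continuous_on ?S ?b"
    by (intro continuous_intros continuous_on_compose2[OF uc]) auto
  have "(?b \<longlongrightarrow> ?b z0) (at z0 within ?S)" by (rule bc[unfolded continuous_on_def, rule_format, OF z0])
  then have b0: "(?b \<longlongrightarrow> 0) (at z0 within ?S)" by simp
  have "\<forall>\<^sub>F z in at z0 within ?S. norm ((case z of (t,y) \<Rightarrow> f y (p t)) - (case z0 of (t,y) \<Rightarrow> f y (p t))) \<le> ?b z"
    unfolding eventually_at_filter
  proof (rule always_eventually, intro allI impI)
    fix z assume z: "z \<in> ?S"
    have pz: "p (fst z) \<noteq> 0" "p (fst z0) \<noteq> 0" "snd z \<in> cball 0 r" "snd z0 \<in> cball 0 r" using p(2) z z0 by auto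
    have "norm (f (snd z) (p (fst z)) - f (snd z0) (p (fst z0))) \<le>
        norm (f (snd z) (p (fst z)) - f (snd z0) (p (fst z))) + norm (f (snd z0) (p (fst z)) - f (snd z0) (p (fst z0)))"
      using dist_triangle[of "f (snd z) (p (fst z))" "f (snd z0) (p (fst z0))" "f (snd z0) (p (fst z))"]
      by (simp add: dist_norm)
    also have "\<dots> \<le> ?b z"
      using L(2)[OF pz(3,4,1)] f_diff_le_p[OF R(2)[OF pz(4)] pz(1,2)] by linarith
    finally show "norm ((case z of (t,y) \<Rightarrow> f y (p t)) - (case z0 of (t,y) \<Rightarrow> f y (p t))) \<le> ?b z"
      by (simp add: case_prod_unfold)
  qed
  then have "((\<lambda>z. (case z of (t,y) \<Rightarrow> f y (p t)) - (case z0 of (t,y) \<Rightarrow> f y (p t))) \<longlongrightarrow> 0) (at z0 within ?S)"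
    using b0 by (rule Lim_null_comparison)
  then show "((\<lambda>(t,y). f y (p t)) \<longlongrightarrow> (case z0 of (t,y) \<Rightarrow> f y (p t))) (at z0 within ?S)"
    by (rule LIM_zero_cancel)
qed

lemma f_along_continuous_on:
  assumes p: "continuous_on {a..b} p" "\<And>t. t \<in> {a..b} \<Longrightarrow> p t \<noteq> 0"
    and x: "continuous_on {a..b} x" "\<And>t. t \<in> {a..b} \<Longrightarrow> x t \<in> cball 0 r"
  shows "continuous_on {a..b} (\<lambda>t. f (x t) (p t))"
proof -
  have "continuous_on {a..b} ((\<lambda>(t,y). f y (p t)) \<circ> (\<lambda>t. (t, x t)))"
    using x by (intro continuous_on_compose continuous_intros continuous_on_subset[OF f_continuous_on[OF p, of r]]) auto
  then show ?thesis by (simp add: o_def)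
qed

text \<open>The constant must not depend on the initial time, on the arc or on the costate: the
  backward induction in the maximum principle restarts at many times, and the sensitivity estimate
  uses all of them.\<close>

definition max_arc_bound :: "real \<Rightarrow> real \<Rightarrow> bool" where
  "max_arc_bound B C \<longleftrightarrow> (\<forall>s y0 x g p. 0 \<le> s \<and> s \<le> T \<and> norm (x s) \<le> B \<and> norm y0 \<le> B \<and> g integrable_on {s..T} \<and>
     (\<forall>t\<in>{s..T}. g t \<in> F (x t)) \<and> (\<forall>t\<in>{s..T}. x t = x s + integral {s..t} g) \<and>
     continuous_on {s..T} p \<and> (\<forall>t\<in>{s..T}. p t \<noteq> 0) \<longrightarrow>
     (\<exists>y v. trajectory F T s y0 y \<and> v integrable_on {s..T} \<and> (\<forall>t\<in>{s..T}. v t = f (y t) (p t)) \<and>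
       (\<forall>t\<in>{s..T}. y t = y0 + integral {s..t} v) \<and>
       (\<forall>t\<in>{s..T}. norm (y t - x t) \<le> C * (integral {s..T} (\<lambda>t. norm (g t - f (x t) (p t))) + norm (y0 - x s)))))"

text \<open>Filippov's theorem for the singleton values \<open>{f y (p t)}\<close>. Their Lipschitz
  constant in the state is the same for all nonzero costates, and the defect along \<open>x\<close>
  is exactly \<open>norm (g t - f (x t) (p t))\<close>.\<close>

lemma max_arc_exists: "\<exists>C>0. max_arc_bound B C"
proof -
  define r where "r = radius B"
  obtain L where L: "L > 0" "\<And>x y p. x \<in> cball 0 r \<Longrightarrow> y \<in> cball 0 r \<Longrightarrow> p \<noteq> 0 \<Longrightarrow> norm (f x p - f y p) \<le> L * norm (x - y)"
    using f_lipschitz_x[of r] by blast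
  show ?thesis
    unfolding max_arc_bound_def
  proof (intro exI[of _ "3 * exp (2 * L * T)"] conjI allI impI)
    fix s and y0 :: "real^'n" and x g p :: "real \<Rightarrow> real^'n"
    assume A: "0 \<le> s \<and> s \<le> T \<and> norm (x s) \<le> B \<and> norm y0 \<le> B \<and> g integrable_on {s..T} \<and>
     (\<forall>t\<in>{s..T}. g t \<in> F (x t)) \<and> (\<forall>t\<in>{s..T}. x t = x s + integral {s..t} g) \<and>
     continuous_on {s..T} p \<and> (\<forall>t\<in>{s..T}. p t \<noteq> 0)"
    then have s: "0 \<le> s" "s \<le> T" and B: "norm (x s) \<le> B" "norm y0 \<le> B" and g: "g integrable_on {s..T}"
      and gF: "\<And>t. t \<in> {s..T} \<Longrightarrow> g t \<in> F (x t)" and x: "\<And>t. t \<in> {s..T} \<Longrightarrow> x t = x s + integral {s..t} g"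
      and p: "continuous_on {s..T} p" "\<And>t. t \<in> {s..T} \<Longrightarrow> p t \<noteq> 0" by blast+
    have xr: "1 + norm (x t) \<le> r" if "t \<in> {s..T}" for t
      unfolding r_def by (rule arc_in_radius[OF s g x \<rho>(2)[OF gF] that B(1)])
    have xr': "x t \<in> cball 0 r" if "t \<in> {s..T}" for t using xr[OF that] by simp
    have rr: "radius (norm y0) \<le> r" using B by (simp add: r_def radius_def)
    have r0: "0 \<le> r" using xr[of s] s norm_ge_zero[of "x s"] by (meson add_nonneg_nonneg atLeastAtMost_iff order_refl order_trans zero_le_one)
    have gM: "norm (g t) \<le> \<rho> * r" if "t \<in> {s..T}" for t by (rule velocity_le[OF gF[OF that] xr[OF that]])
    have xc: "continuous_on {s..T} x"
    proof (rule continuous_on_eq)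
      show "continuous_on {s..T} (\<lambda>t. x s + integral {s..t} g)"
        by (intro continuous_intros indefinite_integral_continuous_1 g)
    qed (rule x[symmetric])
    have fx: "continuous_on {s..T} (\<lambda>t. f (x t) (p t))" by (rule f_along_continuous_on[OF p xc xr'])
    have "(\<lambda>t. norm (g t - f (x t) (p t)) ^ 1) integrable_on {s..T}"
      by (rule norm_diff_power_integrable_on[OF g gM fx])
    then have D: "(\<lambda>t. norm (g t - f (x t) (p t))) integrable_on {s..T}" by (simp only: power_one_right)
    have fc: "continuous_on ({s..T} \<times> cball 0 r) (\<lambda>(t,y). f y (p t))" by (rule f_continuous_on[OF p])
    have "compact ((\<lambda>z. (fst z, snd z, (\<lambda>(t,y). f y (p t)) z)) ` ({s..T} \<times> cball 0 r))"
      by (intro compact_continuous_image continuous_intros fc compact_Times) auto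
    also have "(\<lambda>z. (fst z, snd z, (\<lambda>(t,y). f y (p t)) z)) ` ({s..T} \<times> cball 0 r) =
        {(t,y,w). t \<in> {s..T} \<and> y \<in> cball 0 r \<and> w \<in> {f y (p t)}}" by force
    finally have graph: "closed {(t,y,w). t \<in> {s..T} \<and> y \<in> cball 0 r \<and> w \<in> {f y (p t)}}" by (rule compact_imp_closed)
    obtain y v where y: "trajectory F T s y0 y" "v integrable_on {s..T}"
      "\<And>t. t \<in> {s..T} \<Longrightarrow> v t \<in> {f (y t) (p t)}" "\<And>t. t \<in> {s..T} \<Longrightarrow> y t = y0 + integral {s..t} v"
      "\<And>t. t \<in> {s..T} \<Longrightarrow> y t \<in> cball 0 r"
      "\<And>t. t \<in> {s..T} \<Longrightarrow> norm (y t - x t) \<le> 3 * exp (2 * L * T) *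
        (integral {s..T} (\<lambda>t. norm (g t - f (x t) (p t))) + norm (y0 - x s))"
    proof (rule filippov_trajectory[OF s rr r0, of "\<lambda>t y. {f y (p t)}" L g "\<rho> * r" x "\<lambda>t. norm (g t - f (x t) (p t))"])
      show "g \<in> borel_measurable (lebesgue_on {s..T})" using g by (rule integrable_imp_measurable)
      show "\<exists>w'\<in>{f y' (p t)}. norm (w' - w) \<le> L * norm (y' - y)"
        if "t \<in> {s..T}" "y \<in> cball 0 r" "y' \<in> cball 0 r" "w \<in> {f y (p t)}" for t y y' w
        using L(2)[OF that(3,2) p(2)[OF that(1)]] that(4) by simp
      show "\<exists>w\<in>{f (x t) (p t)}. norm (w - g t) \<le> norm (g t - f (x t) (p t))" for t
        by (simp add: norm_minus_commute)
      show "x t = x s + integral {s..t} g" if "t \<in> {s..T}" for t by (rule x[OF that])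
    qed (use f(1) graph L(1) gM xr' D in auto)
    then show "\<exists>y v. trajectory F T s y0 y \<and> v integrable_on {s..T} \<and> (\<forall>t\<in>{s..T}. v t = f (y t) (p t)) \<and>
       (\<forall>t\<in>{s..T}. y t = y0 + integral {s..t} v) \<and>
       (\<forall>t\<in>{s..T}. norm (y t - x t) \<le> 3 * exp (2 * L * T) * (integral {s..T} (\<lambda>t. norm (g t - f (x t) (p t))) + norm (y0 - x s)))"
      by (intro exI[of _ y] exI[of _ v]) blast
  qed simp
qed

section \<open>Adjoint arcs\<close>

lemma adjoint_arc_lipschitz_on:
  assumes p: "adjoint_arc F T a x p" and a: "a \<le> T" and x: "\<And>t. t \<in> {a..T} \<Longrightarrow> x t \<in> cball 0 r"
  shows "\<exists>L. L-lipschitz_on {a..T} p"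
proof -
  obtain C where C: "C > 0" "\<forall>x\<in>cball 0 r. \<forall>p w. w \<in> frechet_subdiff UNIV (\<lambda>y. H y p) x \<longrightarrow> norm w \<le> C * norm p"
    using H_subdiff_bound[of r] by blast
  have ac: "abs_continuous_on {a..T} p" using p by (simp add: adjoint_arc_def)
  have "bounded (p ` {a..T})"
    by (intro compact_imp_bounded compact_continuous_image abs_continuous_on_imp_continuous_on[OF ac]) auto
  then obtain m where m: "\<And>t. t \<in> {a..T} \<Longrightarrow> norm (p t) \<le> m" unfolding bounded_iff by blast
  have m0: "0 \<le> m" using m[of a] a norm_ge_zero[of "p a"] by (meson atLeastAtMost_iff order_refl order_trans)
  have "AE t\<in>{a..T} in lebesgue. \<exists>w. (p has_vector_derivative w) (at t within {a..T}) \<and>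
        - w \<in> frechet_subdiff UNIV (\<lambda>y. H y (p t)) (x t)" using p by (simp add: adjoint_arc_def)
  then have "AE t\<in>{a..T} in lebesgue. \<exists>w. (p has_vector_derivative w) (at t within {a..T}) \<and> norm w \<le> C * m"
  proof eventually_elim
    case (elim t)
    show ?case
    proof
      assume t: "t \<in> {a..T}"
      then obtain w where w: "(p has_vector_derivative w) (at t within {a..T})"
        "- w \<in> frechet_subdiff UNIV (\<lambda>y. H y (p t)) (x t)" using elim by blast
      have "norm (- w) \<le> C * norm (p t)" using C(2) x[OF t] w(2) by blast
      also have "\<dots> \<le> C * m" using m[OF t] C(1) by (intro mult_left_mono) auto
      finally show "\<exists>w. (p has_vector_derivative w) (at t within {a..T}) \<and> norm w \<le> C * m" using w(1) by auto
    qed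
  qed
  then show ?thesis using abs_continuous_on_imp_lipschitz_on[OF ac, of "C * m"] C(1) m0 by auto
qed

text \<open>The product \<open>p \<bullet> (y - x)\<close> is almost monotone along an arc \<open>y\<close> that maximizes the Hamiltonian,
  because \<open>- p'\<close> is a subgradient of the semiconvex function \<open>\<lambda>z. H z p\<close> at \<open>x\<close>.\<close>

lemma adjoint_comparison:
  assumes p: "adjoint_arc F T a x p" and a: "a \<le> \<alpha>" "\<alpha> \<le> T"
    and x: "L1-lipschitz_on {a..T} x" "\<And>t. t \<in> {a..T} \<Longrightarrow> x t \<in> cball 0 r"
    and y: "L2-lipschitz_on {\<alpha>..T} y" "\<And>t. t \<in> {\<alpha>..T} \<Longrightarrow> y t \<in> cball 0 r"
    and yd: "AE t\<in>{\<alpha>..T} in lebesgue. \<exists>v. (y has_vector_derivative v) (at t within {\<alpha>..T}) \<and> v \<bullet> p t = H (y t) (p t)"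
    and k: "k integrable_on {\<alpha>..T}"
    and xd: "AE t\<in>{\<alpha>..T} in lebesgue. \<exists>g. (x has_vector_derivative g) (at t within {\<alpha>..T}) \<and> k t \<le> H (x t) (p t) - g \<bullet> p t"
    and c: "c \<ge> 0" "\<forall>x\<in>cball 0 r. \<forall>y\<in>cball 0 r. \<forall>p w. w \<in> frechet_subdiff UNIV (\<lambda>y. H y p) x \<longrightarrow>
      H y p \<ge> H x p + w \<bullet> (y - x) - c * norm p * (norm (y - x))\<^sup>2"
    and m: "\<And>t. t \<in> {\<alpha>..T} \<Longrightarrow> norm (p t) \<le> m"
    and \<Delta>: "\<And>t. t \<in> {\<alpha>..T} \<Longrightarrow> norm (y t - x t) \<le> \<Delta>"
  shows "p \<alpha> \<bullet> (y \<alpha> - x \<alpha>) + integral {\<alpha>..T} k - c * m * \<Delta>\<^sup>2 * (T - \<alpha>) \<le> p T \<bullet> (y T - x T)"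
proof -
  have m0: "0 \<le> m" using m[of \<alpha>] a norm_ge_zero[of "p \<alpha>"] by (meson atLeastAtMost_iff order_refl order_trans)
  have \<Delta>0: "0 \<le> \<Delta>" using \<Delta>[of \<alpha>] a norm_ge_zero[of "y \<alpha> - x \<alpha>"] by (meson atLeastAtMost_iff order_refl order_trans)
  have sub: "{\<alpha>..T} \<subseteq> {a..T}" using a by auto
  obtain L where L: "L-lipschitz_on {a..T} p" using adjoint_arc_lipschitz_on[OF p _ x(2)] a by auto
  have "(m * (L2 + L1) + L * \<Delta>)-lipschitz_on {\<alpha>..T} (\<lambda>t. p t \<bullet> (y t - x t))"
    by (intro lipschitz_on_inner lipschitz_on_subset[OF L sub] m m0 \<Delta> \<Delta>0 lipschitz_on_diff y(1) lipschitz_on_subset[OF x(1) sub])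
  then have ac: "abs_continuous_on {\<alpha>..T} (\<lambda>t. p t \<bullet> (y t - x t))" by (rule lipschitz_on_imp_abs_continuous_on)
  have pd: "AE t\<in>{a..T} in lebesgue. \<exists>w. (p has_vector_derivative w) (at t within {a..T}) \<and>
        - w \<in> frechet_subdiff UNIV (\<lambda>y. H y (p t)) (x t)" using p by (simp add: adjoint_arc_def)
  have "integral {\<alpha>..T} (\<lambda>t. k t - c * m * \<Delta>\<^sup>2) \<le> p T \<bullet> (y T - x T) - p \<alpha> \<bullet> (y \<alpha> - x \<alpha>)"
  proof (rule integral_le_abs_continuous_increment[OF a(2) ac])
    show "(\<lambda>t. k t - c * m * \<Delta>\<^sup>2) integrable_on {\<alpha>..T}" using k by (intro integrable_diff) auto
    show "AE t\<in>{\<alpha>..T} in lebesgue. \<exists>d. ((\<lambda>t. p t \<bullet> (y t - x t)) has_vector_derivative d) (at t within {\<alpha>..T}) \<and>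
        k t - c * m * \<Delta>\<^sup>2 \<le> d"
      using pd yd xd
    proof eventually_elim
      case (elim t)
      show ?case
      proof
        assume t: "t \<in> {\<alpha>..T}"
        then have ta: "t \<in> {a..T}" using sub by blast
        obtain w v g where w: "(p has_vector_derivative w) (at t within {a..T})"
            "- w \<in> frechet_subdiff UNIV (\<lambda>y. H y (p t)) (x t)"
          and v: "(y has_vector_derivative v) (at t within {\<alpha>..T})" "v \<bullet> p t = H (y t) (p t)"
          and g: "(x has_vector_derivative g) (at t within {\<alpha>..T})" "k t \<le> H (x t) (p t) - g \<bullet> p t"
          using elim t ta by blast
        have w': "(p has_vector_derivative w) (at t within {\<alpha>..T})"
          by (rule has_vector_derivative_within_subset[OF w(1) sub])
        \<comment> \<open>The derivative equals
          \<open>H (y t) (p t) - g \<bullet> p t + w \<bullet> (y t - x t)\<close>; the subgradient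
          inequality for \<open>- w\<close> contributes a term that cancels the last
          summand.\<close>
        have d: "((\<lambda>t. p t \<bullet> (y t - x t)) has_vector_derivative (p t \<bullet> (v - g) + w \<bullet> (y t - x t))) (at t within {\<alpha>..T})"
          using bounded_bilinear.has_vector_derivative[OF bounded_bilinear_inner w' has_vector_derivative_diff[OF v(1) g(1)]]
          by simp
        have "H (y t) (p t) \<ge> H (x t) (p t) + (- w) \<bullet> (y t - x t) - c * norm (p t) * (norm (y t - x t))\<^sup>2"
          using c(2) x(2) y(2) t sub w(2) by blast
        moreover have "c * norm (p t) * (norm (y t - x t))\<^sup>2 \<le> c * m * \<Delta>\<^sup>2"
          using c(1) m[OF t] \<Delta>[OF t] m0 by (intro mult_mono power_mono) auto
        ultimately have "k t - c * m * \<Delta>\<^sup>2 \<le> p t \<bullet> (v - g) + w \<bullet> (y t - x t)"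
          using v(2) g(2) by (simp add: inner_diff_right inner_commute)
        with d show "\<exists>d. ((\<lambda>t. p t \<bullet> (y t - x t)) has_vector_derivative d) (at t within {\<alpha>..T}) \<and>
          k t - c * m * \<Delta>\<^sup>2 \<le> d" by blast
      qed
    qed
  qed
  moreover have "integral {\<alpha>..T} (\<lambda>t. k t - c * m * \<Delta>\<^sup>2) = integral {\<alpha>..T} k - c * m * \<Delta>\<^sup>2 * (T - \<alpha>)"
    using k a by (subst Henstock_Kurzweil_Integration.integral_diff) auto
  ultimately show ?thesis by linarith
qed

lemma H_continuous_on: "continuous_on (cball 0 r \<times> UNIV) (\<lambda>z. H (fst z) (snd z))"
  unfolding continuous_on_def
proof
  fix z0 assume z0: "z0 \<in> cball (0::real^'n) r \<times> (UNIV :: (real^'n) set)"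
  let ?S = "cball (0::real^'n) r \<times> (UNIV :: (real^'n) set)"
  obtain L where L: "L > 0" "\<And>y z p. y \<in> cball 0 r \<Longrightarrow> z \<in> cball 0 r \<Longrightarrow> \<bar>H y p - H z p\<bar> \<le> L * norm p * norm (y - z)"
    using H_lipschitz[of r] by blast
  let ?b = "\<lambda>z. L * norm (snd z) * norm (fst z - fst z0) + \<rho> * (1 + norm (fst z0)) * norm (snd z - snd z0)"
  have "(?b \<longlongrightarrow> ?b z0) (at z0 within ?S)" by (intro tendsto_intros)
  then have b0: "(?b \<longlongrightarrow> 0) (at z0 within ?S)" by simp
  have "\<forall>\<^sub>F z in at z0 within ?S. norm (H (fst z) (snd z) - H (fst z0) (snd z0)) \<le> ?b z"
    unfolding eventually_at_filter
  proof (rule always_eventually, intro allI impI)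
    fix z assume "z \<in> ?S"
    then have "\<bar>H (fst z) (snd z) - H (fst z0) (snd z)\<bar> \<le> L * norm (snd z) * norm (fst z - fst z0)"
      using z0 by (intro L(2)) auto
    then show "norm (H (fst z) (snd z) - H (fst z0) (snd z0)) \<le> ?b z"
      using H_diff_le_p[of "fst z0" "snd z" "snd z0"] by (simp add: abs_le_iff)
  qed
  then have "((\<lambda>z. H (fst z) (snd z) - H (fst z0) (snd z0)) \<longlongrightarrow> 0) (at z0 within ?S)"
    using b0 by (rule Lim_null_comparison)
  then show "((\<lambda>z. H (fst z) (snd z)) \<longlongrightarrow> H (fst z0) (snd z0)) (at z0 within ?S)"
    by (rule LIM_zero_cancel)
qed

text \<open>By the mixed difference estimate the subdifferential \<open>\<partial>\<^sub>xH(x,p)\<close> is Lipschitz in \<open>p\<close>,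
  so the adjoint inclusion falls under Filippov's theorem after a reversal of time.\<close>

lemma adjoint_arc_exists:
  assumes tr: "trajectory F T a x0 x" and a: "0 \<le> a" "a \<le> T"
  shows "\<exists>p. adjoint_arc F T a x p \<and> p T = pT"
proof -
  define r where "r = radius (norm x0)"
  have xr: "norm (x t) < r" if "t \<in> {a..T}" for t
    using trajectory_bound[OF tr a order_refl that] by (simp add: r_def)
  have xr': "x t \<in> cball 0 r" if "t \<in> {a..T}" for t using xr[OF that] by simp
  have r0: "0 < r" using xr[of a] a norm_ge_zero[of "x a"] by (meson atLeastAtMost_iff order_refl order_le_less_trans)
  have xc: "continuous_on {a..T} x"
    using tr abs_continuous_on_imp_continuous_on by (auto simp: trajectory_def)
  have "cball (0::real^'n) r \<noteq> {}" using r0 by simp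
  then obtain c0 where c0: "c0 \<ge> 0" "\<And>p. semiconvex_on_with (c0 * norm p) (cball 0 r) (\<lambda>x. H x p)"
    using H_semiconvex[OF _ convex_cball compact_cball] by blast
  define c where "c = c0 / 2"
  have c: "c \<ge> 0" using c0 by (simp add: c_def)
  obtain L where L: "L > 0" "\<And>y z p. y \<in> cball 0 r \<Longrightarrow> z \<in> cball 0 r \<Longrightarrow> \<bar>H y p - H z p\<bar> \<le> L * norm p * norm (y - z)"
    using H_lipschitz[of r] by blast
  obtain L' where L': "L' > 0" "\<And>x y p p'. x \<in> cball 0 r \<Longrightarrow> y \<in> cball 0 r \<Longrightarrow>
    \<bar>(H y p - H x p) - (H y p' - H x p')\<bar> \<le> L' * norm (p - p') * norm (y - x)"
    using H_mixed_difference[of r] by blast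
  obtain C where C: "C > 0" "\<forall>x\<in>cball 0 r. \<forall>p w. w \<in> frechet_subdiff UNIV (\<lambda>y. H y p) x \<longrightarrow> norm w \<le> C * norm p"
    using H_subdiff_bound[of r] by blast
  \<comment> \<open>The subgradients at \<open>x s\<close> described by a quadratic inequality with
    one fixed constant. Each \<open>y\<close> contributes a closed condition in
    \<open>(s,p,w)\<close>, so the graph is closed, which limits of difference quotients would not
    show directly.\<close>
  define K where "K s p = {w. \<forall>y\<in>cball 0 r. w \<bullet> (y - x s) \<le> H y p - H (x s) p + c * norm p * (norm (y - x s))\<^sup>2}" for s p
  have K_sub: "w \<in> frechet_subdiff UNIV (\<lambda>y. H y p) (x s)" if "s \<in> {a..T}" "w \<in> K s p" for s p w
  proof (rule frechet_subdiff_HI[OF xr[OF that(1)] c])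
    fix y :: "real^'n" assume "y \<in> cball 0 r"
    then have "w \<bullet> (y - x s) \<le> H y p - H (x s) p + c * norm p * (norm (y - x s))\<^sup>2" using that(2) unfolding K_def by blast
    then show "H (x s) p + w \<bullet> (y - x s) - c * norm p * (norm (y - x s))\<^sup>2 \<le> H y p" by linarith
  qed
  have K_bd: "norm w \<le> C * norm p" if "s \<in> {a..T}" "w \<in> K s p" for s p w
    using K_sub[OF that] C(2) xr'[OF that(1)] by blast
  have cvx: "convex_on (cball 0 r) (\<lambda>y. H y p - H z p - w \<bullet> (y - z) + c * norm p * (norm (y - z))\<^sup>2)" for p w z
  proof -
    have 1: "convex_on (cball 0 r) (\<lambda>y. H y p + c0 * norm p / 2 * (norm (y - z))\<^sup>2)"
      by (rule semiconvex_imp_convex_on[OF c0(2) convex_cball])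
    have 2: "convex_on (cball 0 r) (\<lambda>y. - H z p - w \<bullet> (y - z))"
      by (rule convex_onI[OF _ convex_cball]) (simp add: algebra_simps inner_diff_right inner_add_right)
    have "convex_on (cball 0 r) (\<lambda>y. (H y p + c0 * norm p / 2 * (norm (y - z))\<^sup>2) + (- H z p - w \<bullet> (y - z)))"
      by (rule convex_on_add[OF 1 2])
    also have "(\<lambda>y. (H y p + c0 * norm p / 2 * (norm (y - z))\<^sup>2) + (- H z p - w \<bullet> (y - z))) =
      (\<lambda>y. H y p - H z p - w \<bullet> (y - z) + c * norm p * (norm (y - z))\<^sup>2)" by (rule ext) (simp add: c_def)
    finally show ?thesis .
  qed
  have K_ne: "K s p \<noteq> {}" if s: "s \<in> {a..T}" for s p
  proof -
    obtain l where "\<And>y. y \<in> cball 0 r \<Longrightarrow> H y p - H (x s) p - 0 \<bullet> (y - x s) + c * norm p * (norm (y - x s))\<^sup>2 \<ge> l \<bullet> (y - x s)"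
    proof (rule convex_minorant_exists[OF cvx[of p "x s" 0] xr'[OF s], of "L * norm p"])
      show "- (L * norm p) * norm (y - x s) \<le> H y p - H (x s) p - 0 \<bullet> (y - x s) + c * norm p * (norm (y - x s))\<^sup>2"
        if "y \<in> cball 0 r" for y
      proof -
        have "0 \<le> c * norm p * (norm (y - x s))\<^sup>2" using c by simp
        then show ?thesis using L(2)[OF that xr'[OF s], of p] by (simp add: abs_le_iff)
      qed
    qed (use L in auto)
    then have "l \<in> K s p" by (simp add: K_def)
    then show ?thesis by blast
  qed
  \<comment> \<open>\<open>L'\<close> comes from the mixed difference of \<open>H\<close>, and
    \<open>2 * r * c\<close> from the change of the quadratic term with \<open>norm p\<close>, using
    that \<open>norm (y - x s)\<close> is at most \<open>2 * r\<close>.\<close>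
  define \<Lambda> where "\<Lambda> = L' + 2 * r * c"
  have \<Lambda>: "\<Lambda> > 0" using L' r0 c by (simp add: \<Lambda>_def add_pos_nonneg)
  have K_lip: "\<exists>w'\<in>K s p'. norm (w' - w) \<le> \<Lambda> * norm (p' - p)" if s: "s \<in> {a..T}" and w: "w \<in> K s p" for s p p' w
  proof -
    \<comment> \<open>Keeping the old subgradient \<open>w\<close> at the new costate violates the
      inequality by at most \<open>\<Lambda> * norm (p' - p) * norm (y - x s)\<close>. The convex
      defect has a linear minorant of that slope, and \<open>l\<close> is the correction turning
      \<open>w\<close> into an element of \<open>K s p'\<close>.\<close>
    obtain l where l: "norm l \<le> \<Lambda> * norm (p' - p)"
      "\<And>y. y \<in> cball 0 r \<Longrightarrow> H y p' - H (x s) p' - w \<bullet> (y - x s) + c * norm p' * (norm (y - x s))\<^sup>2 \<ge> l \<bullet> (y - x s)"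
    proof (rule convex_minorant_exists[OF cvx[of p' "x s" w] xr'[OF s], of "\<Lambda> * norm (p' - p)"])
      show "- (\<Lambda> * norm (p' - p)) * norm (y - x s) \<le> H y p' - H (x s) p' - w \<bullet> (y - x s) + c * norm p' * (norm (y - x s))\<^sup>2"
        if y: "y \<in> cball 0 r" for y
      proof -
        define d where "d = norm (y - x s)"
        have d: "0 \<le> d" "d \<le> 2 * r" using y xr[OF s] norm_triangle_ineq4[of y "x s"] by (auto simp: d_def)
        have 1: "w \<bullet> (y - x s) \<le> H y p - H (x s) p + c * norm p * d\<^sup>2" using w y unfolding K_def d_def by blast
        have 2: "(H y p - H (x s) p) - (H y p' - H (x s) p') \<le> L' * norm (p' - p) * d"
          using L'(2)[OF xr'[OF s] y, of p p'] by (simp add: d_def abs_le_iff norm_minus_commute)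
        have "c * (norm p - norm p') * d\<^sup>2 \<le> c * norm (p' - p) * (2 * r * d)"
        proof -
          have "norm p - norm p' \<le> norm (p' - p)" using norm_triangle_ineq2[of p p'] by (simp add: norm_minus_commute)
          then have "c * (norm p - norm p') * d\<^sup>2 \<le> c * norm (p' - p) * d\<^sup>2" using c by (intro mult_right_mono mult_left_mono) auto
          also have "\<dots> \<le> c * norm (p' - p) * (2 * r * d)"
            using c d by (intro mult_left_mono) (auto simp: power2_eq_square mult_right_mono)
          finally show ?thesis .
        qed
        with 1 2 have "- (L' * norm (p' - p) * d + c * norm (p' - p) * (2 * r * d)) \<le>
            H y p' - H (x s) p' - w \<bullet> (y - x s) + c * norm p' * d\<^sup>2"
          by (simp add: algebra_simps)
        then show ?thesis unfolding d_def[symmetric] by (simp add: \<Lambda>_def algebra_simps)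
      qed
    qed (use \<Lambda> in auto)
    have "w + l \<in> K s p'"
      unfolding K_def using l(2) by (fastforce simp: inner_add_left)
    with l(1) show ?thesis by (intro bexI[of _ "w + l"]) auto
  qed
  \<comment> \<open>Reflecting time about the midpoint of the interval turns the terminal condition
    into an initial one, and the minus sign of the adjoint inclusion disappears.\<close>
  define rv where "rv s = a + T - s" for s
  have rv: "rv s \<in> {a..T} \<longleftrightarrow> s \<in> {a..T}" for s by (auto simp: rv_def)
  obtain P v B where P: "v integrable_on {a..T}" "\<And>s. s \<in> {a..T} \<Longrightarrow> norm (v s) \<le> B"
    "\<And>s. s \<in> {a..T} \<Longrightarrow> v s \<in> K (rv s) (P s)" "\<And>t. t \<in> {a..T} \<Longrightarrow> P t = pT + integral {a..t} v"
  proof (rule filippov[of a T "\<lambda>s. K (rv s)" C \<Lambda> "\<lambda>_. 0" 0 "\<lambda>_. pT" "\<lambda>_. C * norm pT" pT])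
    show "closed {(s,p,w). s \<in> {a..T} \<and> w \<in> K (rv s) p}"
    proof -
      let ?D = "{a..T} \<times> (UNIV :: ((real^'n) \<times> (real^'n)) set)"
      let ?h = "\<lambda>y z. H y (fst (snd z)) - H (x (rv (fst z))) (fst (snd z)) +
        c * norm (fst (snd z)) * (norm (y - x (rv (fst z))))\<^sup>2 - snd (snd z) \<bullet> (y - x (rv (fst z)))"
      have xrc: "continuous_on ?D (\<lambda>z. x (rv (fst z)))"
        by (rule continuous_on_compose2[OF xc]) (auto simp: rv_def intro!: continuous_intros)
      have "continuous_on ?D (\<lambda>z. H y (fst (snd z)))" if "y \<in> cball 0 r" for y
      proof -
        have "continuous_on ?D (\<lambda>z. (y, fst (snd z)))" by (intro continuous_intros)
        moreover have "(\<lambda>z. (y, fst (snd z))) ` ?D \<subseteq> cball 0 r \<times> UNIV" using that by auto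
        ultimately show ?thesis using continuous_on_compose2[OF H_continuous_on[of r]] by fastforce
      qed
      moreover have "continuous_on ?D (\<lambda>z. H (x (rv (fst z))) (fst (snd z)))"
      proof -
        have "continuous_on ?D (\<lambda>z. (x (rv (fst z)), fst (snd z)))" by (intro continuous_intros xrc)
        moreover have "(\<lambda>z. (x (rv (fst z)), fst (snd z))) ` ?D \<subseteq> cball 0 r \<times> UNIV"
          using xr'[OF rv[THEN iffD2]] by auto
        ultimately show ?thesis using continuous_on_compose2[OF H_continuous_on[of r]] by fastforce
      qed
      ultimately have hc: "continuous_on ?D (?h y)" if "y \<in> cball 0 r" for y
        using that xrc by (intro continuous_intros) auto
      have "closed (\<Inter>y\<in>cball 0 r. ?D \<inter> ?h y -` {0..})"
        by (intro closed_INT ballI continuous_closed_preimage hc closed_Times) auto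
      also have "(\<Inter>y\<in>cball 0 r. ?D \<inter> ?h y -` {0..}) = {(s,p,w). s \<in> {a..T} \<and> w \<in> K (rv s) p}"
        using \<open>cball (0::real^'n) r \<noteq> {}\<close> by (auto simp: K_def)
      finally show ?thesis .
    qed
    show "convex (K (rv s) p)" for s p
      unfolding K_def
    proof (rule convexI)
      fix w1 w2 and u v :: real
      assume w: "w1 \<in> {w. \<forall>y\<in>cball 0 r. w \<bullet> (y - x (rv s)) \<le> H y p - H (x (rv s)) p + c * norm p * (norm (y - x (rv s)))\<^sup>2}"
        "w2 \<in> {w. \<forall>y\<in>cball 0 r. w \<bullet> (y - x (rv s)) \<le> H y p - H (x (rv s)) p + c * norm p * (norm (y - x (rv s)))\<^sup>2}"
        and uv: "0 \<le> u" "0 \<le> v" "u + v = 1"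
      have "(u *\<^sub>R w1 + v *\<^sub>R w2) \<bullet> (y - x (rv s)) \<le> H y p - H (x (rv s)) p + c * norm p * (norm (y - x (rv s)))\<^sup>2"
        if "y \<in> cball 0 r" for y
        unfolding inner_add_left inner_scaleR_left
        by (rule convex_bound_le[OF _ _ uv]) (use w that in auto)
      then show "u *\<^sub>R w1 + v *\<^sub>R w2 \<in> {w. \<forall>y\<in>cball 0 r. w \<bullet> (y - x (rv s)) \<le> H y p - H (x (rv s)) p + c * norm p * (norm (y - x (rv s)))\<^sup>2}"
        by blast
    qed
    show "norm w \<le> C * (1 + norm p)" if "s \<in> {a..T}" "w \<in> K (rv s) p" for s p w
      using K_bd[OF rv[THEN iffD2, OF that(1)] that(2)] C(1) by (simp add: distrib_left)
    show "\<exists>w\<in>K (rv s) pT. norm (w - 0) \<le> C * norm pT" if "s \<in> {a..T}" for s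
      using K_ne[OF rv[THEN iffD2, OF that], of pT] K_bd[OF rv[THEN iffD2, OF that], of _ pT] by auto
    show "\<exists>w'\<in>K (rv s) y'. norm (w' - w) \<le> \<Lambda> * norm (y' - y)" if "s \<in> {a..T}" "w \<in> K (rv s) y" for s y y' w
      by (rule K_lip[OF rv[THEN iffD2, OF that(1)] that(2)])
    show "K (rv s) y \<noteq> {}" if "s \<in> {a..T}" for s y by (rule K_ne[OF rv[THEN iffD2, OF that]])
  qed (use a \<Lambda> in auto)
  define p where "p t = P (rv t)" for t
  have B0: "B \<ge> 0" using P(2)[of a] a norm_ge_zero[of "v a"] by (meson atLeastAtMost_iff order_refl order_trans)
  have Pl: "B-lipschitz_on {a..T} P" by (rule indefinite_integral_lipschitz_on[OF P(1,2) B0 P(4)])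
  have pl: "B-lipschitz_on {a..T} p"
  proof (rule lipschitz_onI[OF _ B0])
    fix s t assume "s \<in> {a..T}" "t \<in> {a..T}"
    then show "dist (p s) (p t) \<le> B * dist s t"
      using lipschitz_onD[OF Pl, of "rv s" "rv t"] rv by (simp add: p_def rv_def dist_real_def abs_minus_commute)
  qed
  define E where "E = {t\<in>{a..T}. \<not> ((\<lambda>t. integral {a..t} v) has_vector_derivative v t) (at t within {a..T})}"
  have E: "negligible E"
    using indefinite_integral_has_vector_derivative_AE[OF P(1)] unfolding AE_on_lebesgue_iff E_def .
  \<comment> \<open>The exceptional null set lives in reflected time and has to be carried back by a
    map that preserves negligible sets.\<close>
  have "rv differentiable_on E" unfolding rv_def[abs_def] by (intro derivative_intros)
  then have "negligible (rv ` E)" using E by (intro negligible_differentiable_image_negligible) auto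
  moreover have "{t\<in>{a..T}. \<not> (\<exists>w. (p has_vector_derivative w) (at t within {a..T}) \<and>
      - w \<in> frechet_subdiff UNIV (\<lambda>y. H y (p t)) (x t))} \<subseteq> rv ` E"
  proof (rule subsetI, rule ccontr)
    fix t assume t: "t \<in> {t\<in>{a..T}. \<not> (\<exists>w. (p has_vector_derivative w) (at t within {a..T}) \<and>
      - w \<in> frechet_subdiff UNIV (\<lambda>y. H y (p t)) (x t))}" and tE: "t \<notin> rv ` E"
    have tt: "t \<in> {a..T}" "rv t \<in> {a..T}" "rv (rv t) = t" using t rv by (auto simp: rv_def)
    then have "rv t \<notin> E" using tE by force
    then have d: "((\<lambda>t. integral {a..t} v) has_vector_derivative v (rv t)) (at (rv t) within {a..T})"
      using tt by (simp add: E_def)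
    have "((\<lambda>t. pT + integral {a..t} v) has_vector_derivative v (rv t)) (at (rv t) within {a..T})"
      using d by (auto intro!: derivative_eq_intros)
    then have "(P has_vector_derivative v (rv t)) (at (rv t) within {a..T})"
      by (rule has_vector_derivative_transform[OF tt(2), rotated]) (use P(4) in auto)
    moreover have "rv ` {a..T} = {a..T}"
    proof
      show "{a..T} \<subseteq> rv ` {a..T}"
      proof
        fix s assume "s \<in> {a..T}"
        then have "rv s \<in> {a..T}" "s = rv (rv s)" using rv by (auto simp: rv_def)
        then show "s \<in> rv ` {a..T}" by blast
      qed
    qed (use rv in auto)
    moreover have "(rv has_vector_derivative - 1) (at t within {a..T})"
      unfolding rv_def[abs_def] by (auto intro!: derivative_eq_intros)
    ultimately have "((P \<circ> rv) has_vector_derivative (- 1) *\<^sub>R v (rv t)) (at t within {a..T})"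
      by (intro vector_diff_chain_within) auto
    then have pd: "(p has_vector_derivative - v (rv t)) (at t within {a..T})" by (simp add: p_def[abs_def] o_def)
    have "v (rv t) \<in> K t (p t)" using P(3)[OF tt(2)] tt(3) by (simp add: p_def)
    then have "- (- v (rv t)) \<in> frechet_subdiff UNIV (\<lambda>y. H y (p t)) (x t)" using K_sub[OF tt(1)] by simp
    with pd t show False by blast
  qed
  ultimately have "negligible {t\<in>{a..T}. \<not> (\<exists>w. (p has_vector_derivative w) (at t within {a..T}) \<and>
      - w \<in> frechet_subdiff UNIV (\<lambda>y. H y (p t)) (x t))}" by (rule negligible_subset)
  then have "adjoint_arc F T a x p"
    unfolding adjoint_arc_def AE_on_lebesgue_iff using lipschitz_on_imp_abs_continuous_on[OF pl] by blast
  moreover have "p T = pT" using P(4)[of a] a by (simp add: p_def rv_def)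
  ultimately show ?thesis by blast
qed

end

section \<open>Maximum principle and sensitivity relation\<close>

lemma nonneg_integral_zero_imp_AE_zero:
  fixes h :: "real \<Rightarrow> real"
  assumes h: "h integrable_on {a..b}" "\<And>t. t \<in> {a..b} \<Longrightarrow> 0 \<le> h t" and zero: "integral {a..b} h = 0"
  shows "AE t\<in>{a..b} in lebesgue. h t = 0"
proof -
  have ai: "h absolutely_integrable_on {a..b}" by (rule nonnegative_absolutely_integrable_1[OF h])
  then have i: "integrable lebesgue (\<lambda>t. indicator {a..b} t *\<^sub>R h t)" by (simp add: set_integrable_def)
  have "(LINT t|lebesgue. indicator {a..b} t *\<^sub>R h t) = 0"
    using set_lebesgue_integral_eq_integral(2)[OF ai] zero by (simp add: set_lebesgue_integral_def)
  moreover have "AE t in lebesgue. 0 \<le> indicator {a..b} t *\<^sub>R h t"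
    using h(2) by (intro always_eventually) (auto simp: indicator_def)
  ultimately have "AE t in lebesgue. indicator {a..b} t *\<^sub>R h t = 0"
    using integral_nonneg_eq_0_iff_AE[OF i] by simp
  then show ?thesis by eventually_elim (auto simp: indicator_def)
qed

context mayer_problem
begin

lemma max_velocity_arc_AE:
  assumes y: "v integrable_on {s..T}" "\<And>t. t \<in> {s..T} \<Longrightarrow> v t = f (y t) (p t)"
    "\<And>t. t \<in> {s..T} \<Longrightarrow> y t = y0 + integral {s..t} v"
  shows "AE t\<in>{s..T} in lebesgue. \<exists>w. (y has_vector_derivative w) (at t within {s..T}) \<and> w \<bullet> p t = H (y t) (p t)"
  using indefinite_integral_has_vector_derivative_AE[OF y(1)]
proof eventually_elim
  case (elim t)
  show ?case
  proof
    assume t: "t \<in> {s..T}"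
    then have "((\<lambda>t. y0 + integral {s..t} v) has_vector_derivative v t) (at t within {s..T})"
      using elim by (auto intro!: derivative_eq_intros)
    then have "(y has_vector_derivative v t) (at t within {s..T})"
      by (rule has_vector_derivative_transform[OF t, rotated]) (rule y(3))
    then show "\<exists>w. (y has_vector_derivative w) (at t within {s..T}) \<and> w \<bullet> p t = H (y t) (p t)"
      using f(2) y(2)[OF t] by auto
  qed
qed

text \<open>States the alternative in a form that serves both cases: a positive lower bound if the
  final costate is nonzero, and the upper bound \<open>m = 0\<close> if it vanishes.\<close>

lemma adjoint_arc_bounded_away:
  assumes p: "adjoint_arc F T a x p" and a: "a \<le> T" and x: "\<And>t. t \<in> {a..T} \<Longrightarrow> x t \<in> cball 0 r"
  shows "\<exists>m1 m. 0 \<le> m \<and> (\<forall>t\<in>{a..T}. norm (p t) \<le> m) \<and> (\<forall>t\<in>{a..T}. m1 \<le> norm (p t)) \<and>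
    (p T \<noteq> 0 \<longrightarrow> m1 > 0) \<and> (p T = 0 \<longrightarrow> m = 0)"
proof -
  obtain C where C: "C > 0" "\<forall>x\<in>cball 0 r. \<forall>p w. w \<in> frechet_subdiff UNIV (\<lambda>y. H y p) x \<longrightarrow> norm w \<le> C * norm p"
    using H_subdiff_bound[of r] by blast
  let ?e = "exp (C * (T - a))"
  note b = adjoint_arc_bounds[OF p a x C]
  have e: "exp (C * (T - t)) \<le> ?e" if "t \<in> {a..T}" for t using that C(1) by auto
  have 1: "norm (p t) \<le> norm (p T) * ?e" if "t \<in> {a..T}" for t
    using b(1)[OF _ that] mult_left_mono[OF e[OF that], of "norm (p T)"] by fastforce
  have 2: "norm (p T) / ?e \<le> norm (p t)" if "t \<in> {a..T}" for t
  proof -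
    have "norm (p T) \<le> norm (p t) * ?e"
      using b(2)[OF _ that] mult_left_mono[OF e[OF that], of "norm (p t)"] by fastforce
    then show ?thesis by (simp add: field_simps)
  qed
  show ?thesis
    by (intro exI[of _ "norm (p T) / ?e"] exI[of _ "norm (p T) * ?e"]) (use 1 2 in auto)
qed

text \<open>The gap in the maximum principle dominates \<open>\<kappa> * \<integral>D\<^sup>2\<close> with \<open>D = norm (x' - f x p)\<close>, whereas the cost of
  switching to the maximizing arc at time \<open>\<alpha>\<close> is of order \<open>(\<integral>D)\<^sup>2\<close>. If \<open>D\<close> vanishes after \<open>\<beta>\<close>, the
  Cauchy-Schwarz inequality bounds the latter by \<open>(\<beta> - \<alpha>) * \<integral>D\<^sup>2\<close>, so \<open>D\<close> vanishes after \<open>\<alpha>\<close> too as soon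
  as \<open>\<beta> - \<alpha>\<close> is below a uniform threshold.\<close>

lemma optimal_max_velocity:
  assumes opt: "mayer_optimal F \<phi> T t0 x0 x" and t0: "0 \<le> t0" "t0 \<le> T"
    and q: "q \<in> frechet_superdiff UNIV \<phi> (x T)" and p: "adjoint_arc F T t0 x p" "- p T = q" and q0: "q \<noteq> 0"
  shows "AE t\<in>{t0..T} in lebesgue. (x has_vector_derivative f (x t) (p t)) (at t within {t0..T})"
proof -
  have tr: "trajectory F T t0 x0 x" using opt by (simp add: mayer_optimal_def)
  obtain g E where E: "negligible E" and g: "g integrable_on {t0..T}" and gF: "\<And>t. t \<in> {t0..T} \<Longrightarrow> g t \<in> F (x t)"
    and xg: "\<And>t. t \<in> {t0..T} \<Longrightarrow> x t = x0 + integral {t0..t} g"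
    and gE: "\<And>t. t \<in> {t0..T} - E \<Longrightarrow> (x has_vector_derivative g t) (at t within {t0..T})"
    by (rule trajectory_velocity[OF tr t0(2)]) blast
  define r1 where "r1 = radius (norm x0)"
  define r where "r = radius r1"
  have xr1: "1 + norm (x t) \<le> r1" if "t \<in> {t0..T}" for t
    using trajectory_bound[OF tr t0 order_refl that] by (simp add: r1_def)
  have r1: "0 \<le> r1" using xr1[of t0] t0 norm_ge_zero[of "x t0"] by (meson add_nonneg_nonneg atLeastAtMost_iff order_refl order_trans zero_le_one)
  have r1r: "r1 \<le> r" unfolding r_def by (rule radius_ge[OF r1])
  have xr: "x t \<in> cball 0 r" if "t \<in> {t0..T}" for t using xr1[OF that] r1r by simp
  have xB: "norm (x t) \<le> r1" if "t \<in> {t0..T}" for t using xr1[OF that] by simp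
  obtain m1 m where m: "0 \<le> m" "\<And>t. t \<in> {t0..T} \<Longrightarrow> norm (p t) \<le> m" "\<And>t. t \<in> {t0..T} \<Longrightarrow> m1 \<le> norm (p t)" "m1 > 0"
    proof -
    have "p T \<noteq> 0" using p(2) q0 by auto
    then show thesis using adjoint_arc_bounded_away[OF p(1) t0(2) xr] that by blast
  qed
  have p0: "p t \<noteq> 0" if "t \<in> {t0..T}" for t using m(3)[OF that] m(4) by auto
  have pc: "continuous_on {t0..T} p"
    using p(1) abs_continuous_on_imp_continuous_on by (auto simp: adjoint_arc_def)
  have xl: "(\<rho> * r1)-lipschitz_on {t0..T} x" using trajectory_lipschitz_on[OF tr t0 order_refl] by (simp add: r1_def)
  have xc: "continuous_on {t0..T} x" by (rule lipschitz_on_continuous_on[OF xl])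
  have gM: "norm (g t) \<le> \<rho> * r1" if "t \<in> {t0..T}" for t by (rule velocity_le[OF gF[OF that] xr1[OF that]])
  have fM: "norm (f (x t) (p t)) \<le> \<rho> * r1" if "t \<in> {t0..T}" for t by (rule velocity_le[OF f(1) xr1[OF that]])
  define D where "D t = norm (g t - f (x t) (p t))" for t
  have fx: "continuous_on {t0..T} (\<lambda>t. f (x t) (p t))" by (rule f_along_continuous_on[OF pc p0 xc xr])
  have Di: "(\<lambda>t. D t ^ n) integrable_on {t0..T}" for n
    unfolding D_def by (rule norm_diff_power_integrable_on[OF g gM fx])
  have Di': "(\<lambda>t. D t ^ n) integrable_on {s..t}" if "t0 \<le> s" "t \<le> T" for n s t
    by (rule integrable_on_subinterval[OF Di]) (use that in auto)
  have D1: "D integrable_on {s..t}" if "t0 \<le> s" "t \<le> T" for s t using Di'[OF that, of 1] by (simp only: power_one_right)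
  define DM where "DM = 2 * (\<rho> * r1)"
  have DM: "D t \<le> DM" if "t \<in> {t0..T}" for t
    using norm_triangle_ineq4[of "g t" "f (x t) (p t)"] gM[OF that] fM[OF that] by (simp add: D_def DM_def)
  have DM0: "0 \<le> DM" using \<rho>(1) r1 by (simp add: DM_def)
  obtain R where R: "R > 0" "\<And>z. z \<in> cball 0 r \<Longrightarrow> R_convex R (F z)" using F_R_convex[of r] by blast
  define \<kappa> where "\<kappa> = m1 / (4 * R)"
  have \<kappa>: "\<kappa> > 0" using m(4) R(1) by (simp add: \<kappa>_def)
  have gap: "\<kappa> * (D t)\<^sup>2 \<le> H (x t) (p t) - g t \<bullet> p t" if t: "t \<in> {t0..T}" for t
  proof -
    have "norm (p t) * (D t)\<^sup>2 / (4 * R) \<le> H (x t) (p t) - g t \<bullet> p t"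
      unfolding D_def by (rule H_gap[OF R(2)[OF xr[OF t]] R(1) p0[OF t] gF[OF t]])
    moreover have "\<kappa> * (D t)\<^sup>2 \<le> norm (p t) * (D t)\<^sup>2 / (4 * R)"
    proof -
      have "m1 * (D t)\<^sup>2 \<le> norm (p t) * (D t)\<^sup>2" using m(3)[OF t] by (intro mult_right_mono) auto
      then have "m1 * (D t)\<^sup>2 / (4 * R) \<le> norm (p t) * (D t)\<^sup>2 / (4 * R)" using R(1) by (intro divide_right_mono) auto
      then show ?thesis by (simp add: \<kappa>_def)
    qed
    ultimately show ?thesis by linarith
  qed
  obtain C1 where C1: "C1 > 0" "max_arc_bound r1 C1"
    using max_arc_exists[of r1] by blast
  obtain c where c: "c \<ge> 0" "\<forall>x\<in>cball 0 r. \<forall>y\<in>cball 0 r. \<forall>p w. w \<in> frechet_subdiff UNIV (\<lambda>y. H y p) x \<longrightarrow>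
      H y p \<ge> H x p + w \<bullet> (y - x) - c * norm p * (norm (y - x))\<^sup>2"
    using H_subdiff_ge[of r] by blast
  obtain r\<phi> C\<phi> where \<phi>: "r\<phi> > 0" "C\<phi> \<ge> 0" "\<And>y. norm (y - x T) < r\<phi> \<Longrightarrow> \<phi> y \<le> \<phi> (x T) + q \<bullet> (y - x T) + C\<phi> * (norm (y - x T))\<^sup>2"
    using locally_semiconcave_superdiff_le[OF \<phi>_semiconcave q] by blast
  \<comment> \<open>Collects the coefficients of the squared deviation: the semiconvexity error
    accumulated over time at most \<open>T\<close>, and the semiconcavity error of
    \<open>\<phi>\<close> at the end point.\<close>
  define K where "K = c * m * C1\<^sup>2 * T + C\<phi> * C1\<^sup>2"
  have K: "K \<ge> 0" using c(1) m(1) T_pos \<phi>(2) by (simp add: K_def)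
  \<comment> \<open>The first bound keeps the end point of the competing arc where the quadratic
    estimate of \<open>\<phi>\<close> holds; the second makes \<open>K * \<delta>\<close> at most
    half of \<open>\<kappa>\<close>. Neither depends on the current time.\<close>
  define \<delta> where "\<delta> = min (r\<phi> / (C1 * DM + 1)) (\<kappa> / (2 * (K + 1)))"
  have CD: "C1 * DM + 1 > 0" using C1(1) DM0 by (simp add: add_nonneg_pos)
  have \<delta>: "\<delta> > 0" using \<phi>(1) CD \<kappa> K by (simp add: \<delta>_def)
  define J where "J s = integral {s..T} (\<lambda>t. (D t)\<^sup>2)" for s
  have J0: "0 \<le> J s" if "t0 \<le> s" for s
    unfolding J_def using Di'[OF that order_refl, of 2] by (intro Henstock_Kurzweil_Integration.integral_nonneg) auto
  have step: "J \<alpha> = 0" if \<alpha>: "t0 \<le> \<alpha>" "\<alpha> \<le> \<beta>" "\<beta> \<le> T" "\<beta> - \<alpha> \<le> \<delta>" and J\<beta>: "J \<beta> = 0" for \<alpha> \<beta>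
  proof -
    have \<alpha>T: "0 \<le> \<alpha>" "\<alpha> \<le> T" "\<alpha> \<in> {t0..T}" using \<alpha> t0 by auto
    define I where "I = integral {\<alpha>..T} D"
    have split: "integral {\<alpha>..\<beta>} D + integral {\<beta>..T} D = I" "integral {\<alpha>..\<beta>} (\<lambda>t. (D t)\<^sup>2) + J \<beta> = J \<alpha>"
      unfolding I_def J_def
      using \<alpha> D1[OF \<alpha>(1) order_refl] Di'[OF \<alpha>(1) order_refl, of 2]
      by (auto intro!: Henstock_Kurzweil_Integration.integral_combine)
    \<comment> \<open>From \<open>J \<beta> = 0\<close> the integral of \<open>D\<close> beyond
      \<open>\<beta>\<close> is zero, so \<open>I\<close> comes from the short interval between
      \<open>\<alpha>\<close> and \<open>\<beta>\<close> alone.\<close>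
    have "(integral {\<beta>..T} D)\<^sup>2 \<le> (T - \<beta>) * integral {\<beta>..T} (\<lambda>t. (D t)\<^sup>2)"
      using \<alpha> D1 Di' by (intro integral_square_le) auto
    then have I1: "I = integral {\<alpha>..\<beta>} D" using J\<beta> split(1) unfolding J_def by simp
    have "I\<^sup>2 \<le> (\<beta> - \<alpha>) * integral {\<alpha>..\<beta>} (\<lambda>t. (D t)\<^sup>2)"
      unfolding I1 using \<alpha> D1 Di' by (intro integral_square_le) auto
    also have "\<dots> = (\<beta> - \<alpha>) * J \<alpha>" using split(2) J\<beta> by simp
    also have "\<dots> \<le> \<delta> * J \<alpha>" using \<alpha> J0[OF \<alpha>(1)] by (intro mult_right_mono) auto
    finally have I2: "I\<^sup>2 \<le> \<delta> * J \<alpha>" .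
    have I0: "0 \<le> I" unfolding I_def using D1[OF \<alpha>(1) order_refl]
      by (intro Henstock_Kurzweil_Integration.integral_nonneg) (auto simp: D_def)
    \<comment> \<open>This crude bound only serves to locate \<open>y T\<close>; the decisive
      estimate of \<open>I\<close> is the quadratic one above.\<close>
    have "I \<le> integral {\<alpha>..\<beta>} (\<lambda>_. DM)"
      unfolding I1 using \<alpha> DM D1 by (intro integral_le) auto
    then have "I \<le> DM * \<delta>" using \<alpha> DM0 mult_left_mono[OF \<alpha>(4) DM0] by (simp add: mult.commute)
    then have "C1 * I \<le> C1 * (DM * \<delta>)" using C1(1) by (intro mult_left_mono) auto
    also have "\<dots> < (C1 * DM + 1) * \<delta>" using \<delta> by (simp add: algebra_simps)
    also have "\<dots> \<le> (C1 * DM + 1) * (r\<phi> / (C1 * DM + 1))" using CD by (intro mult_left_mono) (auto simp: \<delta>_def)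
    also have "\<dots> = r\<phi>" using CD by simp
    finally have CI: "C1 * I < r\<phi>" .
    have x\<alpha>: "x t = x \<alpha> + integral {\<alpha>..t} g" if "t \<in> {\<alpha>..T}" for t
    proof -
      have gt: "g integrable_on {t0..t}" by (rule integrable_on_subinterval[OF g]) (use that in auto)
      have "integral {t0..\<alpha>} g + integral {\<alpha>..t} g = integral {t0..t} g"
        by (rule Henstock_Kurzweil_Integration.integral_combine) (use that \<alpha> gt in auto)
      then show ?thesis using xg[of t] xg[OF \<alpha>T(3)] that \<alpha> by (simp add: algebra_simps)
    qed
    have sub: "{\<alpha>..T} \<subseteq> {t0..T}" using \<alpha> by auto
    have "\<exists>y v. trajectory F T \<alpha> (x \<alpha>) y \<and> v integrable_on {\<alpha>..T} \<and> (\<forall>t\<in>{\<alpha>..T}. v t = f (y t) (p t)) \<and>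
       (\<forall>t\<in>{\<alpha>..T}. y t = x \<alpha> + integral {\<alpha>..t} v) \<and>
       (\<forall>t\<in>{\<alpha>..T}. norm (y t - x t) \<le> C1 * (integral {\<alpha>..T} (\<lambda>t. norm (g t - f (x t) (p t))) + norm (x \<alpha> - x \<alpha>)))"
    proof (rule C1(2)[unfolded max_arc_bound_def, rule_format], intro conjI ballI)
      show "g integrable_on {\<alpha>..T}" by (rule integrable_on_subinterval[OF g sub])
      show "continuous_on {\<alpha>..T} p" by (rule continuous_on_subset[OF pc sub])
    qed (use \<alpha>T xB[OF \<alpha>T(3)] gF x\<alpha> p0 sub in blast)+
    then obtain y v where y: "trajectory F T \<alpha> (x \<alpha>) y" "v integrable_on {\<alpha>..T}"
       "\<And>t. t \<in> {\<alpha>..T} \<Longrightarrow> v t = f (y t) (p t)" "\<And>t. t \<in> {\<alpha>..T} \<Longrightarrow> y t = x \<alpha> + integral {\<alpha>..t} v"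
       "\<And>t. t \<in> {\<alpha>..T} \<Longrightarrow> norm (y t - x t) \<le> C1 * I"
      unfolding I_def D_def[abs_def] by auto
    have TT: "T \<in> {\<alpha>..T}" using \<alpha>T by simp
    have ys: "y \<alpha> = x \<alpha>" using y(1) by (simp add: trajectory_def)
    have yr: "y t \<in> cball 0 r" if "t \<in> {\<alpha>..T}" for t
      using trajectory_bound[OF y(1) \<alpha>T(1,2) xB[OF \<alpha>T(3)] that] by (simp add: r_def)
    have "p \<alpha> \<bullet> (y \<alpha> - x \<alpha>) + integral {\<alpha>..T} (\<lambda>t. \<kappa> * (D t)\<^sup>2) - c * m * (C1 * I)\<^sup>2 * (T - \<alpha>) \<le> p T \<bullet> (y T - x T)"
    proof (rule adjoint_comparison[OF p(1) \<alpha>(1) \<alpha>T(2) xl xr trajectory_lipschitz_on[OF y(1) \<alpha>T(1,2) xB[OF \<alpha>T(3)]] yr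
          max_velocity_arc_AE[OF y(2-4)] _ _ c _ y(5)])
      show "(\<lambda>t. \<kappa> * (D t)\<^sup>2) integrable_on {\<alpha>..T}" using Di'[OF \<alpha>(1) order_refl, of 2] by (intro integrable_on_mult_right)
      show "norm (p t) \<le> m" if "t \<in> {\<alpha>..T}" for t using m(2) that sub by blast
      have "AE t in lebesgue. t \<notin> E" using E by (intro AE_not_in) (simp add: negligible_iff_null_sets)
      then show "AE t\<in>{\<alpha>..T} in lebesgue. \<exists>g. (x has_vector_derivative g) (at t within {\<alpha>..T}) \<and> \<kappa> * (D t)\<^sup>2 \<le> H (x t) (p t) - g \<bullet> p t"
      proof eventually_elim
        case (elim t)
        show ?case
        proof
          assume "t \<in> {\<alpha>..T}"
          then have t: "t \<in> {t0..T}" using sub by blast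
          have "(x has_vector_derivative g t) (at t within {\<alpha>..T})"
            by (rule has_vector_derivative_within_subset[OF gE sub]) (use t elim in auto)
          then show "\<exists>g. (x has_vector_derivative g) (at t within {\<alpha>..T}) \<and> \<kappa> * (D t)\<^sup>2 \<le> H (x t) (p t) - g \<bullet> p t"
            using gap[OF t] by blast
        qed
      qed
    qed
    then have A1: "\<kappa> * J \<alpha> - c * m * (C1 * I)\<^sup>2 * (T - \<alpha>) \<le> p T \<bullet> (y T - x T)" by (simp add: ys J_def)
    have yT: "norm (y T - x T) \<le> C1 * I" by (rule y(5)[OF TT])
    \<comment> \<open>The competitor leaves \<open>x\<close> at time \<open>\<alpha>\<close> and
      cannot beat it. Because \<open>p T = - q\<close>, the linear terms of the two estimates
      cancel, leaving the gap integral against \<open>K * I\<^sup>2\<close>.\<close>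
    have "\<phi> (x T) \<le> \<phi> (y T)" using optimal_V_eq[OF opt t0(1) \<alpha>(1) \<alpha>T(2)] V_le[OF \<alpha>T(1,2) y(1)] by simp
    also have "\<dots> \<le> \<phi> (x T) + q \<bullet> (y T - x T) + C\<phi> * (norm (y T - x T))\<^sup>2" by (rule \<phi>(3)) (use yT CI in linarith)
    finally have "p T \<bullet> (y T - x T) \<le> C\<phi> * (norm (y T - x T))\<^sup>2" using p(2) by auto
    also have "\<dots> \<le> C\<phi> * (C1 * I)\<^sup>2" using yT \<phi>(2) by (intro mult_left_mono power_mono) auto
    finally have A2: "p T \<bullet> (y T - x T) \<le> C\<phi> * (C1 * I)\<^sup>2" .
    have "c * m * (C1 * I)\<^sup>2 * (T - \<alpha>) \<le> c * m * (C1 * I)\<^sup>2 * T" using c(1) m(1) \<alpha>T by (intro mult_left_mono) auto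
    with A1 A2 have "\<kappa> * J \<alpha> \<le> K * I\<^sup>2" by (simp add: K_def power_mult_distrib algebra_simps)
    also have "\<dots> \<le> K * (\<delta> * J \<alpha>)" using I2 K by (rule mult_left_mono)
    also have "\<dots> \<le> (K + 1) * (\<kappa> / (2 * (K + 1)) * J \<alpha>)"
      using K J0[OF \<alpha>(1)] \<delta> by (intro mult_mono mult_right_mono mult_nonneg_nonneg) (auto simp: \<delta>_def)
    also have "\<dots> = \<kappa> * J \<alpha> / 2" using K by (simp add: field_simps add_nonneg_eq_0_iff)
    finally have "\<kappa> * J \<alpha> \<le> 0" by simp
    then have "J \<alpha> \<le> 0" using \<kappa> by (simp add: mult_le_0_iff)
    then show ?thesis using J0[OF \<alpha>(1)] by simp
  qed
  \<comment> \<open>Finitely many steps of length \<open>\<delta>\<close> reach \<open>t0\<close>;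
    the maximum truncates the last one.\<close>
  have all: "J (max t0 (T - real n * \<delta>)) = 0" for n
  proof (induction n)
    case 0 then show ?case using t0 by (simp add: J_def)
  next
    case (Suc n)
    show ?case
      by (rule step[OF _ _ _ _ Suc]) (use t0 \<delta> in \<open>auto simp: algebra_simps\<close>)
  qed
  obtain n where "(T - t0) / \<delta> \<le> real n" using real_arch_simple by blast
  then have "T - real n * \<delta> \<le> t0" using \<delta> by (simp add: field_simps)
  then have "J t0 = 0" using all[of n] by (simp add: max_def)
  then have "AE t\<in>{t0..T} in lebesgue. (D t)\<^sup>2 = 0"
    unfolding J_def by (intro nonneg_integral_zero_imp_AE_zero Di) auto
  moreover have "AE t in lebesgue. t \<notin> E" using E by (intro AE_not_in) (simp add: negligible_iff_null_sets)
  ultimately show ?thesis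
  proof eventually_elim
    case (elim t)
    show ?case
    proof
      assume t: "t \<in> {t0..T}"
      then have "g t = f (x t) (p t)" using elim by (simp add: D_def)
      then show "(x has_vector_derivative f (x t) (p t)) (at t within {t0..T})" using gE[of t] t elim by auto
    qed
  qed
qed

text \<open>If \<open>x\<close> itself follows the maximizing velocity, the defect in Filippov's
  estimate is zero, so an arc started at \<open>\<xi>\<close> stays within a multiple of
  \<open>norm (\<xi> - x s)\<close> of \<open>x\<close>. Its final cost then bounds the value with a
  quadratic error, uniformly in \<open>s\<close>.\<close>

lemma value_upper_bound:
  assumes tr: "trajectory F T t0 x0 x" and t0: "0 \<le> t0" "t0 \<le> T"
    and q: "q \<in> frechet_superdiff UNIV \<phi> (x T)" and p: "adjoint_arc F T t0 x p" "- p T = q"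
    and mp: "q \<noteq> 0 \<Longrightarrow> AE t\<in>{t0..T} in lebesgue. (x has_vector_derivative f (x t) (p t)) (at t within {t0..T})"
  obtains C \<eta> where "C \<ge> 0" "\<eta> > 0" "\<And>s \<xi>. s \<in> {t0..T} \<Longrightarrow> norm (\<xi> - x s) < \<eta> \<Longrightarrow>
    V (s, \<xi>) \<le> \<phi> (x T) - p s \<bullet> (\<xi> - x s) + C * (norm (\<xi> - x s))\<^sup>2"
proof -
  \<comment> \<open>The added one leaves room for starting points at distance up to one from the
    arc.\<close>
  define r1 where "r1 = radius (norm x0) + 1"
  define r where "r = radius r1"
  have xr1: "1 + norm (x t) \<le> radius (norm x0)" if "t \<in> {t0..T}" for t
    by (rule trajectory_bound[OF tr t0 order_refl that])
  have xB: "norm (x t) \<le> r1" "norm (x t) + 1 \<le> r1" if "t \<in> {t0..T}" for t using xr1[OF that] by (auto simp: r1_def)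
  have r1: "0 \<le> r1" using xB[of t0] t0 norm_ge_zero[of "x t0"] by (meson atLeastAtMost_iff order_refl order_trans)
  have r1r: "r1 \<le> r" unfolding r_def by (rule radius_ge[OF r1])
  have xr: "x t \<in> cball 0 r" if "t \<in> {t0..T}" for t using xB(1)[OF that] r1r by simp
  obtain m1 m where m: "0 \<le> m" "\<And>t. t \<in> {t0..T} \<Longrightarrow> norm (p t) \<le> m" "\<And>t. t \<in> {t0..T} \<Longrightarrow> m1 \<le> norm (p t)"
    "p T \<noteq> 0 \<Longrightarrow> m1 > 0" "p T = 0 \<Longrightarrow> m = 0"
    using adjoint_arc_bounded_away[OF p(1) t0(2) xr] by blast
  have xl: "(\<rho> * radius (norm x0))-lipschitz_on {t0..T} x" by (rule trajectory_lipschitz_on[OF tr t0 order_refl])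
  have xc: "continuous_on {t0..T} x" by (rule lipschitz_on_continuous_on[OF xl])
  obtain c where c: "c \<ge> 0" "\<forall>x\<in>cball 0 r. \<forall>y\<in>cball 0 r. \<forall>p w. w \<in> frechet_subdiff UNIV (\<lambda>y. H y p) x \<longrightarrow>
      H y p \<ge> H x p + w \<bullet> (y - x) - c * norm p * (norm (y - x))\<^sup>2"
    using H_subdiff_ge[of r] by blast
  obtain r\<phi> C\<phi> where \<phi>: "r\<phi> > 0" "C\<phi> \<ge> 0" "\<And>y. norm (y - x T) < r\<phi> \<Longrightarrow> \<phi> y \<le> \<phi> (x T) + q \<bullet> (y - x T) + C\<phi> * (norm (y - x T))\<^sup>2"
    using locally_semiconcave_superdiff_le[OF \<phi>_semiconcave q] by blast
  \<comment> \<open>Both cases are brought to one statement. For \<open>q = 0\<close> the costate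
    and its bound \<open>m\<close> vanish, so the last inequality is trivial and any nearby
    trajectory will do.\<close>
  have "\<exists>C1>0. \<forall>s\<in>{t0..T}. \<forall>\<xi>. norm (\<xi> - x s) \<le> 1 \<longrightarrow> (\<exists>y. trajectory F T s \<xi> y \<and>
      norm (y T - x T) \<le> C1 * norm (\<xi> - x s) \<and>
      p s \<bullet> (\<xi> - x s) - c * m * (C1 * norm (\<xi> - x s))\<^sup>2 * T \<le> p T \<bullet> (y T - x T))"
  proof (cases "q = 0")
    case True
    then have pT: "p T = 0" using p(2) by simp
    have p0: "p t = 0" if "t \<in> {t0..T}" for t using m(2)[OF that] m(5)[OF pT] by simp
    obtain C1 where C1: "C1 > 0" "\<And>s y0 x. 0 \<le> s \<and> s \<le> T \<and> norm (x s) \<le> r1 \<and> norm y0 \<le> r1 \<and> trajectory F T s (x s) x \<Longrightarrow>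
      (\<exists>y. trajectory F T s y0 y \<and> (\<forall>t\<in>{s..T}. norm (y t - x t) \<le> C1 * norm (y0 - x s)))"
      using trajectory_exists_near[of r1] by blast
    show ?thesis
    proof (intro exI[of _ C1] conjI ballI allI impI C1(1))
      fix s \<xi> assume s: "s \<in> {t0..T}" and \<xi>: "norm (\<xi> - x s) \<le> 1"
      have "norm \<xi> \<le> r1" using norm_triangle_ineq[of "\<xi> - x s" "x s"] \<xi> xB(2)[OF s] by simp
      moreover have "trajectory F T s (x s) x" by (rule trajectory_restrict[OF tr]) (use s in auto)
      ultimately obtain y where y: "trajectory F T s \<xi> y" "\<And>t. t \<in> {s..T} \<Longrightarrow> norm (y t - x t) \<le> C1 * norm (\<xi> - x s)"
        using C1(2)[of s x \<xi>] xB(1)[OF s] s t0 by auto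
      have "T \<in> {s..T}" using s by simp
      then have "norm (y T - x T) \<le> C1 * norm (\<xi> - x s)" by (rule y(2))
      then show "\<exists>y. trajectory F T s \<xi> y \<and> norm (y T - x T) \<le> C1 * norm (\<xi> - x s) \<and>
        p s \<bullet> (\<xi> - x s) - c * m * (C1 * norm (\<xi> - x s))\<^sup>2 * T \<le> p T \<bullet> (y T - x T)"
        using y(1) p0[OF s] pT m(5)[OF pT] by (intro exI[of _ y]) simp
    qed
  next
    case False
    have pT: "p T \<noteq> 0" using False p(2) by auto
    have p0: "p t \<noteq> 0" if "t \<in> {t0..T}" for t using m(3)[OF that] m(4)[OF pT] by auto
    have pc: "continuous_on {t0..T} p"
      using p(1) abs_continuous_on_imp_continuous_on by (auto simp: adjoint_arc_def)
    have fx: "continuous_on {t0..T} (\<lambda>t. f (x t) (p t))" by (rule f_along_continuous_on[OF pc p0 xc xr])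
    obtain C1 where C1: "C1 > 0" "max_arc_bound r1 C1"
      using max_arc_exists[of r1] by blast
    define E where "E = {t\<in>{t0..T}. \<not> (x has_vector_derivative f (x t) (p t)) (at t within {t0..T})}"
    have E: "negligible E" using mp[OF False] unfolding AE_on_lebesgue_iff E_def .
    have ac: "abs_continuous_on {t0..T} x" using tr by (simp add: trajectory_def)
    have xi: "((\<lambda>t. f (x t) (p t)) has_integral (x t - x s)) {s..t}" if "t0 \<le> s" "s \<le> t" "t \<le> T" for s t
      by (rule abs_continuous_has_integral_subinterval[OF that ac E]) (auto simp: E_def)
    show ?thesis
    proof (intro exI[of _ C1] conjI ballI allI impI C1(1))
      fix s \<xi> assume s: "s \<in> {t0..T}" and \<xi>: "norm (\<xi> - x s) \<le> 1"
      have sT: "0 \<le> s" "s \<le> T" "t0 \<le> s" using s t0 by auto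
      have sub: "{s..T} \<subseteq> {t0..T}" using s by auto
      have \<xi>r: "norm \<xi> \<le> r1" using norm_triangle_ineq[of "\<xi> - x s" "x s"] \<xi> xB(2)[OF s] by simp
      have "\<exists>y v. trajectory F T s \<xi> y \<and> v integrable_on {s..T} \<and> (\<forall>t\<in>{s..T}. v t = f (y t) (p t)) \<and>
         (\<forall>t\<in>{s..T}. y t = \<xi> + integral {s..t} v) \<and>
         (\<forall>t\<in>{s..T}. norm (y t - x t) \<le> C1 * (integral {s..T} (\<lambda>t. norm (f (x t) (p t) - f (x t) (p t))) + norm (\<xi> - x s)))"
      proof (rule C1(2)[unfolded max_arc_bound_def, rule_format], intro conjI ballI)
        show "(\<lambda>t. f (x t) (p t)) integrable_on {s..T}" using xi[OF sT(3,2) order_refl] by blast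
        show "continuous_on {s..T} p" by (rule continuous_on_subset[OF pc sub])
        show "x t = x s + integral {s..t} (\<lambda>t. f (x t) (p t))" if "t \<in> {s..T}" for t
          using integral_unique[OF xi[OF sT(3), of t]] that by simp
      qed (use sT xB(1)[OF s] \<xi>r f(1) p0 sub in blast)+
      then obtain y v where y: "trajectory F T s \<xi> y" "v integrable_on {s..T}"
         "\<And>t. t \<in> {s..T} \<Longrightarrow> v t = f (y t) (p t)" "\<And>t. t \<in> {s..T} \<Longrightarrow> y t = \<xi> + integral {s..t} v"
         "\<And>t. t \<in> {s..T} \<Longrightarrow> norm (y t - x t) \<le> C1 * norm (\<xi> - x s)"
        by auto
      have yr: "y t \<in> cball 0 r" if "t \<in> {s..T}" for t
        using trajectory_bound[OF y(1) sT(1,2) \<xi>r that] by (simp add: r_def)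
      have "p s \<bullet> (y s - x s) + integral {s..T} (\<lambda>t. 0) - c * m * (C1 * norm (\<xi> - x s))\<^sup>2 * (T - s) \<le> p T \<bullet> (y T - x T)"
      proof (rule adjoint_comparison[OF p(1) sT(3,2) xl xr trajectory_lipschitz_on[OF y(1) sT(1,2) \<xi>r] yr
            max_velocity_arc_AE[OF y(2-4)] _ _ c _ y(5)])
        show "norm (p t) \<le> m" if "t \<in> {s..T}" for t using m(2) that sub by blast
        show "AE t\<in>{s..T} in lebesgue. \<exists>g. (x has_vector_derivative g) (at t within {s..T}) \<and> 0 \<le> H (x t) (p t) - g \<bullet> p t"
          using mp[OF False]
        proof eventually_elim
          case (elim t)
          show ?case
          proof
            assume "t \<in> {s..T}"
            then have "(x has_vector_derivative f (x t) (p t)) (at t within {t0..T})" using elim sub by blast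
            then have "(x has_vector_derivative f (x t) (p t)) (at t within {s..T})"
              by (rule has_vector_derivative_within_subset[OF _ sub])
            then show "\<exists>g. (x has_vector_derivative g) (at t within {s..T}) \<and> 0 \<le> H (x t) (p t) - g \<bullet> p t"
              using f(2)[of "x t" "p t"] by auto
          qed
        qed
        show "(\<lambda>t. 0::real) integrable_on {s..T}" by (rule integrable_0)
      qed
      moreover have "c * m * (C1 * norm (\<xi> - x s))\<^sup>2 * (T - s) \<le> c * m * (C1 * norm (\<xi> - x s))\<^sup>2 * T"
        using c(1) m(1) sT by (intro mult_left_mono) auto
      moreover have "y s = \<xi>" using y(1) by (simp add: trajectory_def)
      ultimately have "p s \<bullet> (\<xi> - x s) - c * m * (C1 * norm (\<xi> - x s))\<^sup>2 * T \<le> p T \<bullet> (y T - x T)" by simp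
      then show "\<exists>y. trajectory F T s \<xi> y \<and> norm (y T - x T) \<le> C1 * norm (\<xi> - x s) \<and>
        p s \<bullet> (\<xi> - x s) - c * m * (C1 * norm (\<xi> - x s))\<^sup>2 * T \<le> p T \<bullet> (y T - x T)"
        using y(1) y(5)[of T] sT by auto
    qed
  qed
  then obtain C1 where C1: "C1 > 0" "\<And>s \<xi>. s \<in> {t0..T} \<Longrightarrow> norm (\<xi> - x s) \<le> 1 \<Longrightarrow> \<exists>y. trajectory F T s \<xi> y \<and>
      norm (y T - x T) \<le> C1 * norm (\<xi> - x s) \<and>
      p s \<bullet> (\<xi> - x s) - c * m * (C1 * norm (\<xi> - x s))\<^sup>2 * T \<le> p T \<bullet> (y T - x T)"
    by blast
  define C where "C = c * m * C1\<^sup>2 * T + C\<phi> * C1\<^sup>2"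
  have C: "C \<ge> 0" using c(1) m(1) T_pos \<phi>(2) by (simp add: C_def)
  define \<eta> where "\<eta> = min 1 (r\<phi> / C1)"
  have \<eta>: "\<eta> > 0" using \<phi>(1) C1(1) by (simp add: \<eta>_def)
  show thesis
  proof (rule that[OF C \<eta>])
    fix s \<xi> assume s: "s \<in> {t0..T}" and \<xi>: "norm (\<xi> - x s) < \<eta>"
    define d where "d = norm (\<xi> - x s)"
    have d: "d \<le> 1" "C1 * d < r\<phi>" using \<xi> C1(1) by (auto simp: \<eta>_def d_def field_simps)
    obtain y where y: "trajectory F T s \<xi> y" "norm (y T - x T) \<le> C1 * d"
      "p s \<bullet> (\<xi> - x s) - c * m * (C1 * d)\<^sup>2 * T \<le> p T \<bullet> (y T - x T)"
      using C1(2)[OF s] d(1) unfolding d_def by blast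
    have "V (s, \<xi>) \<le> \<phi> (y T)" by (rule V_le[OF _ _ y(1)]) (use s t0 in auto)
    also have "\<dots> \<le> \<phi> (x T) + q \<bullet> (y T - x T) + C\<phi> * (norm (y T - x T))\<^sup>2" by (rule \<phi>(3)) (use y(2) d(2) in linarith)
    also have "\<dots> \<le> \<phi> (x T) - p T \<bullet> (y T - x T) + C\<phi> * (C1 * d)\<^sup>2"
      using p(2) y(2) \<phi>(2) by (auto intro!: mult_left_mono power_mono)
    also have "\<dots> \<le> \<phi> (x T) - p s \<bullet> (\<xi> - x s) + C * d\<^sup>2"
      using y(3) by (simp add: C_def power_mult_distrib algebra_simps)
    finally show "V (s, \<xi>) \<le> \<phi> (x T) - p s \<bullet> (\<xi> - x s) + C * (norm (\<xi> - x s))\<^sup>2" by (simp add: d_def)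
  qed
qed

text \<open>The upper bound is centred at \<open>(s, x s)\<close> with costate \<open>p s\<close>,
  whereas the superdifferential is taken at \<open>(t, x t)\<close>. Replacing \<open>p s\<close> by
  \<open>p t\<close> costs a product of two small quantities, and moving along \<open>x\<close>
  costs \<open>H\<close> times the time increment up to first order.\<close>

lemma optimal_sensitivity:
  assumes opt: "mayer_optimal F \<phi> T t0 x0 x" and t0: "0 \<le> t0" "t0 \<le> T"
    and q: "q \<in> frechet_superdiff UNIV \<phi> (x T)" and p: "adjoint_arc F T t0 x p" "- p T = q"
    and t: "t \<in> {t0<..<T}"
  shows "(H (x t) (p t), - p t) \<in> frechet_superdiff ({0..T} \<times> UNIV) V (t, x t)"
proof -
  have tr: "trajectory F T t0 x0 x" using opt by (simp add: mayer_optimal_def)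
  have mp: "AE t\<in>{t0..T} in lebesgue. (x has_vector_derivative f (x t) (p t)) (at t within {t0..T})" if "q \<noteq> 0"
    by (rule optimal_max_velocity[OF opt t0 q p that])
  define r where "r = radius (norm x0)"
  have xr: "x t \<in> cball 0 r" if "t \<in> {t0..T}" for t
    using trajectory_bound[OF tr t0 order_refl that] by (simp add: r_def)
  define M where "M = \<rho> * radius (norm x0)"
  have xl: "M-lipschitz_on {t0..T} x" unfolding M_def by (rule trajectory_lipschitz_on[OF tr t0 order_refl])
  have M: "M \<ge> 0" using xl by (rule lipschitz_on_nonneg)
  obtain Lp where pl: "Lp-lipschitz_on {t0..T} p" using adjoint_arc_lipschitz_on[OF p(1) t0(2) xr] by blast
  have Lp: "Lp \<ge> 0" using pl by (rule lipschitz_on_nonneg)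
  have tt: "t \<in> {t0..T}" using t by auto
  obtain C \<eta> where C: "C \<ge> 0" "\<eta> > 0" "\<And>s \<xi>. s \<in> {t0..T} \<Longrightarrow> norm (\<xi> - x s) < \<eta> \<Longrightarrow>
    V (s, \<xi>) \<le> \<phi> (x T) - p s \<bullet> (\<xi> - x s) + C * (norm (\<xi> - x s))\<^sup>2"
    using value_upper_bound[OF tr t0 q p mp] by blast
  \<comment> \<open>The claim concerns every \<open>t\<close>, not almost every one. Where
    \<open>p\<close> is nonzero, \<open>x\<close> is the integral of the continuous function
    \<open>\<lambda>t. f (x t) (p t)\<close>, hence differentiable at all times.\<close>
  have dx: "\<exists>\<delta>>0. \<forall>s\<in>{t0..T}. \<bar>s - t\<bar> < \<delta> \<longrightarrow> p t \<bullet> (x s - x t) - H (x t) (p t) * (s - t) \<le> e * \<bar>s - t\<bar>"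
    if e: "e > 0" for e
  proof (cases "p t = 0")
    case True then show ?thesis using e by (intro exI[of _ 1]) auto
  next
    case False
    obtain m1 m where m: "\<And>t. t \<in> {t0..T} \<Longrightarrow> norm (p t) \<le> m" "\<And>t. t \<in> {t0..T} \<Longrightarrow> m1 \<le> norm (p t)"
      "p T \<noteq> 0 \<Longrightarrow> m1 > 0" "p T = 0 \<Longrightarrow> m = 0"
      using adjoint_arc_bounded_away[OF p(1) t0(2) xr] by blast
    have pT: "p T \<noteq> 0" using m(1)[OF tt] m(4) False by auto
    then have q0: "q \<noteq> 0" using p(2) by auto
    have p0: "p t \<noteq> 0" if "t \<in> {t0..T}" for t using m(2)[OF that] m(3)[OF pT] by auto
    have fx: "continuous_on {t0..T} (\<lambda>t. f (x t) (p t))"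
      by (rule f_along_continuous_on[OF lipschitz_on_continuous_on[OF pl] p0 lipschitz_on_continuous_on[OF xl] xr])
    define E where "E = {t\<in>{t0..T}. \<not> (x has_vector_derivative f (x t) (p t)) (at t within {t0..T})}"
    have E: "negligible E" using mp[OF q0] unfolding AE_on_lebesgue_iff E_def .
    have ac: "abs_continuous_on {t0..T} x" using tr by (simp add: trajectory_def)
    have xi: "((\<lambda>t. f (x t) (p t)) has_integral (x s - x t0)) {t0..s}" if "s \<in> {t0..T}" for s
      by (rule abs_continuous_has_integral_subinterval[OF _ _ _ ac E]) (use that in \<open>auto simp: E_def\<close>)
    have "((\<lambda>s. x t0 + integral {t0..s} (\<lambda>t. f (x t) (p t))) has_vector_derivative f (x t) (p t)) (at t within {t0..T})"
      using integral_has_vector_derivative[OF fx tt] by (auto intro!: derivative_eq_intros)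
    then have "(x has_vector_derivative f (x t) (p t)) (at t within {t0..T})"
      by (rule has_vector_derivative_transform[OF tt, rotated]) (use integral_unique[OF xi] in auto)
    moreover have "e / norm (p t) > 0" using e False by simp
    ultimately obtain \<delta> where \<delta>: "\<delta> > 0" "\<forall>s\<in>{t0..T}. norm (s - t) < \<delta> \<longrightarrow>
        norm (x s - x t - (s - t) *\<^sub>R f (x t) (p t)) \<le> e / norm (p t) * norm (s - t)"
      unfolding has_vector_derivative_def has_derivative_within_alt by blast
    show ?thesis
    proof (intro exI[of _ \<delta>] conjI ballI impI \<delta>(1))
      fix s assume s: "s \<in> {t0..T}" "\<bar>s - t\<bar> < \<delta>"
      have "p t \<bullet> (x s - x t) - H (x t) (p t) * (s - t) = p t \<bullet> (x s - x t - (s - t) *\<^sub>R f (x t) (p t))"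
        using f(2)[of "x t" "p t"] by (simp add: inner_diff_right inner_commute)
      also have "\<dots> \<le> norm (p t) * norm (x s - x t - (s - t) *\<^sub>R f (x t) (p t))" by (rule norm_cauchy_schwarz)
      also have "\<dots> \<le> norm (p t) * (e / norm (p t) * norm (s - t))" using \<delta>(2) s by (intro mult_left_mono) auto
      also have "\<dots> = e * \<bar>s - t\<bar>" using False by simp
      finally show "p t \<bullet> (x s - x t) - H (x t) (p t) * (s - t) \<le> e * \<bar>s - t\<bar>" .
    qed
  qed
  show ?thesis
    unfolding frechet_superdiff_iff
  proof (intro allI impI)
    fix e :: real assume e: "e > 0"
    obtain \<delta> where \<delta>: "\<delta> > 0" "\<And>s. s \<in> {t0..T} \<Longrightarrow> \<bar>s - t\<bar> < \<delta> \<Longrightarrow> p t \<bullet> (x s - x t) - H (x t) (p t) * (s - t) \<le> e/2 * \<bar>s - t\<bar>"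
      using dx[of "e/2"] e by auto
    define K where "K = Lp * (1 + M) + C * (1 + M)\<^sup>2"
    have K: "K \<ge> 0" using Lp M C(1) by (simp add: K_def)
    \<comment> \<open>In order: the differentiability estimate for \<open>x\<close>, times inside
      the interval, \<open>\<xi>\<close> close enough to \<open>x s\<close> for the value bound, and
      quadratic terms below half of the allowed error.\<close>
    define \<epsilon> where "\<epsilon> = min (min \<delta> (min (t - t0) (T - t))) (min (\<eta> / (1 + M)) (e / (2 * (K + 1))))"
    have \<epsilon>: "\<epsilon> > 0" using \<delta>(1) t C(2) M e K by (auto simp: \<epsilon>_def)
    show "\<forall>\<^sub>F z in at (t, x t) within {0..T} \<times> UNIV.
        V z - V (t, x t) - (H (x t) (p t), - p t) \<bullet> (z - (t, x t)) \<le> e * norm (z - (t, x t))"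
      unfolding eventually_at
    proof (intro exI[of _ \<epsilon>] conjI ballI impI \<epsilon>)
      fix z :: "real \<times> (real^'n)" assume z: "z \<noteq> (t, x t) \<and> dist z (t, x t) < \<epsilon>"
      obtain s \<xi> where s\<xi>: "z = (s, \<xi>)" by (cases z)
      define n where "n = norm (z - (t, x t))"
      have n: "0 \<le> n" "n < \<epsilon>" using z by (auto simp: n_def dist_norm)
      have hn: "\<bar>s - t\<bar> \<le> n" "norm (\<xi> - x t) \<le> n"
        using norm_fst_le[of "s - t" "\<xi> - x t"] norm_snd_le[of "\<xi> - x t" "s - t"] by (auto simp: n_def s\<xi>)
      have s: "s \<in> {t0..T}" "\<bar>s - t\<bar> < \<delta>" using hn(1) n(2) by (auto simp: \<epsilon>_def)
      have xs: "norm (x s - x t) \<le> M * \<bar>s - t\<bar>" using lipschitz_onD[OF xl s(1) tt] by (simp add: dist_norm)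
      have ps: "norm (p s - p t) \<le> Lp * \<bar>s - t\<bar>" using lipschitz_onD[OF pl s(1) tt] by (simp add: dist_norm)
      have \<xi>s: "norm (\<xi> - x s) \<le> (1 + M) * n"
      proof -
        have "norm (\<xi> - x s) \<le> norm (\<xi> - x t) + norm (x s - x t)"
          using norm_triangle_ineq4[of "\<xi> - x t" "x s - x t"] by simp
        also have "\<dots> \<le> n + M * n" using hn xs mult_left_mono[OF hn(1) M] by linarith
        finally show ?thesis by (simp add: algebra_simps)
      qed
      also have "\<dots> < \<eta>"
      proof -
        have "n < \<eta> / (1 + M)" using n(2) by (simp add: \<epsilon>_def)
        then show ?thesis using M by (simp add: field_simps)
      qed
      finally have V: "V (s, \<xi>) \<le> \<phi> (x T) - p s \<bullet> (\<xi> - x s) + C * (norm (\<xi> - x s))\<^sup>2" by (rule C(3)[OF s(1)])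
      have Vt: "V (t, x t) = \<phi> (x T)" by (rule optimal_V_eq[OF opt t0(1)]) (use tt in auto)
      have "(p t - p s) \<bullet> (\<xi> - x s) \<le> norm (p t - p s) * norm (\<xi> - x s)" by (rule norm_cauchy_schwarz)
      also have "\<dots> \<le> (Lp * n) * ((1 + M) * n)"
        using ps mult_left_mono[OF hn(1) Lp] \<xi>s Lp n(1) by (intro mult_mono) (auto simp: norm_minus_commute)
      finally have 1: "(p t - p s) \<bullet> (\<xi> - x s) \<le> Lp * (1 + M) * n * n" by (simp add: mult_ac)
      have "C * (norm (\<xi> - x s))\<^sup>2 \<le> C * ((1 + M) * n)\<^sup>2" using \<xi>s C(1) by (intro mult_left_mono power_mono) auto
      then have 2: "C * (norm (\<xi> - x s))\<^sup>2 \<le> C * (1 + M)\<^sup>2 * n * n" by (simp add: power2_eq_square mult_ac)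
      have 3: "p t \<bullet> (x s - x t) - H (x t) (p t) * (s - t) \<le> e/2 * n"
        using \<delta>(2)[OF s] mult_left_mono[OF hn(1), of "e/2"] e by linarith
      have 4: "K * n * n \<le> e/2 * n"
      proof -
        have "K * n \<le> (K + 1) * (e / (2 * (K + 1)))" using n K by (intro mult_mono) (auto simp: \<epsilon>_def)
        also have "\<dots> = e/2" using K by (simp add: field_simps add_nonneg_eq_0_iff)
        finally show ?thesis using n(1) by (rule mult_right_mono)
      qed
      have "V z - V (t, x t) - (H (x t) (p t), - p t) \<bullet> (z - (t, x t)) =
          V (s, \<xi>) - \<phi> (x T) - H (x t) (p t) * (s - t) + p t \<bullet> (\<xi> - x t)"
        by (simp add: s\<xi> Vt)
      also have "\<dots> \<le> (p t - p s) \<bullet> (\<xi> - x s) + C * (norm (\<xi> - x s))\<^sup>2 + (p t \<bullet> (x s - x t) - H (x t) (p t) * (s - t))"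
        using V by (simp add: inner_diff_left inner_diff_right)
      also have "\<dots> \<le> K * n * n + e/2 * n" using 1 2 3 by (simp add: K_def algebra_simps)
      also have "\<dots> \<le> e * n" using 4 by simp
      finally show "V z - V (t, x t) - (H (x t) (p t), - p t) \<bullet> (z - (t, x t)) \<le> e * norm (z - (t, x t))" by (simp add: n_def)
    qed
  qed
qed

lemma optimal_maximum_principle:
  assumes opt: "mayer_optimal F \<phi> T t0 x0 x" and t0: "0 \<le> t0" "t0 \<le> T"
    and q: "q \<in> frechet_superdiff UNIV \<phi> (x T)" and p: "adjoint_arc F T t0 x p" "- p T = q"
  shows "AE t\<in>{t0..T} in lebesgue. H (x t) (p t) = p t \<bullet> vector_derivative x (at t within {t0..T})"
proof (cases "q = 0")
  case True
  have tr: "trajectory F T t0 x0 x" using opt by (simp add: mayer_optimal_def)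
  have xr: "x t \<in> cball 0 (radius (norm x0))" if "t \<in> {t0..T}" for t
    using trajectory_bound[OF tr t0 order_refl that] by simp
  obtain m1 m where m: "\<And>t. t \<in> {t0..T} \<Longrightarrow> norm (p t) \<le> m" "p T = 0 \<Longrightarrow> m = 0"
    using adjoint_arc_bounded_away[OF p(1) t0(2) xr] by blast
  have "p t = 0" if "t \<in> {t0..T}" for t using m(1)[OF that] m(2) p(2) True by simp
  then show ?thesis by (intro always_eventually) simp
next
  case False
  show ?thesis
  proof (cases "t0 = T")
    case True
    \<comment> \<open>On a one-point interval \<open>vector_derivative\<close> carries no
      information, but the interval is a null set.\<close>
    have "negligible {t \<in> {T..T}. H (x t) (p t) \<noteq> p t \<bullet> vector_derivative x (at t within {T..T})}"
      by (rule negligible_subset[of "{T}"]) auto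
    then show ?thesis unfolding AE_on_lebesgue_iff True .
  next
    case nT: False
    show ?thesis
      using optimal_max_velocity[OF opt t0 q p False]
    proof eventually_elim
      case (elim t)
      show ?case
      proof
        assume t: "t \<in> {t0..T}"
        then have "vector_derivative x (at t within {t0..T}) = f (x t) (p t)"
          using elim nT t0 vector_derivative_within_cbox[of t0 T t x "f (x t) (p t)"] by auto
        then show "H (x t) (p t) = p t \<bullet> vector_derivative x (at t within {t0..T})"
          using f(2)[of "x t" "p t"] by (simp add: inner_commute)
      qed
    qed
  qed
qed

text \<open>Along \<open>x\<close> the sensitivity relation and the maximum principle bound the upper right Dini
  derivative of \<open>V\<close> by zero almost everywhere, so \<open>V\<close> does not increase along \<open>x\<close>.\<close>

lemma sensitivity_imp_optimal:
  assumes tr: "trajectory F T t0 x0 x" and t0: "0 \<le> t0" "t0 \<le> T"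
    and p: "adjoint_arc F T t0 x p"
    and sens: "\<And>t. t \<in> {t0<..<T} \<Longrightarrow> (H (x t) (p t), - p t) \<in> frechet_superdiff ({0..T} \<times> UNIV) V (t, x t)"
    and mp: "AE t\<in>{t0..T} in lebesgue. H (x t) (p t) = p t \<bullet> vector_derivative x (at t within {t0..T})"
  shows "mayer_optimal F \<phi> T t0 x0 x"
proof -
  have xt0: "x t0 = x0" using tr by (simp add: trajectory_def)
  have "V (T, x T) \<le> V (t0, x t0)"
  proof (cases "t0 = T")
    case False
    then have tT: "t0 < T" using t0 by simp
    define r where "r = radius (norm x0)"
    have xr: "1 + norm (x t) \<le> r" if "t \<in> {t0..T}" for t
      using trajectory_bound[OF tr t0 order_refl that] by (simp add: r_def)
    have xr': "x t \<in> cball 0 r" if "t \<in> {t0..T}" for t using xr[OF that] by simp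
    have r0: "0 \<le> r" using xr[of t0] t0 norm_ge_zero[of "x t0"] by (meson add_nonneg_nonneg atLeastAtMost_iff order_refl order_trans zero_le_one)
    define M where "M = \<rho> * r"
    have xl: "M-lipschitz_on {t0..T} x" unfolding M_def r_def by (rule trajectory_lipschitz_on[OF tr t0 order_refl])
    have M: "M \<ge> 0" using xl by (rule lipschitz_on_nonneg)
    obtain m1 m where m: "0 \<le> m" "\<And>t. t \<in> {t0..T} \<Longrightarrow> norm (p t) \<le> m"
      using adjoint_arc_bounded_away[OF p t0(2) xr'] by blast
    define E1 where "E1 = {t\<in>{t0..T}. \<not> (\<exists>v\<in>F (x t). (x has_vector_derivative v) (at t within {t0..T}))}"
    define E2 where "E2 = {t\<in>{t0..T}. \<not> H (x t) (p t) = p t \<bullet> vector_derivative x (at t within {t0..T})}"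
    have E: "negligible (E1 \<union> E2)"
      using tr mp unfolding trajectory_def AE_on_lebesgue_iff E1_def E2_def by (intro negligible_Un) blast+
    \<comment> \<open>The superdifferential inequality is evaluated along the graph of
      \<open>x\<close>. The Lipschitz constant \<open>M\<close> of \<open>x\<close> converts the
      distance in space-time into at most \<open>(1 + M) * h\<close>, hence the division by
      \<open>1 + M\<close>.\<close>
    have key: "\<forall>\<^sub>F h in at_right 0. V (t + h, x (t + h)) \<le> V (t, x t) + (H (x t) (p t) * h - p t \<bullet> (x (t + h) - x t) + e * h)"
      if t: "t0 < t" "t < T" and e: "e > 0" for t e
    proof -
      have "e / (1 + M) > 0" using e M by simp
      then have "\<forall>\<^sub>F z in at (t, x t) within {0..T} \<times> UNIV.
          V z - V (t, x t) - (H (x t) (p t), - p t) \<bullet> (z - (t, x t)) \<le> e / (1 + M) * norm (z - (t, x t))"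
        using sens[of t] t unfolding frechet_superdiff_iff by auto
      then obtain d where d: "d > 0" "\<And>z. z \<in> {0..T} \<times> UNIV \<Longrightarrow> z \<noteq> (t, x t) \<Longrightarrow> dist z (t, x t) < d \<Longrightarrow>
          V z - V (t, x t) - (H (x t) (p t), - p t) \<bullet> (z - (t, x t)) \<le> e / (1 + M) * norm (z - (t, x t))"
        unfolding eventually_at by blast
      define \<delta> where "\<delta> = min (T - t) (d / (1 + M))"
      have \<delta>: "\<delta> > 0" using t d(1) M by (simp add: \<delta>_def)
      show ?thesis
        unfolding eventually_at_right_field
      proof (intro exI[of _ \<delta>] conjI allI impI \<delta>)
        fix h :: real assume h: "h > 0" "h < \<delta>"
        define z where "z = (t + h, x (t + h))"
        have th: "t + h \<in> {t0..T}" "t \<in> {t0..T}" using h t by (auto simp: \<delta>_def)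
        have "norm (x (t + h) - x t) \<le> M * h" using lipschitz_onD[OF xl th] h by (simp add: dist_norm)
        moreover have "norm (z - (t, x t)) \<le> norm h + norm (x (t + h) - x t)"
          unfolding z_def using norm_Pair_le[of h "x (t + h) - x t"] by simp
        ultimately have n: "norm (z - (t, x t)) \<le> (1 + M) * h" using h by (simp add: algebra_simps)
        have "h < d / (1 + M)" using h(2) by (simp add: \<delta>_def)
        then have "(1 + M) * h < d" using M by (simp add: field_simps)
        with n have "dist z (t, x t) < d" by (simp add: dist_norm)
        moreover have "z \<in> {0..T} \<times> UNIV" "z \<noteq> (t, x t)" using th t0 h by (auto simp: z_def)
        ultimately have "V z - V (t, x t) - (H (x t) (p t), - p t) \<bullet> (z - (t, x t)) \<le> e / (1 + M) * norm (z - (t, x t))"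
          using d(2) by blast
        also have "\<dots> \<le> e / (1 + M) * ((1 + M) * h)" using n e M by (intro mult_left_mono) auto
        also have "\<dots> = e * h" using M by (simp add: add_nonneg_eq_0_iff)
        finally show "V (t + h, x (t + h)) \<le> V (t, x t) + (H (x t) (p t) * h - p t \<bullet> (x (t + h) - x t) + e * h)"
          by (simp add: z_def)
      qed
    qed
    have pos: "\<forall>\<^sub>F h in at_right 0. 0 < h \<and> h < T - t" if "t < T" for t
      using that unfolding eventually_at_right_field by (intro exI[of _ "T - t"]) auto
    show ?thesis
    \<comment> \<open>The crude rate consists of a bound on \<open>H\<close>, a bound on
      \<open>norm p\<close> times the speed, and one for the error term of \<open>key\<close> taken
      with \<open>e = 1\<close>.\<close>
    proof (rule right_dini_nonpos_imp_le[where \<psi>="\<lambda>t. V (t, x t)" and C="\<rho> * (1 + r) * m + m * M + 1", OF tT _ E])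
      show "0 \<le> \<rho> * (1 + r) * m + m * M + 1" using \<rho>(1) r0 m(1) M by simp
      show "\<exists>d>0. \<forall>s t. t0 \<le> s \<and> s \<le> t \<and> t \<le> T \<and> t - s < d \<longrightarrow> V (t, x t) \<le> V (s, x s) + e" if "e > 0" for e
        by (rule V_along_trajectory_lsc[OF tr t0 that])
      show "\<forall>\<^sub>F h in at_right 0. V (t + h, x (t + h)) \<le> V (t, x t) + (\<rho> * (1 + r) * m + m * M + 1) * h"
        if t: "t0 < t" "t < T" for t
        using key[OF t zero_less_one] pos[OF t(2)]
      proof eventually_elim
        case (elim h)
        have th: "t + h \<in> {t0..T}" "t \<in> {t0..T}" using elim t by auto
        have "H (x t) (p t) \<le> \<rho> * (1 + norm (x t)) * norm (p t)" using H_diff_le_p[of "x t" "p t" 0] by (simp add: abs_le_iff)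
        also have "\<dots> \<le> \<rho> * (1 + r) * m" using xr[OF th(2)] m(2)[OF th(2)] \<rho>(1) r0 by (intro mult_mono) auto
        finally have 1: "H (x t) (p t) * h \<le> \<rho> * (1 + r) * m * h" using elim by (intro mult_right_mono) auto
        have "- (p t \<bullet> (x (t + h) - x t)) \<le> norm (p t) * norm (x (t + h) - x t)"
          using Cauchy_Schwarz_ineq2[of "p t" "x (t + h) - x t"] by linarith
        also have "\<dots> \<le> m * (M * h)"
          using lipschitz_onD[OF xl th] m elim th by (intro mult_mono) (auto simp: dist_norm)
        finally have 2: "- (p t \<bullet> (x (t + h) - x t)) \<le> m * (M * h)" .
        show ?case using elim 1 2 by (simp add: algebra_simps)
      qed
      show "\<forall>\<^sub>F h in at_right 0. V (t + h, x (t + h)) \<le> V (t, x t) + e * h"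
        if t: "t0 < t" "t < T" "t \<notin> E1 \<union> E2" and e: "e > 0" for t e
      proof -
        have tt: "t \<in> {t0..T}" using t by auto
        obtain v where v: "(x has_vector_derivative v) (at t within {t0..T})" using t(3) tt by (auto simp: E1_def)
        have "vector_derivative x (at t within {t0..T}) = v"
          using vector_derivative_within_cbox[of t0 T t x v] v tT tt by simp
        then have Hv: "H (x t) (p t) = p t \<bullet> v" using t(3) tt by (auto simp: E2_def)
        define e' where "e' = e / (2 * (m + 1))"
        have e': "e' > 0" using e m(1) by (simp add: e'_def)
        obtain d where d: "d > 0" "\<forall>s\<in>{t0..T}. norm (s - t) < d \<longrightarrow> norm (x s - x t - (s - t) *\<^sub>R v) \<le> e' * norm (s - t)"
          using v e' unfolding has_vector_derivative_def has_derivative_within_alt by blast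
        have dd: "\<forall>\<^sub>F h in at_right 0. h < d"
          using d(1) unfolding eventually_at_right_field by (intro exI[of _ d]) auto
        have "e/2 > 0" using e by simp
        from key[OF t(1,2) this] pos[OF t(2)] dd show ?thesis
        proof eventually_elim
          case (elim h)
          have th: "t + h \<in> {t0..T}" using elim t by auto
          have "norm (x (t + h) - x t - h *\<^sub>R v) \<le> e' * h" using d(2)[rule_format, OF th] elim by simp
          then have "norm (p t) * norm (x (t + h) - x t - h *\<^sub>R v) \<le> (m + 1) * (e' * h)"
            using m(1) m(2)[OF tt] by (intro mult_mono) auto
          also have "\<dots> = e/2 * h" using m(1) by (simp add: e'_def field_simps add_nonneg_eq_0_iff)
          finally have "norm (p t) * norm (x (t + h) - x t - h *\<^sub>R v) \<le> e/2 * h" .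
          moreover have "- (p t \<bullet> (x (t + h) - x t - h *\<^sub>R v)) \<le> norm (p t) * norm (x (t + h) - x t - h *\<^sub>R v)"
            using Cauchy_Schwarz_ineq2[of "p t" "x (t + h) - x t - h *\<^sub>R v"] by linarith
          \<comment> \<open>By the maximum principle the first-order terms cancel, leaving the
            differentiability error of \<open>x\<close> at \<open>t\<close>.\<close>
          ultimately have "H (x t) (p t) * h - p t \<bullet> (x (t + h) - x t) \<le> e/2 * h"
            by (simp add: Hv inner_diff_right algebra_simps)
          then show ?case using elim by linarith
        qed
      qed
    qed
  qed simp
  then have "\<phi> (x T) \<le> V (t0, x0)" by (simp add: V_T xt0)
  moreover have "V (t0, x0) \<le> \<phi> (x T)" by (rule V_le[OF t0 tr])
  ultimately show ?thesis using tr by (simp add: mayer_optimal_def)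
qed

end

theorem theorem4p3:
  fixes F :: "real^'n \<Rightarrow> (real^'n) set"
    and \<phi> :: "real^'n \<Rightarrow> real"
    and T t0 :: real
    and x0 :: "real^'n"
    and xbar :: "real \<Rightarrow> real^'n"
  assumes T_pos: "T > 0"
    and F_values: "\<And>x. F x \<noteq> {} \<and> convex (F x) \<and> compact (F x)"
    and lipschitz: "locally_hausdorff_lipschitz F"
    and growth: "\<exists>\<rho>>0. \<forall>x. \<forall>v\<in>F x. norm v \<le> \<rho> * (1 + norm x)"
    and H_semiconvex: "\<And>K. K \<noteq> {} \<Longrightarrow> convex K \<Longrightarrow> compact K \<Longrightarrow>
      \<exists>c\<ge>0. \<forall>p. semiconvex_on_with (c * norm p) K (\<lambda>x. hamiltonian F x p)"
    and H_gradient: "\<And>K. K \<noteq> {} \<Longrightarrow> convex K \<Longrightarrow> compact K \<Longrightarrow>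
      \<exists>G. (\<forall>x\<in>K. \<forall>p. p \<noteq> 0 \<longrightarrow> GDERIV (hamiltonian F x) p :> G x p) \<and>
          (\<forall>P. compact P \<and> P \<subseteq> - {0} \<longrightarrow>
            (\<forall>x\<in>K. \<exists>e>0. \<exists>L. \<forall>p\<in>P. lipschitz_on L (K \<inter> ball x e) (\<lambda>y. G y p)))"
    and \<phi>_semiconcave: "locally_semiconcave \<phi>"
    and strongly_convex: "locally_strongly_convex F"
    and t0: "t0 \<in> {0..T}"
    and xbar: "trajectory F T t0 x0 xbar"
  shows "mayer_optimal F \<phi> T t0 x0 xbar \<longleftrightarrow>
    (\<forall>q \<in> frechet_superdiff UNIV \<phi> (xbar T). \<forall>p. adjoint_arc F T t0 xbar p \<and> - p T = q \<longrightarrow>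
      (\<forall>t\<in>{t0<..<T}. (hamiltonian F (xbar t) (p t), - p t) \<in>
         frechet_superdiff ({0..T} \<times> UNIV) (value_function F \<phi> T) (t, xbar t)) \<and>
      (AE t\<in>{t0..T} in lebesgue. hamiltonian F (xbar t) (p t) =
         p t \<bullet> vector_derivative xbar (at t within {t0..T})))"
proof -
  interpret mayer_problem F \<phi> T
    by (rule mayer_problem.intro[OF T_pos F_values lipschitz growth H_semiconvex H_gradient \<phi>_semiconcave strongly_convex])
  have t: "0 \<le> t0" "t0 \<le> T" using t0 by auto
  show ?thesis (is "?opt \<longleftrightarrow> ?cond")
  proof
    assume opt: ?opt
    show ?cond
    proof (intro ballI allI impI)
      fix q p assume q: "q \<in> frechet_superdiff UNIV \<phi> (xbar T)" and A: "adjoint_arc F T t0 xbar p \<and> - p T = q"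
      have p: "adjoint_arc F T t0 xbar p" "- p T = q" using A by auto
      show "(\<forall>t\<in>{t0<..<T}. (H (xbar t) (p t), - p t) \<in> frechet_superdiff ({0..T} \<times> UNIV) V (t, xbar t)) \<and>
        (AE t\<in>{t0..T} in lebesgue. H (xbar t) (p t) = p t \<bullet> vector_derivative xbar (at t within {t0..T}))"
        using optimal_sensitivity[OF opt t q p] optimal_maximum_principle[OF opt t q p] by blast
    qed
  next
    assume cond: ?cond
    \<comment> \<open>The condition quantifies universally over \<open>q\<close> and
      \<open>p\<close>; it has content only because a supergradient of \<open>\<phi>\<close> and a
      matching adjoint arc exist. One such pair suffices.\<close>
    obtain q where q: "q \<in> frechet_superdiff UNIV \<phi> (xbar T)"
      using locally_semiconcave_superdiff_nonempty[OF \<phi>_semiconcave] by blast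
    obtain p where p: "adjoint_arc F T t0 xbar p" "p T = - q"
      using adjoint_arc_exists[OF xbar t] by blast
    then have "- p T = q" by simp
    with cond q p(1) show ?opt
      by (intro sensitivity_imp_optimal[OF xbar t p(1)]) blast+
  qed
qed

end
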